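(* Let $X$ be a Lévy process on $\mathbf{R}$ (so $d=1$) with $L^2$-generator $\mathscr{L}$, and let the underlying probability space $(\Omega,\mathscr{F},\mathrm{P})$ be complete. Suppose $b:\mathbf{R}\to\mathbf{R}$ is bounded and globally Lipschitz, and the stochastic heat equation $\partial_tH=\mathscr{L}H+\dot w$, $H(0,\cdot)=0$, has a random-field solution $H$. Then there exist a modification of $H$, still denoted by $H$, and a process $H_b=\{H_b(t,x)\}_{t\ge0,x\in\mathbf{R}}$ with the following properties: (1) $H_b\in L^p_{\mathrm{loc}}(\mathbf{R}_+\times\mathbf{R})$ almost surely, for all $p\in[1,\infty)$. (2) With probability one, $$H_b(t,x)=H(t,x)+\int_0^t\int_{-\infty}^\infty b(H_b(s,x-y))\,p_{t-s}(y)\,dy\,ds\qquad\text{for all }(t,x)\in\mathbf{R}_+\times\mathbf{R}.$$ (3) For all $T>0$, $J$ is a.s. bounded and continuous on $[0,T]\times\mathbf{R}$, where $$J(t,x):=\int_0^t\int_{-\infty}^\infty b(H_b(s,x-y))\,p_{t-s}(y)\,dy\,ds.$$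
   Context: Lévy process: $X_0=0$, $\mathrm{E}\,e^{i\xi X_t}=e^{-t\Psi(\xi)}$; $\mathscr{L}$ is the operator with Fourier multiplier $-\overline{\Psi(\xi)}$, where $\hat f(\xi)=\int_{\mathbf{R}}e^{i\xi x}f(x)\,dx$. $(P^*_tf)(x):=\mathrm{E} f(x-X_t)$. $\mathscr{S}(\mathbf{R})$ is the space of rapidly decreasing test functions; $\dot w$ is space-time white noise on $\mathbf{R}_+\times\mathbf{R}$. The weak solution of the heat equation is $H(t,\phi):=\int_0^t\int_{\mathbf{R}}(P^*_{t-s}\phi)(y)\,w(dy\,ds)$ (Wiener integral), $\phi\in\mathscr{S}(\mathbf{R})$. Random-field solutions: with $d_t(\phi):=\sqrt{\mathrm{E}(|H(t,\phi)|^2)}$, let $M_t$ be the completion of $\mathscr{S}(\mathbf{R})$ inside the space of Schwartz distributions with respect to $d_t(\phi-\psi)$ (distributional limits of $d_t$-Cauchy sequences; void at $t=0$) and $M:=\bigcap_{t\ge0}M_t$. There is a random-field solution iff $\delta_x\in M$ for all $x$; then $H(t,x):=H(t,\delta_x)$ is the $L^2(\mathrm{P})$-extension of $\phi\mapsto H(t,\phi)$ to $\delta_x$. Under the existence of a random-field solution, $X$ has a jointly measurable transition density $\{p_t(x)\}_{t>0,x\in\mathbf{R}}$, i.e. $\mathrm{P}\{X_t\in dx\}=p_t(x)\,dx$, and $(t,x)\mapsto p_t(x)$ is taken uniformly continuous on $[\epsilon,T]\times\mathbf{R}$ for all $\epsilon,T>0$. The process $H_b$ is the (mild) solution of $\partial_tH_b=\mathscr{L}H_b+b(H_b)+\dot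 w$, $H_b(0,\cdot)=0$, understood as the integral equation in (2). *)

theory Defs
  imports "HOL-Probability.Probability"
begin

subsection \<open>Levy processes, their adjoint semigroup and transition densities\<close>

text \<open>
  The index of a process is a real number of which only the values \<open>t \<ge> 0\<close> matter.
\<close>

definition levy_process :: "'o measure \<Rightarrow> (real \<Rightarrow> 'o \<Rightarrow> real) \<Rightarrow> bool" where
  "levy_process N X \<longleftrightarrow>
     prob_space N \<and>
     (\<forall>t\<ge>0. X t \<in> borel_measurable N) \<and>
     (AE \<omega> in N. X 0 \<omega> = 0) \<and>
     (\<forall>(t :: nat \<Rightarrow> real) n. 0 \<le> t 0 \<and> mono_on {..n} t \<longrightarrow>
        prob_space.indep_vars N (\<lambda>_. borel) (\<lambda>i \<omega>. X (t (Suc i)) \<omega> - X (t i) \<omega>) {..<n}) \<and>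
     (\<forall>s\<ge>0. \<forall>t\<ge>0.
        distr N borel (\<lambda>\<omega>. X (s + t) \<omega> - X s \<omega>) = distr N borel (X t)) \<and>
     (AE \<omega> in N. \<forall>t\<ge>0. ((\<lambda>s. X s \<omega>) \<longlongrightarrow> X t \<omega>) (at_right t) \<and>
        (t > 0 \<longrightarrow> (\<exists>l. ((\<lambda>s. X s \<omega>) \<longlongrightarrow> l) (at_left t))))"

text \<open>
  The operator with Fourier multiplier \<open>- cnj (\<Psi> \<xi>)\<close> enters the heat equation only through
  the semigroup below, whose Fourier multiplier is \<open>exp (- t * \<Psi> \<xi>)\<close>.
\<close>

definition adjoint_semigroup ::
  "'o measure \<Rightarrow> (real \<Rightarrow> 'o \<Rightarrow> real) \<Rightarrow> real \<Rightarrow> (real \<Rightarrow> real) \<Rightarrow> real \<Rightarrow> real" where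
  "adjoint_semigroup N X t f x = (\<integral>\<omega>. f (x - X t \<omega>) \<partial>N)"

definition is_transition_density ::
  "'o measure \<Rightarrow> (real \<Rightarrow> 'o \<Rightarrow> real) \<Rightarrow> (real \<Rightarrow> real \<Rightarrow> real) \<Rightarrow> bool" where
  "is_transition_density N X p \<longleftrightarrow>
     (\<lambda>(t, x). p t x) \<in> borel_measurable (restrict_space borel ({0<..} \<times> UNIV)) \<and>
     (\<forall>t>0. \<forall>x. 0 \<le> p t x) \<and>
     (\<forall>t>0. distributed N lborel (X t) (\<lambda>x. ennreal (p t x))) \<and>
     (\<forall>\<epsilon> T. 0 < \<epsilon> \<longrightarrow> 0 < T \<longrightarrow>
        uniformly_continuous_on ({\<epsilon>..T} \<times> UNIV) (\<lambda>(t, x). p t x))"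

text \<open>
  By continuity in \<open>x\<close> such a density is unique at all times \<open>t > 0\<close>; the choice only affects
  the irrelevant values at \<open>t \<le> 0\<close>.
\<close>

definition transition_density ::
  "'o measure \<Rightarrow> (real \<Rightarrow> 'o \<Rightarrow> real) \<Rightarrow> real \<Rightarrow> real \<Rightarrow> real" where
  "transition_density N X = (SOME p. is_transition_density N X p)"


subsection \<open>White noise and the Wiener integral\<close>

definition normal_law :: "real \<Rightarrow> real \<Rightarrow> real measure" where
  "normal_law \<mu> \<sigma> =
     (if \<sigma> = 0 then return borel \<mu> else density lborel (\<lambda>x. ennreal (normal_density \<mu> \<sigma> x)))"

definition gaussian_rv :: "'a measure \<Rightarrow> ('a \<Rightarrow> real) \<Rightarrow> bool" where
  "gaussian_rv M Y \<longleftrightarrow>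
     Y \<in> borel_measurable M \<and> (\<exists>\<mu> \<sigma>. 0 \<le> \<sigma> \<and> distr M borel Y = normal_law \<mu> \<sigma>)"

text \<open>A point \<open>(s, y)\<close> of the index space consists of a time \<open>s \<ge> 0\<close> and a position \<open>y\<close>.\<close>

definition noise_sets :: "(real \<times> real) set set" where
  "noise_sets = {A \<in> sets borel. A \<subseteq> {0..} \<times> UNIV \<and> emeasure lborel A < \<infinity>}"

definition white_noise :: "'a measure \<Rightarrow> ((real \<times> real) set \<Rightarrow> 'a \<Rightarrow> real) \<Rightarrow> bool" where
  "white_noise M w \<longleftrightarrow>
     (\<forall>A\<in>noise_sets. w A \<in> borel_measurable M) \<and>
     (\<forall>F c. finite F \<and> F \<subseteq> noise_sets \<longrightarrow> gaussian_rv M (\<lambda>\<omega>. \<Sum>A\<in>F. c A * w A \<omega>)) \<and>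
     (\<forall>A\<in>noise_sets. (\<integral>\<omega>. w A \<omega> \<partial>M) = 0) \<and>
     (\<forall>A\<in>noise_sets. \<forall>B\<in>noise_sets.
        (\<integral>\<omega>. w A \<omega> * w B \<omega> \<partial>M) = measure lborel (A \<inter> B))"

definition elementary_integrand :: "(real \<times> real \<Rightarrow> real) \<Rightarrow> bool" where
  "elementary_integrand f \<longleftrightarrow> finite (range f) \<and> (\<forall>c. c \<noteq> 0 \<longrightarrow> f -` {c} \<in> noise_sets)"

definition elementary_integral ::
  "((real \<times> real) set \<Rightarrow> 'a \<Rightarrow> real) \<Rightarrow> (real \<times> real \<Rightarrow> real) \<Rightarrow> 'a \<Rightarrow> real" where
  "elementary_integral w f \<omega> = (\<Sum>c\<in>range f. c * w (f -` {c}) \<omega>)"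

definition L2_limit :: "'b measure \<Rightarrow> (nat \<Rightarrow> 'b \<Rightarrow> real) \<Rightarrow> ('b \<Rightarrow> real) \<Rightarrow> bool" where
  "L2_limit M Y Z \<longleftrightarrow>
     Z \<in> borel_measurable M \<and>
     (\<lambda>n. \<integral>\<^sup>+ \<omega>. ennreal ((Y n \<omega> - Z \<omega>)\<^sup>2) \<partial>M) \<longlonglongrightarrow> 0"

definition has_wiener_integral ::
  "'a measure \<Rightarrow> ((real \<times> real) set \<Rightarrow> 'a \<Rightarrow> real) \<Rightarrow> (real \<times> real \<Rightarrow> real)
     \<Rightarrow> ('a \<Rightarrow> real) \<Rightarrow> bool" where
  "has_wiener_integral M w f Y \<longleftrightarrow>
     (\<exists>g. (\<forall>n. elementary_integrand (g n)) \<and> L2_limit lborel g f \<and>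
        L2_limit M (\<lambda>n. elementary_integral w (g n)) Y)"

text \<open>The integral is determined up to almost sure equality; a version is chosen.\<close>

definition wiener_integral ::
  "'a measure \<Rightarrow> ((real \<times> real) set \<Rightarrow> 'a \<Rightarrow> real) \<Rightarrow> (real \<times> real \<Rightarrow> real) \<Rightarrow> 'a \<Rightarrow> real" where
  "wiener_integral M w f = (SOME Y. has_wiener_integral M w f Y)"


subsection \<open>Test functions and distributions\<close>

definition schwartz :: "(real \<Rightarrow> real) set" where
  "schwartz = {\<phi>. (\<forall>n x. (deriv ^^ n) \<phi> field_differentiable at x) \<and>
                  (\<forall>k n. bounded (range (\<lambda>x. x ^ k * (deriv ^^ n) \<phi> x)))}"

definition schwartz_seminorm :: "nat \<Rightarrow> nat \<Rightarrow> (real \<Rightarrow> real) \<Rightarrow> real" where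
  "schwartz_seminorm k n \<phi> = (SUP x. \<bar>x ^ k * (deriv ^^ n) \<phi> x\<bar>)"

text \<open>Only the values of a functional on test functions are relevant.\<close>

definition schwartz_distribution :: "((real \<Rightarrow> real) \<Rightarrow> real) \<Rightarrow> bool" where
  "schwartz_distribution u \<longleftrightarrow>
     (\<forall>\<phi>\<in>schwartz. \<forall>\<psi>\<in>schwartz. \<forall>a b.
        u (\<lambda>x. a * \<phi> x + b * \<psi> x) = a * u \<phi> + b * u \<psi>) \<and>
     (\<exists>C m. \<forall>\<phi>\<in>schwartz. \<bar>u \<phi>\<bar> \<le> C * (\<Sum>k\<le>m. \<Sum>n\<le>m. schwartz_seminorm k n \<phi>))"

definition dirac :: "real \<Rightarrow> (real \<Rightarrow> real) \<Rightarrow> real" where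
  "dirac x \<psi> = \<psi> x"

definition distributional_limit ::
  "(nat \<Rightarrow> real \<Rightarrow> real) \<Rightarrow> ((real \<Rightarrow> real) \<Rightarrow> real) \<Rightarrow> bool" where
  "distributional_limit \<phi> u \<longleftrightarrow>
     (\<forall>\<psi>\<in>schwartz. (\<lambda>n. \<integral>x. \<phi> n x * \<psi> x \<partial>lborel) \<longlonglongrightarrow> u \<psi>)"


subsection \<open>The linear stochastic heat equation\<close>

definition weak_solution ::
  "'o measure \<Rightarrow> (real \<Rightarrow> 'o \<Rightarrow> real) \<Rightarrow> 'a measure \<Rightarrow> ((real \<times> real) set \<Rightarrow> 'a \<Rightarrow> real)
     \<Rightarrow> real \<Rightarrow> (real \<Rightarrow> real) \<Rightarrow> 'a \<Rightarrow> real" where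
  "weak_solution N X M w t \<phi> =
     wiener_integral M w (\<lambda>(s, y). indicator {0..t} s * adjoint_semigroup N X (t - s) \<phi> y)"

definition heat_norm ::
  "'o measure \<Rightarrow> (real \<Rightarrow> 'o \<Rightarrow> real) \<Rightarrow> 'a measure \<Rightarrow> ((real \<times> real) set \<Rightarrow> 'a \<Rightarrow> real)
     \<Rightarrow> real \<Rightarrow> (real \<Rightarrow> real) \<Rightarrow> real" where
  "heat_norm N X M w t \<phi> = sqrt (\<integral>\<omega>. \<bar>weak_solution N X M w t \<phi> \<omega>\<bar>\<^sup>2 \<partial>M)"

definition heat_cauchy ::
  "'o measure \<Rightarrow> (real \<Rightarrow> 'o \<Rightarrow> real) \<Rightarrow> 'a measure \<Rightarrow> ((real \<times> real) set \<Rightarrow> 'a \<Rightarrow> real)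
     \<Rightarrow> real \<Rightarrow> (nat \<Rightarrow> real \<Rightarrow> real) \<Rightarrow> bool" where
  "heat_cauchy N X M w t \<phi> \<longleftrightarrow>
     (\<forall>e>0. \<exists>n0. \<forall>m\<ge>n0. \<forall>n\<ge>n0. heat_norm N X M w t (\<lambda>x. \<phi> m x - \<phi> n x) < e)"

definition heat_completion ::
  "'o measure \<Rightarrow> (real \<Rightarrow> 'o \<Rightarrow> real) \<Rightarrow> 'a measure \<Rightarrow> ((real \<times> real) set \<Rightarrow> 'a \<Rightarrow> real)
     \<Rightarrow> real \<Rightarrow> ((real \<Rightarrow> real) \<Rightarrow> real) set" where
  "heat_completion N X M w t =
     {u. schwartz_distribution u \<and>
         (\<exists>\<phi>. (\<forall>n. \<phi> n \<in> schwartz) \<and> heat_cauchy N X M w t \<phi> \<and> distributional_limit \<phi> u)}"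

definition weak_solution_extension ::
  "'o measure \<Rightarrow> (real \<Rightarrow> 'o \<Rightarrow> real) \<Rightarrow> 'a measure \<Rightarrow> ((real \<times> real) set \<Rightarrow> 'a \<Rightarrow> real)
     \<Rightarrow> real \<Rightarrow> ((real \<Rightarrow> real) \<Rightarrow> real) \<Rightarrow> ('a \<Rightarrow> real) \<Rightarrow> bool" where
  "weak_solution_extension N X M w t u Y \<longleftrightarrow>
     (\<exists>\<phi>. (\<forall>n. \<phi> n \<in> schwartz) \<and> heat_cauchy N X M w t \<phi> \<and> distributional_limit \<phi> u \<and>
        L2_limit M (\<lambda>n. weak_solution N X M w t (\<phi> n)) Y)"

definition random_field_solution ::
  "'o measure \<Rightarrow> (real \<Rightarrow> 'o \<Rightarrow> real) \<Rightarrow> 'a measure \<Rightarrow> ((real \<times> real) set \<Rightarrow> 'a \<Rightarrow> real)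
     \<Rightarrow> (real \<Rightarrow> real \<Rightarrow> 'a \<Rightarrow> real) \<Rightarrow> bool" where
  "random_field_solution N X M w H \<longleftrightarrow>
     (\<forall>x. dirac x \<in> (\<Inter>t\<in>{0..}. heat_completion N X M w t)) \<and>
     (\<forall>t\<ge>0. \<forall>x. weak_solution_extension N X M w t (dirac x) (H t x))"


subsection \<open>Random fields and the drift term\<close>

definition random_field :: "'a measure \<Rightarrow> (real \<Rightarrow> real \<Rightarrow> 'a \<Rightarrow> real) \<Rightarrow> bool" where
  "random_field M Y \<longleftrightarrow> (\<forall>t\<ge>0. \<forall>x. Y t x \<in> borel_measurable M)"

definition modification_of ::
  "'a measure \<Rightarrow> (real \<Rightarrow> real \<Rightarrow> 'a \<Rightarrow> real) \<Rightarrow> (real \<Rightarrow> real \<Rightarrow> 'a \<Rightarrow> real) \<Rightarrow> bool" where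
  "modification_of M Y Z \<longleftrightarrow>
     random_field M Y \<and> (\<forall>t\<ge>0. \<forall>x. AE \<omega> in M. Y t x \<omega> = Z t x \<omega>)"

definition Lp_loc :: "(real \<times> real) set \<Rightarrow> real \<Rightarrow> (real \<times> real \<Rightarrow> real) \<Rightarrow> bool" where
  "Lp_loc S q f \<longleftrightarrow>
     (\<forall>K. compact K \<and> K \<subseteq> S \<longrightarrow>
        set_borel_measurable lborel K f \<and> set_integrable lborel K (\<lambda>z. \<bar>f z\<bar> powr q))"

definition drift_term ::
  "(real \<Rightarrow> real \<Rightarrow> real) \<Rightarrow> (real \<Rightarrow> real) \<Rightarrow> (real \<Rightarrow> real \<Rightarrow> 'a \<Rightarrow> real)
     \<Rightarrow> real \<Rightarrow> real \<Rightarrow> 'a \<Rightarrow> real" where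
  "drift_term p b Y t x \<omega> =
     (LINT s:{0..<t}|lborel. (LINT y|lborel. b (Y s (x - y) \<omega>) * p (t - s) y))"

end

theory Submission
  imports Defs
begin

text \<open>
  Let \<open>\<phi>\<^sub>s\<close> be the characteristic function of \<open>X\<^sub>s\<close>, write \<open>|\<phi>\<^sub>s| = exp (- s \<rho>)\<close>, and let \<open>w\<^sub>t\<close> be the
  integral of \<open>|\<phi>\<^sub>s|\<^sup>2\<close> over \<open>0 \<le> s \<le> t\<close>. By the isometry of the Wiener integral and Plancherel's
  theorem, \<open>d\<^sub>t\<close> is, up to a constant, the norm of the Fourier transform in \<open>L\<^sup>2(w\<^sub>t)\<close>. As
  \<open>\<rho> (\<xi> + \<eta>) \<le> 2 \<rho> \<xi> + 2 \<rho> \<eta>\<close>, the weight \<open>w\<^sub>t\<close> changes at most by a polynomial factor under translations.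
  This makes \<open>d\<^sub>t\<close> closable: the Fourier transforms of a \<open>d\<^sub>t\<close>-Cauchy sequence which converges to a
  point mass at \<open>x\<close> as distributions converge to \<open>exp (i \<xi> x)\<close> in \<open>L\<^sup>2(w\<^sub>t)\<close>.

  Hence \<open>w\<^sub>t\<close> is integrable. It follows that \<open>\<phi>\<^sub>s\<close> is integrable for \<open>s > 0\<close>, so that Fourier inversion
  yields the transition density, and that \<open>H\<close> is continuous in mean square, so that it has a jointly
  measurable modification; being Gaussian, \<open>H\<close> has moments of all orders, and Fubini's theorem
  gives local integrability. Since \<open>b\<close> is bounded and Lipschitz, Picard iteration solves
  \<open>u = J(H + u)\<close> for every fixed path of \<open>H\<close> that is merely measurable, and \<open>H\<^sub>b = H + u\<close>. Finally \<open>J\<close> is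
  continuous because the transition density depends continuously on time and space in \<open>L\<^sup>1\<close>, by
  Scheffe's lemma.

  Constant factors never matter, so the triangle inequality in \<open>L\<^sup>2\<close> is used in the form
  \<open>(a + b)\<^sup>2 \<le> 2 a\<^sup>2 + 2 b\<^sup>2\<close>, and isometries only as two-sided bounds.
\<close>

subsection \<open>Square integrable functions\<close>

text \<open>The hypothesis supplies, for each time, only some sequence of test functions that is
  Cauchy for \<open>d\<^sub>t\<close> and tends to the point mass as a distribution. The obstacle is
  to tie these two modes of convergence together: an exponential is not a test function, so the
  distributional limit says nothing about Fourier transforms at a single frequency. A Gaussian
  factor repairs this. On the Fourier side it averages over normally distributed frequency shifts,
  and the control of the weight under translations is what bounds this average, uniformly as the
  Gaussian flattens. At two space-time points the solution comes with two unrelated approximating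
  sequences. The energy identity is therefore proved for two test functions and two times at once.
  The unknown of the fixed point problem is the drift part, which stays bounded on bounded times,
  while the linear solution need not be bounded. The probability parameter is carried through every
  iterate to keep joint measurability. Null sets enter only through the modification and its
  moments; the equation itself is solved on every path. Norms are squared and take values in
  \<open>ennreal\<close>, so that estimates can precede any proof of integrability.\<close>

definition sq_norm :: "'b measure \<Rightarrow> ('b \<Rightarrow> real) \<Rightarrow> ennreal" where
  "sq_norm M f = (\<integral>\<^sup>+ x. ennreal ((f x)\<^sup>2) \<partial>M)"

lemma sq_add_le: "((a :: real) + b)\<^sup>2 \<le> 2 * a\<^sup>2 + 2 * b\<^sup>2"
proof -
  have "0 \<le> (a - b)\<^sup>2" by simp
  then show ?thesis by (simp add: power2_eq_square algebra_simps)
qed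

lemma sq_norm_add_le:
  assumes [measurable]: "f \<in> borel_measurable M" "g \<in> borel_measurable M"
  shows "sq_norm M (\<lambda>x. f x + g x) \<le> 2 * sq_norm M f + 2 * sq_norm M g"
proof -
  have "ennreal ((f x + g x)\<^sup>2) \<le> 2 * ennreal ((f x)\<^sup>2) + 2 * ennreal ((g x)\<^sup>2)" for x
  proof -
    have "2 * ennreal ((f x)\<^sup>2) + 2 * ennreal ((g x)\<^sup>2) = ennreal (2 * (f x)\<^sup>2 + 2 * (g x)\<^sup>2)"
      by (simp add: ennreal_mult')
    then show ?thesis using sq_add_le[of "f x" "g x"] by (simp add: ennreal_leI del: ennreal_plus)
  qed
  then have "sq_norm M (\<lambda>x. f x + g x) \<le> (\<integral>\<^sup>+x. 2 * ennreal ((f x)\<^sup>2) + 2 * ennreal ((g x)\<^sup>2) \<partial>M)"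
    unfolding sq_norm_def by (intro nn_integral_mono)
  also have "\<dots> = 2 * sq_norm M f + 2 * sq_norm M g"
    unfolding sq_norm_def by (subst nn_integral_add) (simp_all add: nn_integral_cmult)
  finally show ?thesis .
qed

lemma sq_norm_triangle:
  assumes [measurable]: "f \<in> borel_measurable M" "g \<in> borel_measurable M" "h \<in> borel_measurable M"
  shows "sq_norm M (\<lambda>x. f x - h x) \<le> 2 * sq_norm M (\<lambda>x. f x - g x) + 2 * sq_norm M (\<lambda>x. g x - h x)"
  using sq_norm_add_le[of "\<lambda>x. f x - g x" M "\<lambda>x. g x - h x"] by simp

lemma sq_norm_le_diff:
  assumes [measurable]: "f \<in> borel_measurable M" "g \<in> borel_measurable M"
  shows "sq_norm M f \<le> 2 * sq_norm M (\<lambda>x. f x - g x) + 2 * sq_norm M g"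
  using sq_norm_add_le[of "\<lambda>x. f x - g x" M g] by simp

lemma sq_norm_commute: "sq_norm M (\<lambda>x. f x - g x) = sq_norm M (\<lambda>x. g x - f x)"
  unfolding sq_norm_def by (simp add: power2_commute)

lemma L2_limit_iff:
  "L2_limit M Y Z \<longleftrightarrow> Z \<in> borel_measurable M \<and> (\<lambda>n. sq_norm M (\<lambda>x. Y n x - Z x)) \<longlonglongrightarrow> 0"
  unfolding L2_limit_def sq_norm_def ..

text \<open>The integral of the pointwise series of squares is the sum of the squared norms, so that
  series converges almost everywhere and its terms tend to 0.\<close>

lemma AE_tendsto_zero_of_sq_norm:
  assumes [measurable]: "\<And>n. D n \<in> borel_measurable M"
    and "(\<Sum>n. sq_norm M (D n)) < \<infinity>"
  shows "AE x in M. (\<lambda>n. D n x) \<longlonglongrightarrow> 0"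
proof -
  have "(\<integral>\<^sup>+x. (\<Sum>n. ennreal ((D n x)\<^sup>2)) \<partial>M) = (\<Sum>n. sq_norm M (D n))"
    unfolding sq_norm_def by (rule nn_integral_suminf) simp
  then have "AE x in M. (\<Sum>n. ennreal ((D n x)\<^sup>2)) \<noteq> \<infinity>"
    using assms(2) by (intro nn_integral_PInf_AE) auto
  then show ?thesis
  proof eventually_elim
    case (elim x)
    then have "summable (\<lambda>n. (D n x)\<^sup>2)"
      by (intro summable_suminf_not_top) auto
    then have "(\<lambda>n. (D n x)\<^sup>2) \<longlonglongrightarrow> 0" by (rule summable_LIMSEQ_zero)
    then have "(\<lambda>n. sqrt ((D n x)\<^sup>2)) \<longlonglongrightarrow> sqrt 0" by (rule tendsto_real_sqrt)
    then show ?case by (simp add: tendsto_rabs_zero_iff)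
  qed
qed

text \<open>On a probability space the bound of \<open>\<bar>d\<bar>\<close> by 2^(-n) plus 2^n
  times the square of \<open>d\<close> does the work of Cauchy-Schwarz. With squared norms below
  4^(-n) both terms contribute 2^(-n), and the telescoping series converges absolutely almost
  everywhere.\<close>

lemma (in prob_space) AE_convergent_of_sq_norm:
  assumes [measurable]: "\<And>n. Y n \<in> borel_measurable M"
    and small: "\<And>n. sq_norm M (\<lambda>x. Y (Suc n) x - Y n x) \<le> ennreal ((1/4) ^ n)"
  shows "AE x in M. convergent (\<lambda>n. Y n x)"
proof -
  let ?D = "\<lambda>n x. Y (Suc n) x - Y n x"
  have bound: "(\<integral>\<^sup>+x. ennreal \<bar>?D n x\<bar> \<partial>M) \<le> ennreal (2 * (1/2) ^ n)" for n
  proof -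
    have "\<bar>?D n x\<bar> \<le> (1/2) ^ n + 2 ^ n * (?D n x)\<^sup>2" for x
    proof -
      have "0 \<le> ((1/2) ^ n - \<bar>?D n x\<bar>)\<^sup>2" by simp
      then have "2 * (1/2) ^ n * \<bar>?D n x\<bar> \<le> ((1/2) ^ n)\<^sup>2 + (?D n x)\<^sup>2"
        by (simp add: power2_diff)
      then have "2 ^ n * (2 * (1/2) ^ n * \<bar>?D n x\<bar>) \<le> 2 ^ n * (((1/2) ^ n)\<^sup>2 + (?D n x)\<^sup>2)"
        by (rule mult_left_mono) simp
      also have "2 ^ n * (((1/2) ^ n)\<^sup>2 + (?D n x)\<^sup>2) = (1/2) ^ n + 2 ^ n * (?D n x)\<^sup>2"
        by (simp add: algebra_simps power2_eq_square power_divide)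
      also have "2 ^ n * (2 * (1/2) ^ n * \<bar>?D n x\<bar>) = 2 * \<bar>?D n x\<bar>"
        by (simp add: power_divide)
      finally show ?thesis by (rule order_trans[rotated]) simp
    qed
    then have "(\<integral>\<^sup>+x. ennreal \<bar>?D n x\<bar> \<partial>M) \<le> (\<integral>\<^sup>+x. ennreal ((1/2) ^ n) + ennreal (2 ^ n) * ennreal ((?D n x)\<^sup>2) \<partial>M)"
      by (intro nn_integral_mono) (simp add: ennreal_leI flip: ennreal_mult ennreal_plus)
    also have "\<dots> = ennreal ((1/2) ^ n) + ennreal (2 ^ n) * sq_norm M (?D n)"
      unfolding sq_norm_def
      by (subst nn_integral_add) (simp_all add: nn_integral_cmult emeasure_space_1)
    also have "\<dots> \<le> ennreal ((1/2) ^ n) + ennreal (2 ^ n) * ennreal ((1/4) ^ n)"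
      by (intro add_left_mono mult_left_mono small) simp
    also have "\<dots> = ennreal (2 * (1/2) ^ n)"
    proof -
      have "(2::real) ^ n * (1/4) ^ n = (1/2) ^ n" by (simp flip: power_mult_distrib)
      then show ?thesis by (simp flip: ennreal_mult ennreal_plus)
    qed
    finally show ?thesis .
  qed
  have sums: "(\<Sum>n. ennreal (2 * (1/2) ^ n)) < \<infinity>"
  proof -
    have "summable (\<lambda>n. 2 * (1/2 :: real) ^ n)" by (intro summable_mult summable_geometric) simp
    then show ?thesis by (subst suminf_ennreal2) auto
  qed
  have "(\<integral>\<^sup>+x. (\<Sum>n. ennreal \<bar>?D n x\<bar>) \<partial>M) = (\<Sum>n. \<integral>\<^sup>+x. ennreal \<bar>?D n x\<bar> \<partial>M)"
    by (rule nn_integral_suminf) simp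
  also have "\<dots> \<le> (\<Sum>n. ennreal (2 * (1/2) ^ n))"
    by (intro suminf_le bound) auto
  finally have "(\<integral>\<^sup>+x. (\<Sum>n. ennreal \<bar>?D n x\<bar>) \<partial>M) < \<infinity>" using sums by (rule le_less_trans)
  then have "AE x in M. (\<Sum>n. ennreal \<bar>?D n x\<bar>) \<noteq> \<infinity>"
    by (intro nn_integral_PInf_AE) auto
  then show ?thesis
  proof eventually_elim
    case (elim x)
    then have "summable (\<lambda>n. \<bar>?D n x\<bar>)" by (intro summable_suminf_not_top) auto
    then have "summable (\<lambda>n. ?D n x)" by (rule summable_rabs_cancel)
    then have "convergent (\<lambda>n. \<Sum>k<n. ?D k x)" by (simp add: summable_iff_convergent)
    then have "convergent (\<lambda>n. Y 0 x + (\<Sum>k<n. ?D k x))" by (rule convergent_add[OF convergent_const])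
    moreover have "Y 0 x + (\<Sum>k<n. ?D k x) = Y n x" for n by (induction n) auto
    ultimately show ?case by simp
  qed
qed

text \<open>Riesz-Fischer: a subsequence with geometric rate converges almost everywhere, and
  Fatou's lemma along it bounds the distance of every late member of the sequence to that
  limit.\<close>

lemma (in prob_space) L2_complete:
  assumes [measurable]: "\<And>n. Y n \<in> borel_measurable M"
    and cauchy: "\<And>e. e > 0 \<Longrightarrow> \<exists>n0. \<forall>m\<ge>n0. \<forall>n\<ge>n0. sq_norm M (\<lambda>x. Y m x - Y n x) \<le> ennreal e"
  shows "\<exists>Z. L2_limit M Y Z"
proof -
  have "\<exists>n0. \<forall>m\<ge>n0. \<forall>n\<ge>n0. sq_norm M (\<lambda>x. Y m x - Y n x) \<le> ennreal ((1/4) ^ k)" for k :: nat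
    by (rule cauchy) simp
  then obtain N where N: "\<And>k m n. m \<ge> N k \<Longrightarrow> n \<ge> N k \<Longrightarrow>
      sq_norm M (\<lambda>x. Y m x - Y n x) \<le> ennreal ((1/4) ^ k)" by metis
  \<comment> \<open>The sum makes both \<open>r k\<close> and \<open>r (Suc k)\<close> at least
    \<open>N k\<close>; the summand \<open>k\<close> drives the indices to infinity.\<close>
  define r where "r k = k + (\<Sum>i\<le>k. N i)" for k
  have "N k \<le> (\<Sum>i\<le>k. N i)" for k by (rule member_le_sum) auto
  then have r_ge: "r k \<ge> N k" "r (Suc k) \<ge> N k" "r k \<ge> k" for k
    unfolding r_def by (simp_all add: trans_le_add2 trans_le_add1 le_SucI)
  define Z where "Z x = lim (\<lambda>k. Y (r k) x)" for x
  have [measurable]: "Z \<in> borel_measurable M"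
    unfolding Z_def by measurable
  have "AE x in M. convergent (\<lambda>k. Y (r k) x)"
    by (rule AE_convergent_of_sq_norm) (auto intro: N r_ge)
  then have conv: "AE x in M. (\<lambda>k. Y (r k) x) \<longlonglongrightarrow> Z x"
    by eventually_elim (simp add: Z_def convergent_LIMSEQ_iff)
  have "(\<lambda>n. sq_norm M (\<lambda>x. Y n x - Z x)) \<longlonglongrightarrow> 0"
  proof (rule tendsto_sandwich[OF _ _ tendsto_const])
    show "\<forall>\<^sub>F n in sequentially. 0 \<le> sq_norm M (\<lambda>x. Y n x - Z x)" by simp
    have key: "sq_norm M (\<lambda>x. Y n x - Z x) \<le> ennreal e"
      if n0: "\<And>m n. m \<ge> n0 \<Longrightarrow> n \<ge> n0 \<Longrightarrow> sq_norm M (\<lambda>x. Y m x - Y n x) \<le> ennreal e" and n: "n \<ge> n0" for n0 e n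
    proof -
      have "sq_norm M (\<lambda>x. Y n x - Z x) = (\<integral>\<^sup>+x. liminf (\<lambda>k. ennreal ((Y n x - Y (r k) x)\<^sup>2)) \<partial>M)"
        unfolding sq_norm_def
      proof (rule nn_integral_cong_AE)
        show "AE x in M. ennreal ((Y n x - Z x)\<^sup>2) = liminf (\<lambda>k. ennreal ((Y n x - Y (r k) x)\<^sup>2))"
          using conv
        proof eventually_elim
          case (elim x)
          then have "(\<lambda>k. ennreal ((Y n x - Y (r k) x)\<^sup>2)) \<longlonglongrightarrow> ennreal ((Y n x - Z x)\<^sup>2)"
            by (intro tendsto_intros)
          then show ?case by (intro lim_imp_Liminf[symmetric]) simp_all
        qed
      qed
      also have "\<dots> \<le> liminf (\<lambda>k. sq_norm M (\<lambda>x. Y n x - Y (r k) x))"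
        unfolding sq_norm_def by (rule nn_integral_liminf) simp
      also have "\<dots> \<le> ennreal e"
      proof (rule Liminf_le)
        show "\<forall>\<^sub>F k in sequentially. sq_norm M (\<lambda>x. Y n x - Y (r k) x) \<le> ennreal e"
          using eventually_ge_at_top[of n0]
          by eventually_elim (intro n0 n order_trans[OF _ r_ge(3)])
      qed simp
      finally show ?thesis .
    qed
    \<comment> \<open>The bound \<open>key\<close> holds from some index on; the tail supremum packs
      it into a majorant that tends to 0.\<close>
    define u where "u n = (SUP m\<in>{n..}. sq_norm M (\<lambda>x. Y m x - Z x))" for n
    show "\<forall>\<^sub>F n in sequentially. sq_norm M (\<lambda>x. Y n x - Z x) \<le> u n"
      unfolding u_def by (intro always_eventually allI SUP_upper) simp
    show "u \<longlonglongrightarrow> 0"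
    proof (rule order_tendstoI)
      fix a :: ennreal assume "0 < a"
      then obtain e where e: "0 < e" "ennreal e < a"
        by (metis ennreal_lt_0 ennreal_less_zero_iff linorder_neqE_linordered_idom dense ennreal_cases less_top_ennreal not_less_zero order_less_trans top.not_eq_extremum)
      then obtain n0 where n0: "\<And>m n. m \<ge> n0 \<Longrightarrow> n \<ge> n0 \<Longrightarrow> sq_norm M (\<lambda>x. Y m x - Y n x) \<le> ennreal e"
        using cauchy by meson
      show "\<forall>\<^sub>F n in sequentially. u n < a"
        using eventually_ge_at_top[of n0]
      proof eventually_elim
        case (elim n)
        have "u n \<le> ennreal e" unfolding u_def
          by (rule SUP_least, rule key[OF n0]) (use elim in auto)
        then show ?case using e by simp
      qed
    qed simp
  qed
  then show ?thesis unfolding L2_limit_iff by (intro exI[of _ Z]) simp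
qed

text \<open>An inequality between approximants survives in the limit, even across different measure
  spaces. Two uses of \<open>sq_add_le\<close> cost the factor 4, rounded up to 8. Applied both ways
  round, it extends the isometry of elementary integrals.\<close>

lemma L2_limit_comparison:
  assumes [measurable]: "\<And>n. a n \<in> borel_measurable M1" "\<And>n. b n \<in> borel_measurable M2"
    and eq: "\<And>n. sq_norm M1 (a n) \<le> sq_norm M2 (b n)"
    and lim: "L2_limit M1 a A" "L2_limit M2 b B"
  shows "sq_norm M1 A \<le> 8 * sq_norm M2 B"
proof -
  have [measurable]: "A \<in> borel_measurable M1" "B \<in> borel_measurable M2"
    using lim by (auto simp: L2_limit_iff)
  have le: "sq_norm M1 A \<le> 2 * sq_norm M1 (\<lambda>x. a n x - A x) + (4 * sq_norm M2 (\<lambda>x. b n x - B x) + 4 * sq_norm M2 B)" for n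
  proof -
    have "sq_norm M1 A \<le> 2 * sq_norm M1 (\<lambda>x. A x - a n x) + 2 * sq_norm M1 (a n)"
      by (rule sq_norm_le_diff) simp_all
    also have "\<dots> \<le> 2 * sq_norm M1 (\<lambda>x. a n x - A x) + 2 * (2 * sq_norm M2 (\<lambda>x. b n x - B x) + 2 * sq_norm M2 B)"
      by (subst sq_norm_commute) (intro add_left_mono mult_left_mono order_trans[OF eq] sq_norm_le_diff; simp)
    finally show ?thesis by (simp add: distrib_left flip: mult.assoc)
  qed
  have "(\<lambda>n. 2 * sq_norm M1 (\<lambda>x. a n x - A x) + (4 * sq_norm M2 (\<lambda>x. b n x - B x) + 4 * sq_norm M2 B))
      \<longlonglongrightarrow> 2 * 0 + (4 * 0 + 4 * sq_norm M2 B)"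
    using lim unfolding L2_limit_iff by (intro tendsto_add ennreal_tendsto_cmult tendsto_const) auto
  then have "sq_norm M1 A \<le> 2 * 0 + (4 * 0 + 4 * sq_norm M2 B)"
    by (rule LIMSEQ_le_const) (use le in auto)
  also have "\<dots> \<le> 8 * sq_norm M2 B" by (auto intro: mult_right_mono)
  finally show ?thesis .
qed

lemma L2_limit_diff:
  assumes [measurable]: "\<And>n. a n \<in> borel_measurable M" "\<And>n. b n \<in> borel_measurable M"
    and lim: "L2_limit M a A" "L2_limit M b B"
  shows "L2_limit M (\<lambda>n x. a n x - b n x) (\<lambda>x. A x - B x)"
proof -
  have [measurable]: "A \<in> borel_measurable M" "B \<in> borel_measurable M"
    using lim by (auto simp: L2_limit_iff)
  have "(\<lambda>n. sq_norm M (\<lambda>x. a n x - b n x - (A x - B x))) \<longlonglongrightarrow> 0"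
  proof (rule tendsto_sandwich[OF _ _ tendsto_const])
    show "\<forall>\<^sub>F n in sequentially. sq_norm M (\<lambda>x. a n x - b n x - (A x - B x))
        \<le> 2 * sq_norm M (\<lambda>x. a n x - A x) + 2 * sq_norm M (\<lambda>x. b n x - B x)"
    proof (intro always_eventually allI)
      fix n
      have "sq_norm M (\<lambda>x. (a n x - A x) + (B x - b n x))
        \<le> 2 * sq_norm M (\<lambda>x. a n x - A x) + 2 * sq_norm M (\<lambda>x. B x - b n x)"
        by (rule sq_norm_add_le) simp_all
      then show "sq_norm M (\<lambda>x. a n x - b n x - (A x - B x))
        \<le> 2 * sq_norm M (\<lambda>x. a n x - A x) + 2 * sq_norm M (\<lambda>x. b n x - B x)"
        unfolding sq_norm_commute[of M B "b n"] by (simp add: algebra_simps)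
    qed
    have "(\<lambda>n. 2 * sq_norm M (\<lambda>x. a n x - A x) + 2 * sq_norm M (\<lambda>x. b n x - B x)) \<longlonglongrightarrow> 2 * 0 + 2 * 0"
      using lim unfolding L2_limit_iff by (intro tendsto_add ennreal_tendsto_cmult) auto
    then show "(\<lambda>n. 2 * sq_norm M (\<lambda>x. a n x - A x) + 2 * sq_norm M (\<lambda>x. b n x - B x)) \<longlonglongrightarrow> 0" by simp
  qed simp
  then show ?thesis by (simp add: L2_limit_iff)
qed

text \<open>The indices are picked with squared error at most 2^(-k). The bound
  \<open>r k \<ge> k\<close> is all that Fatou's lemma along \<open>r\<close> asks for.\<close>

lemma L2_limit_subsequence:
  assumes lim: "L2_limit M Y Z" and [measurable]: "\<And>n. Y n \<in> borel_measurable M"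
  obtains r where "\<And>k::nat. r k \<ge> k" "AE x in M. (\<lambda>k. Y (r k) x) \<longlonglongrightarrow> Z x"
proof -
  have [measurable]: "Z \<in> borel_measurable M" using lim by (simp add: L2_limit_iff)
  have "\<exists>m\<ge>k. sq_norm M (\<lambda>x. Y m x - Z x) \<le> ennreal ((1/2) ^ k)" for k
  proof -
    have "(\<lambda>n. sq_norm M (\<lambda>x. Y n x - Z x)) \<longlonglongrightarrow> 0" using lim by (simp add: L2_limit_iff)
    then have "\<forall>\<^sub>F n in sequentially. sq_norm M (\<lambda>x. Y n x - Z x) < ennreal ((1/2) ^ k)"
      by (rule order_tendstoD) simp
    then have "\<forall>\<^sub>F n in sequentially. n \<ge> k \<and> sq_norm M (\<lambda>x. Y n x - Z x) < ennreal ((1/2) ^ k)"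
      using eventually_ge_at_top by (rule eventually_conj[rotated])
    then show ?thesis unfolding eventually_sequentially by (meson order_refl less_imp_le)
  qed
  then obtain r where r: "\<And>k. r k \<ge> k" "\<And>k. sq_norm M (\<lambda>x. Y (r k) x - Z x) \<le> ennreal ((1/2) ^ k)"
    by metis
  have "(\<Sum>k. sq_norm M (\<lambda>x. Y (r k) x - Z x)) \<le> (\<Sum>k. ennreal ((1/2) ^ k))"
    by (intro suminf_le r) auto
  also have "\<dots> < \<infinity>"
    by (subst suminf_ennreal2) (auto intro: summable_geometric)
  finally have "AE x in M. (\<lambda>k. Y (r k) x - Z x) \<longlonglongrightarrow> 0"
    by (intro AE_tendsto_zero_of_sq_norm) auto
  then have "AE x in M. (\<lambda>k. Y (r k) x) \<longlonglongrightarrow> Z x"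
    by eventually_elim (simp add: LIM_zero_cancel)
  with r(1) that show thesis by blast
qed

text \<open>Fatou's lemma along an almost everywhere convergent subsequence. It hands the moment
  bounds of Gaussian approximants to their limits in mean square.\<close>

lemma L2_limit_moment:
  assumes lim: "L2_limit M Y Z" and [measurable]: "\<And>n. Y n \<in> borel_measurable M"
    and bound: "\<forall>\<^sub>F n in sequentially. (\<integral>\<^sup>+x. ennreal (Y n x ^ (2 * k)) \<partial>M) \<le> B"
  shows "(\<integral>\<^sup>+x. ennreal (Z x ^ (2 * k)) \<partial>M) \<le> B"
proof -
  obtain r where r: "\<And>k::nat. r k \<ge> k" and conv: "AE x in M. (\<lambda>k. Y (r k) x) \<longlonglongrightarrow> Z x"
    using L2_limit_subsequence[OF lim] assms(2) by blast
  have "(\<integral>\<^sup>+x. ennreal (Z x ^ (2 * k)) \<partial>M) = (\<integral>\<^sup>+x. liminf (\<lambda>i. ennreal (Y (r i) x ^ (2 * k))) \<partial>M)"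
  proof (rule nn_integral_cong_AE)
    show "AE x in M. ennreal (Z x ^ (2 * k)) = liminf (\<lambda>i. ennreal (Y (r i) x ^ (2 * k)))"
      using conv
    proof eventually_elim
      case (elim x)
      then have "(\<lambda>i. ennreal (Y (r i) x ^ (2 * k))) \<longlonglongrightarrow> ennreal (Z x ^ (2 * k))"
        by (intro tendsto_intros)
      then show ?case by (intro lim_imp_Liminf[symmetric]) simp_all
    qed
  qed
  also have "\<dots> \<le> liminf (\<lambda>i. \<integral>\<^sup>+x. ennreal (Y (r i) x ^ (2 * k)) \<partial>M)"
    by (rule nn_integral_liminf) simp
  also have "\<dots> \<le> B"
  proof (rule Liminf_le)
    obtain n0 where "\<And>n. n \<ge> n0 \<Longrightarrow> (\<integral>\<^sup>+x. ennreal (Y n x ^ (2 * k)) \<partial>M) \<le> B"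
      using bound unfolding eventually_sequentially by blast
    then show "\<forall>\<^sub>F i in sequentially. (\<integral>\<^sup>+x. ennreal (Y (r i) x ^ (2 * k)) \<partial>M) \<le> B"
      unfolding eventually_sequentially using r order_trans by blast
  qed simp
  finally show ?thesis .
qed

lemma L2_limit_eventually_less:
  assumes "L2_limit M Y Z" "0 < e"
  shows "\<forall>\<^sub>F n in sequentially. sq_norm M (\<lambda>x. Y n x - Z x) < e"
  using assms order_tendstoD(2) unfolding L2_limit_iff by fast

subsection \<open>The Wiener integral\<close>

lemma sets_normal_law [simp, measurable_cong]: "sets (normal_law \<mu> \<sigma>) = sets borel"
  by (simp add: normal_law_def)

lemma integrable_normal_law_power:
  assumes "0 \<le> \<sigma>"
  shows "integrable (normal_law \<mu> \<sigma>) (\<lambda>x. (x - \<mu>) ^ k)"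
proof (cases "\<sigma> = 0")
  case True
  then show ?thesis by (simp add: normal_law_def integrable_iff_bounded nn_integral_return)
next
  case False
  then have "\<sigma> > 0" using assms by simp
  then show ?thesis using False integrable_normal_moment[of \<sigma> \<mu> k]
    by (simp add: normal_law_def integrable_real_density normal_density_nonneg)
qed

lemma integral_normal_law: "0 \<le> \<sigma> \<Longrightarrow> (\<integral>x. x - \<mu> \<partial>normal_law \<mu> \<sigma>) = 0"
proof (cases "\<sigma> = 0")
  case False
  assume "0 \<le> \<sigma>"
  then have "\<sigma> > 0" using False by simp
  then show ?thesis using False integral_normal_moment_odd[of \<sigma> \<mu> 0]
    by (simp add: normal_law_def integral_real_density normal_density_nonneg)
qed (simp add: normal_law_def integral_return)

lemma prob_space_normal_law: "0 \<le> \<sigma> \<Longrightarrow> prob_space (normal_law \<mu> \<sigma>)"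
  by (cases "\<sigma> = 0") (auto simp: normal_law_def intro: prob_space_return prob_space_normal_density)

text \<open>The double factorial of 2k - 1: the moment of order 2k of the standard normal
  law.\<close>

definition gaussian_moment :: "nat \<Rightarrow> real" where
  "gaussian_moment k = fact (2 * k) / (2 ^ k * fact k)"

lemma nn_integral_normal_law_even:
  assumes "0 \<le> \<sigma>"
  shows "(\<integral>\<^sup>+x. ennreal (x ^ (2 * k)) \<partial>normal_law 0 \<sigma>) = ennreal (gaussian_moment k * (\<sigma>\<^sup>2) ^ k)"
proof (cases "\<sigma> = 0")
  case True
  then show ?thesis by (cases k) (auto simp: normal_law_def nn_integral_return gaussian_moment_def)
next
  case False
  then have "\<sigma> > 0" using assms by simp
  then have eq: "has_bochner_integral lborel (\<lambda>x. normal_density 0 \<sigma> x * x ^ (2 * k)) (gaussian_moment k * (\<sigma>\<^sup>2) ^ k)"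
    using normal_moment_even[of \<sigma> 0 k] by (simp add: gaussian_moment_def power_divide field_simps)
  have "(\<integral>\<^sup>+x. ennreal (x ^ (2 * k)) \<partial>normal_law 0 \<sigma>) = (\<integral>\<^sup>+x. ennreal (normal_density 0 \<sigma> x * x ^ (2 * k)) \<partial>lborel)"
    using False by (simp add: normal_law_def nn_integral_density ennreal_mult normal_density_nonneg zero_le_even_power)
  also have "\<dots> = ennreal (gaussian_moment k * (\<sigma>\<^sup>2) ^ k)"
    using eq by (subst nn_integral_eq_integral)
      (auto simp: has_bochner_integral_iff normal_density_nonneg zero_le_even_power)
  finally show ?thesis .
qed

lemma gaussian_rv_integrable:
  assumes "gaussian_rv M Y"
  shows "integrable M Y" "integrable M (\<lambda>x. (Y x)\<^sup>2)"
proof -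
  obtain \<mu> \<sigma> where [measurable]: "Y \<in> borel_measurable M" and \<sigma>: "0 \<le> \<sigma>" and D: "distr M borel Y = normal_law \<mu> \<sigma>"
    using assms unfolding gaussian_rv_def by blast
  note I = integrable_normal_law_power[OF \<sigma>, of \<mu>]
  interpret P: prob_space "normal_law \<mu> \<sigma>" by (rule prob_space_normal_law[OF \<sigma>])
  have 1: "integrable (normal_law \<mu> \<sigma>) (\<lambda>x. (x - \<mu>) + \<mu>)"
    using I[of 1] by (intro Bochner_Integration.integrable_add) auto
  then have "integrable (distr M borel Y) (\<lambda>x. x)" by (simp add: D)
  then show "integrable M Y" by (subst (asm) integrable_distr_eq) auto
  have "integrable (normal_law \<mu> \<sigma>) (\<lambda>x. (x - \<mu>)\<^sup>2 + 2 * \<mu> * (x - \<mu>) + \<mu>\<^sup>2)"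
    using I[of 1] by (intro Bochner_Integration.integrable_add I integrable_mult_right) auto
  also have "(\<lambda>x. (x - \<mu>)\<^sup>2 + 2 * \<mu> * (x - \<mu>) + \<mu>\<^sup>2) = (\<lambda>x. x\<^sup>2)"
    by (simp add: fun_eq_iff power2_eq_square algebra_simps)
  finally have "integrable (distr M borel Y) (\<lambda>x. x\<^sup>2)" by (simp add: D)
  then show "integrable M (\<lambda>x. (Y x)\<^sup>2)" by (subst (asm) integrable_distr_eq) auto
qed

lemma gaussian_rv_centered_moment:
  assumes Y: "gaussian_rv M Y" and zero: "(\<integral>x. Y x \<partial>M) = 0"
  shows "(\<integral>\<^sup>+x. ennreal (Y x ^ (2 * k)) \<partial>M) = ennreal (gaussian_moment k) * sq_norm M Y ^ k"
proof -
  obtain \<mu> \<sigma> where [measurable]: "Y \<in> borel_measurable M" and \<sigma>: "0 \<le> \<sigma>" and D: "distr M borel Y = normal_law \<mu> \<sigma>"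
    using assms unfolding gaussian_rv_def by blast
  interpret P: prob_space "normal_law \<mu> \<sigma>" by (rule prob_space_normal_law[OF \<sigma>])
  \<comment> \<open>\<open>gaussian_rv\<close> leaves the parameters of the law open. The first
    moment identifies \<open>\<mu>\<close> as 0, and the second moment below identifies
    \<open>\<sigma>\<^sup>2\<close> with the squared norm.\<close>
  have "0 = (\<integral>x. x \<partial>normal_law \<mu> \<sigma>)"
    using zero unfolding D[symmetric] by (subst integral_distr) auto
  also have "\<dots> = (\<integral>x. (x - \<mu>) + \<mu> \<partial>normal_law \<mu> \<sigma>)" by simp
  also have "\<dots> = \<mu>"
    using integrable_normal_law_power[OF \<sigma>, of \<mu> 1]
    by (subst Bochner_Integration.integral_add) (auto simp: integral_normal_law[OF \<sigma>] P.prob_space)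
  finally have D: "distr M borel Y = normal_law 0 \<sigma>" using D by simp
  have eq: "(\<integral>\<^sup>+x. ennreal (Y x ^ (2 * k)) \<partial>M) = ennreal (gaussian_moment k * (\<sigma>\<^sup>2) ^ k)" for k
  proof -
    have "(\<integral>\<^sup>+x. ennreal (Y x ^ (2 * k)) \<partial>M) = (\<integral>\<^sup>+x. ennreal (x ^ (2 * k)) \<partial>distr M borel Y)"
      by (subst nn_integral_distr) auto
    then show ?thesis by (simp add: D nn_integral_normal_law_even[OF \<sigma>])
  qed
  from eq[of 1] have "sq_norm M Y = ennreal (\<sigma>\<^sup>2)"
    by (simp add: sq_norm_def gaussian_moment_def)
  then show ?thesis using eq[of k]
    by (simp only: ennreal_power zero_le_power2 gaussian_moment_def ennreal_mult' zero_le_power ennreal_mult divide_nonneg_nonneg mult_nonneg_nonneg fact_ge_zero zero_le_numeral)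
qed

section \<open>Elementary integrands\<close>

lemma noise_setsD:
  assumes "A \<in> noise_sets"
  shows "A \<in> sets borel" "emeasure lborel A < \<infinity>"
  using assms by (auto simp: noise_sets_def)

lemma elementary_integrand_simple:
  assumes "elementary_integrand f"
  shows "simple_function borel f"
proof -
  have fin: "finite (range f)" and lev: "\<And>c. c \<noteq> 0 \<Longrightarrow> f -` {c} \<in> sets borel"
    using assms by (auto simp: elementary_integrand_def noise_sets_def)
  have "f -` {0} = UNIV - (\<Union>c\<in>range f - {0}. f -` {c})" by auto
  also have "\<dots> \<in> sets borel" using fin lev by (intro sets.Diff sets.finite_UN) auto
  finally have "f -` {c} \<in> sets borel" for c using lev by (cases "c = 0") auto
  then show ?thesis using fin by (auto simp: simple_function_def)
qed

lemma elementary_integrand_measurable: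
  "elementary_integrand f \<Longrightarrow> f \<in> borel_measurable borel"
  by (intro borel_measurable_simple_function elementary_integrand_simple)

text \<open>The level set of the value 0 has infinite measure, so it lies outside
  \<open>noise_sets\<close> and nothing is known of \<open>w\<close> on it; its coefficient 0
  removes it.\<close>

lemma elementary_integral_alt:
  assumes "elementary_integrand f"
  shows "elementary_integral w f \<omega> = (\<Sum>c\<in>range f - {0}. c * w (f -` {c}) \<omega>)"
  using assms unfolding elementary_integral_def elementary_integrand_def
  by (intro sum.mono_neutral_right) auto

lemma elementary_integrand_sum:
  assumes "elementary_integrand f"
  shows "f z = (\<Sum>c\<in>range f - {0}. c * indicator (f -` {c}) z)"
proof -
  have "(\<Sum>c\<in>range f - {0}. c * indicator (f -` {c}) z) = (\<Sum>c\<in>range f. c * indicator (f -` {c}) z)"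
    using assms unfolding elementary_integrand_def by (intro sum.mono_neutral_left) auto
  also have "\<dots> = (\<Sum>c\<in>range f. if c = f z then c else 0)"
    by (intro sum.cong) (auto simp: indicator_def)
  also have "\<dots> = f z" using assms by (simp add: elementary_integrand_def)
  finally show ?thesis by (rule sym)
qed

section \<open>Isometry, existence and moments of the Wiener integral\<close>

locale noise = prob_space M for M :: "'a measure" +
  fixes w :: "(real \<times> real) set \<Rightarrow> 'a \<Rightarrow> real"
  assumes white_noise: "white_noise M w"
begin

lemma noise_gaussian: "A \<in> noise_sets \<Longrightarrow> gaussian_rv M (w A)"
proof -
  assume "A \<in> noise_sets"
  then have "gaussian_rv M (\<lambda>\<omega>. \<Sum>B\<in>{A}. 1 * w B \<omega>)"
    using white_noise unfolding white_noise_def by (elim conjE allE[of _ "{A}"] allE[of _ "\<lambda>_. 1"]) simp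
  then show ?thesis by simp
qed

lemma noise_measurable: "A \<in> noise_sets \<Longrightarrow> w A \<in> borel_measurable M"
  using noise_gaussian gaussian_rv_def by blast

lemma noise_integrable_mult:
  assumes "A \<in> noise_sets" "B \<in> noise_sets"
  shows "integrable M (\<lambda>\<omega>. w A \<omega> * w B \<omega>)"
proof (rule Bochner_Integration.integrable_bound)
  show "integrable M (\<lambda>\<omega>. (w A \<omega>)\<^sup>2 + (w B \<omega>)\<^sup>2)"
    using assms by (intro Bochner_Integration.integrable_add gaussian_rv_integrable noise_gaussian)
  show "(\<lambda>\<omega>. w A \<omega> * w B \<omega>) \<in> borel_measurable M"
    using assms by (intro borel_measurable_times noise_measurable)
  show "AE \<omega> in M. norm (w A \<omega> * w B \<omega>) \<le> norm ((w A \<omega>)\<^sup>2 + (w B \<omega>)\<^sup>2)"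
  proof (intro AE_I2)
    fix \<omega>
    have "2 * (\<bar>w A \<omega>\<bar> * \<bar>w B \<omega>\<bar>) \<le> \<bar>w A \<omega>\<bar>\<^sup>2 + \<bar>w B \<omega>\<bar>\<^sup>2"
      using sum_squares_bound[of "\<bar>w A \<omega>\<bar>" "\<bar>w B \<omega>\<bar>"] by (simp only: mult.assoc)
    then have "2 * (\<bar>w A \<omega>\<bar> * \<bar>w B \<omega>\<bar>) \<le> (w A \<omega>)\<^sup>2 + (w B \<omega>)\<^sup>2" by simp
    then show "norm (w A \<omega> * w B \<omega>) \<le> norm ((w A \<omega>)\<^sup>2 + (w B \<omega>)\<^sup>2)"
      by (simp add: abs_mult) (smt (verit) mult_nonneg_nonneg abs_ge_zero)
  qed
qed

lemma elementary_integral_gaussian: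
  assumes f: "elementary_integrand f"
  shows "gaussian_rv M (elementary_integral w f)" "(\<integral>\<omega>. elementary_integral w f \<omega> \<partial>M) = 0"
proof -
  let ?R = "range f - {0}"
  have fin: "finite ?R" and lev: "\<And>c. c \<in> ?R \<Longrightarrow> f -` {c} \<in> noise_sets"
    using f by (auto simp: elementary_integrand_def)
  have inj: "inj_on (\<lambda>c. f -` {c}) ?R" by (auto intro!: inj_onI)
  \<comment> \<open>\<open>white_noise\<close> indexes linear combinations by sets, whereas the
    elementary integral is indexed by values. Distinct values in the range have distinct level sets,
    so the coefficient can be recovered from the set.\<close>
  let ?g = "inv_into ?R (\<lambda>c. f -` {c})"
  have "elementary_integral w f = (\<lambda>\<omega>. \<Sum>A\<in>(\<lambda>c. f -` {c}) ` ?R. ?g A * w A \<omega>)"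
    unfolding elementary_integral_alt[OF f, abs_def]
    by (intro ext, subst sum.reindex[OF inj]) (auto intro!: sum.cong simp: inv_into_f_f[OF inj])
  moreover have "gaussian_rv M (\<lambda>\<omega>. \<Sum>A\<in>(\<lambda>c. f -` {c}) ` ?R. ?g A * w A \<omega>)"
    using white_noise fin lev unfolding white_noise_def by (auto simp: image_subset_iff)
  ultimately show "gaussian_rv M (elementary_integral w f)" by simp
  have "(\<integral>\<omega>. elementary_integral w f \<omega> \<partial>M) = (\<Sum>c\<in>?R. \<integral>\<omega>. c * w (f -` {c}) \<omega> \<partial>M)"
    unfolding elementary_integral_alt[OF f, abs_def]
    by (intro Bochner_Integration.integral_sum integrable_mult_right gaussian_rv_integrable noise_gaussian lev)
  also have "\<dots> = (\<Sum>c\<in>?R. c * 0)"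
    using white_noise lev unfolding white_noise_def
    by (intro sum.cong) auto
  finally show "(\<integral>\<omega>. elementary_integral w f \<omega> \<partial>M) = 0" by simp
qed

lemma elementary_integral_measurable:
  "elementary_integrand f \<Longrightarrow> elementary_integral w f \<in> borel_measurable M"
  using elementary_integral_gaussian(1) gaussian_rv_def by blast

text \<open>The polarised isometry: both sides are double sums over pairs of level sets, and the
  covariance of the noise matches them term by term.\<close>

lemma elementary_integral_inner:
  assumes f: "elementary_integrand f" and g: "elementary_integrand g"
  shows "integrable M (\<lambda>\<omega>. elementary_integral w f \<omega> * elementary_integral w g \<omega>)"
    and "integrable lborel (\<lambda>z. f z * g z)"
    and "(\<integral>\<omega>. elementary_integral w f \<omega> * elementary_integral w g \<omega> \<partial>M) = (\<integral>z. f z * g z \<partial>lborel)"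
proof -
  let ?R = "range f - {0}" and ?S = "range g - {0}"
  have fl: "\<And>c. c \<in> ?R \<Longrightarrow> f -` {c} \<in> noise_sets" and gl: "\<And>c. c \<in> ?S \<Longrightarrow> g -` {c} \<in> noise_sets"
    using f g by (auto simp: elementary_integrand_def)
  have e1: "elementary_integral w f \<omega> * elementary_integral w g \<omega> =
      (\<Sum>c\<in>?R. \<Sum>d\<in>?S. (c * d) * (w (f -` {c}) \<omega> * w (g -` {d}) \<omega>))" for \<omega>
    unfolding elementary_integral_alt[OF f] elementary_integral_alt[OF g] sum_product by (simp add: ac_simps)
  have e2: "f z * g z = (\<Sum>c\<in>?R. \<Sum>d\<in>?S. (c * d) * indicator (f -` {c} \<inter> g -` {d}) z)" for z
    by (subst elementary_integrand_sum[OF f], subst elementary_integrand_sum[OF g])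
      (simp add: sum_product indicator_inter_arith ac_simps)
  have i1: "integrable M (\<lambda>\<omega>. (c * d) * (w (f -` {c}) \<omega> * w (g -` {d}) \<omega>))" if "c \<in> ?R" "d \<in> ?S" for c d
    using that by (intro integrable_mult_right noise_integrable_mult fl gl)
  have cap: "f -` {c} \<inter> g -` {d} \<in> sets borel" "emeasure lborel (f -` {c} \<inter> g -` {d}) < \<infinity>" if "c \<in> ?R" "d \<in> ?S" for c d
  proof -
    note F = noise_setsD[OF fl[OF that(1)]] and G = noise_setsD[OF gl[OF that(2)]]
    show "f -` {c} \<inter> g -` {d} \<in> sets borel" using F G by auto
    have "emeasure lborel (f -` {c} \<inter> g -` {d}) \<le> emeasure lborel (f -` {c})"
      using F by (intro emeasure_mono) auto
    then show "emeasure lborel (f -` {c} \<inter> g -` {d}) < \<infinity>" using F(2) by (rule le_less_trans)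
  qed
  have i2: "integrable lborel (\<lambda>z. (c * d) * indicator (f -` {c} \<inter> g -` {d}) z)" if "c \<in> ?R" "d \<in> ?S" for c d
    using cap[OF that] by (intro integrable_mult_right integrable_real_indicator) auto
  show "integrable M (\<lambda>\<omega>. elementary_integral w f \<omega> * elementary_integral w g \<omega>)"
    unfolding e1 by (intro Bochner_Integration.integrable_sum i1)
  show "integrable lborel (\<lambda>z. f z * g z)"
    unfolding e2 by (intro Bochner_Integration.integrable_sum i2)
  have "(\<integral>\<omega>. elementary_integral w f \<omega> * elementary_integral w g \<omega> \<partial>M) =
      (\<Sum>c\<in>?R. \<Sum>d\<in>?S. \<integral>\<omega>. (c * d) * (w (f -` {c}) \<omega> * w (g -` {d}) \<omega>) \<partial>M)"
    unfolding e1
    by (subst Bochner_Integration.integral_sum, intro Bochner_Integration.integrable_sum i1, assumption+,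
        intro sum.cong refl Bochner_Integration.integral_sum i1)
  also have "\<dots> = (\<Sum>c\<in>?R. \<Sum>d\<in>?S. \<integral>z. (c * d) * indicator (f -` {c} \<inter> g -` {d}) z \<partial>lborel)"
  proof (intro sum.cong refl)
    fix c d assume "c \<in> ?R" "d \<in> ?S"
    then show "(\<integral>\<omega>. (c * d) * (w (f -` {c}) \<omega> * w (g -` {d}) \<omega>) \<partial>M) = (\<integral>z. (c * d) * indicator (f -` {c} \<inter> g -` {d}) z \<partial>lborel)"
      using white_noise fl gl unfolding white_noise_def by simp
  qed
  also have "\<dots> = (\<integral>z. f z * g z \<partial>lborel)"
    unfolding e2
    by (subst Bochner_Integration.integral_sum, intro Bochner_Integration.integrable_sum i2, assumption+,
        intro sum.cong refl Bochner_Integration.integral_sum[symmetric] i2)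
  finally show "(\<integral>\<omega>. elementary_integral w f \<omega> * elementary_integral w g \<omega> \<partial>M) = (\<integral>z. f z * g z \<partial>lborel)" .
qed

text \<open>Expanding the square reduces the claim to three inner products of the given integrands,
  whose level sets stay separate.\<close>

lemma elementary_isometry:
  assumes f: "elementary_integrand f" and g: "elementary_integrand g"
  shows "sq_norm M (\<lambda>\<omega>. elementary_integral w f \<omega> - elementary_integral w g \<omega>) = sq_norm lborel (\<lambda>z. f z - g z)"
proof -
  let ?I = "elementary_integral w"
  have e1: "(?I f \<omega> - ?I g \<omega>)\<^sup>2 = ?I f \<omega> * ?I f \<omega> - 2 * (?I f \<omega> * ?I g \<omega>) + ?I g \<omega> * ?I g \<omega>" for \<omega>
    by (simp add: power2_eq_square algebra_simps)
  have e2: "(f z - g z)\<^sup>2 = f z * f z - 2 * (f z * g z) + g z * g z" for z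
    by (simp add: power2_eq_square algebra_simps)
  note i = elementary_integral_inner(1)[OF f f] elementary_integral_inner(1)[OF f g] elementary_integral_inner(1)[OF g g]
    and j = elementary_integral_inner(2)[OF f f] elementary_integral_inner(2)[OF f g] elementary_integral_inner(2)[OF g g]
  have "(\<integral>\<omega>. (?I f \<omega> - ?I g \<omega>)\<^sup>2 \<partial>M) = (\<integral>z. (f z - g z)\<^sup>2 \<partial>lborel)"
    unfolding e1 e2 using i j elementary_integral_inner(3)[OF f f] elementary_integral_inner(3)[OF f g] elementary_integral_inner(3)[OF g g]
    by simp
  moreover have "integrable M (\<lambda>\<omega>. (?I f \<omega> - ?I g \<omega>)\<^sup>2)" "integrable lborel (\<lambda>z. (f z - g z)\<^sup>2)"
    unfolding e1 e2 using i j by simp_all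
  ultimately show ?thesis unfolding sq_norm_def by (simp add: nn_integral_eq_integral)
qed

text \<open>The approximating sequences of the two integrands are subtracted, and the isometry for
  differences is passed to the limit in either direction. Two integrands at once are what compares
  the solution at two space-time points later.\<close>

lemma wiener_integral_comparison:
  assumes "has_wiener_integral M w f Y" "has_wiener_integral M w f' Y'"
  shows "sq_norm M (\<lambda>\<omega>. Y \<omega> - Y' \<omega>) \<le> 8 * sq_norm lborel (\<lambda>z. f z - f' z)"
    and "sq_norm lborel (\<lambda>z. f z - f' z) \<le> 8 * sq_norm M (\<lambda>\<omega>. Y \<omega> - Y' \<omega>)"
proof -
  obtain g where g: "\<And>n. elementary_integrand (g n)" "L2_limit lborel g f" "L2_limit M (\<lambda>n. elementary_integral w (g n)) Y"
    using assms(1) unfolding has_wiener_integral_def by blast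
  obtain g' where g': "\<And>n. elementary_integrand (g' n)" "L2_limit lborel g' f'" "L2_limit M (\<lambda>n. elementary_integral w (g' n)) Y'"
    using assms(2) unfolding has_wiener_integral_def by blast
  note [measurable] = elementary_integral_measurable[OF g(1)] elementary_integral_measurable[OF g'(1)]
  have [measurable]: "\<And>n. g n \<in> borel_measurable borel" "\<And>n. g' n \<in> borel_measurable borel"
    using g(1) g'(1) elementary_integrand_measurable by blast+
  have 1: "L2_limit M (\<lambda>n \<omega>. elementary_integral w (g n) \<omega> - elementary_integral w (g' n) \<omega>) (\<lambda>\<omega>. Y \<omega> - Y' \<omega>)"
    by (rule L2_limit_diff[OF _ _ g(3) g'(3)]) simp_all
  have 2: "L2_limit lborel (\<lambda>n z. g n z - g' n z) (\<lambda>z. f z - f' z)"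
    by (rule L2_limit_diff[OF _ _ g(2) g'(2)]) simp_all
  show "sq_norm M (\<lambda>\<omega>. Y \<omega> - Y' \<omega>) \<le> 8 * sq_norm lborel (\<lambda>z. f z - f' z)"
    by (rule L2_limit_comparison[OF _ _ _ 1 2]) (simp_all add: elementary_isometry g g')
  show "sq_norm lborel (\<lambda>z. f z - f' z) \<le> 8 * sq_norm M (\<lambda>\<omega>. Y \<omega> - Y' \<omega>)"
    by (rule L2_limit_comparison[OF _ _ _ 2 1]) (simp_all add: elementary_isometry g g')
qed

lemma elementary_zero: "elementary_integrand (\<lambda>_. 0)"
proof -
  have "(\<lambda>_::real \<times> real. 0::real) -` {c} = {}" if "c \<noteq> 0" for c using that by auto
  then show ?thesis by (auto simp: elementary_integrand_def noise_sets_def)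
qed

lemma has_wiener_integral_zero: "has_wiener_integral M w (\<lambda>_. 0) (\<lambda>_. 0)"
proof -
  have "elementary_integral w (\<lambda>_. 0) = (\<lambda>_. 0)" by (simp add: elementary_integral_def fun_eq_iff)
  then show ?thesis unfolding has_wiener_integral_def L2_limit_def
    by (intro exI[of _ "\<lambda>_ _. 0"]) (simp add: elementary_zero)
qed

lemma wiener_integral_norm:
  assumes "has_wiener_integral M w f Y"
  shows "sq_norm M Y \<le> 8 * sq_norm lborel f" and "sq_norm lborel f \<le> 8 * sq_norm M Y"
  using wiener_integral_comparison[OF assms has_wiener_integral_zero] by simp_all

text \<open>Simple functions dominated by \<open>2 * \<bar>f\<bar>\<close> converge to
  \<open>f\<close> in mean square; the isometry makes their integrals a Cauchy sequence, and
  completeness provides the limit.\<close>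

lemma has_wiener_integral_exists:
  assumes [measurable]: "f \<in> borel_measurable borel"
    and supp: "\<And>s y. s < 0 \<Longrightarrow> f (s, y) = 0" and fin: "sq_norm lborel f < \<infinity>"
  shows "\<exists>Y. has_wiener_integral M w f Y"
proof -
  obtain F where F: "\<And>i. simple_function borel (F i)" "\<And>z. (\<lambda>i. F i z) \<longlonglongrightarrow> f z" "\<And>i z. dist (F i z) 0 \<le> 2 * dist (f z) 0"
    using borel_measurable_implies_sequence_metric[of f borel 0] by auto
  have le: "(F i z)\<^sup>2 \<le> 4 * (f z)\<^sup>2" for i z
  proof -
    have "\<bar>F i z\<bar>\<^sup>2 \<le> (2 * \<bar>f z\<bar>)\<^sup>2" using F(3)[of i z] by (intro power_mono) auto
    then show ?thesis by (simp add: power_mult_distrib)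
  qed
  have [measurable]: "F i \<in> borel_measurable borel" for i
    using F(1) by (rule borel_measurable_simple_function)
  have el: "elementary_integrand (F i)" for i
    unfolding elementary_integrand_def
  proof (intro conjI allI impI)
    show "finite (range (F i))" using F(1)[of i] by (simp add: simple_function_def)
    fix c :: real assume c: "c \<noteq> 0"
    let ?A = "F i -` {c}"
    have m: "?A \<in> sets borel" using measurable_sets[of "F i" borel borel "{c}"] by simp
    \<comment> \<open>Chebyshev's inequality: on the level set of \<open>c\<close> the domination
      reads \<open>c\<^sup>2 \<le> 4 * (f z)\<^sup>2\<close>, which makes its measure
      finite.\<close>
    have "ennreal (c\<^sup>2) * emeasure lborel ?A = (\<integral>\<^sup>+z. ennreal (c\<^sup>2) * indicator ?A z \<partial>lborel)"
      using m by (simp add: nn_integral_cmult_indicator)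
    also have "\<dots> \<le> (\<integral>\<^sup>+z. 4 * ennreal ((f z)\<^sup>2) \<partial>lborel)"
    proof (intro nn_integral_mono)
      fix z
      show "ennreal (c\<^sup>2) * indicator ?A z \<le> 4 * ennreal ((f z)\<^sup>2)"
        using le[of i z] ennreal_leI[OF le[of i z]] by (auto simp: indicator_def ennreal_mult')
    qed
    also have "\<dots> = 4 * sq_norm lborel f" unfolding sq_norm_def by (simp add: nn_integral_cmult)
    also have "\<dots> < \<infinity>" using fin by (simp add: ennreal_mult_less_top)
    finally have "emeasure lborel ?A < \<infinity>" using c by (auto simp: ennreal_mult_less_top)
    moreover have "?A \<subseteq> {0..} \<times> UNIV"
    proof
      fix z assume z: "z \<in> ?A"
      show "z \<in> {0..} \<times> UNIV"
      proof (rule ccontr)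
        assume "z \<notin> {0..} \<times> UNIV"
        then have "f z = 0" using supp[of "fst z" "snd z"] by (cases z) auto
        then show False using F(3)[of i z] z c by simp
      qed
    qed
    ultimately show "?A \<in> noise_sets" using m by (simp add: noise_sets_def)
  qed
  have L2: "L2_limit lborel F f"
    unfolding L2_limit_iff
  proof
    have "(\<lambda>i. \<integral>\<^sup>+z. ennreal ((F i z - f z)\<^sup>2) \<partial>lborel) \<longlonglongrightarrow> (\<integral>\<^sup>+z. ennreal 0 \<partial>(lborel :: (real \<times> real) measure))"
    \<comment> \<open>The constant is 2 * 4 + 2, from \<open>sq_add_le\<close> and
      \<open>le\<close>.\<close>
    proof (rule nn_integral_dominated_convergence[where w="\<lambda>z. ennreal (10 * (f z)\<^sup>2)"])
      have "(\<integral>\<^sup>+z. ennreal (10 * (f z)\<^sup>2) \<partial>lborel) = 10 * sq_norm lborel f"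
        unfolding sq_norm_def by (simp add: ennreal_mult' nn_integral_cmult)
      then show "(\<integral>\<^sup>+z. ennreal (10 * (f z)\<^sup>2) \<partial>lborel) < \<infinity>" using fin by (simp add: ennreal_mult_less_top)
      show "AE z in lborel. ennreal ((F i z - f z)\<^sup>2) \<le> ennreal (10 * (f z)\<^sup>2)" for i
      proof (intro AE_I2 ennreal_leI)
        fix z
        have "(F i z + - f z)\<^sup>2 \<le> 2 * (F i z)\<^sup>2 + 2 * (- f z)\<^sup>2" by (rule sq_add_le)
        then show "(F i z - f z)\<^sup>2 \<le> 10 * (f z)\<^sup>2" using le[of i z] by simp
      qed
      show "AE z in lborel. (\<lambda>i. ennreal ((F i z - f z)\<^sup>2)) \<longlonglongrightarrow> ennreal 0"
      proof (intro AE_I2 tendsto_ennrealI)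
        fix z
        have "(\<lambda>i. (F i z - f z)\<^sup>2) \<longlonglongrightarrow> (f z - f z)\<^sup>2" by (intro tendsto_intros F)
        then show "(\<lambda>i. (F i z - f z)\<^sup>2) \<longlonglongrightarrow> 0" by simp
      qed
    qed simp_all
    then show "(\<lambda>n. sq_norm lborel (\<lambda>x. F n x - f x)) \<longlonglongrightarrow> 0" by (simp add: sq_norm_def)
  qed simp
  have "\<exists>Y. L2_limit M (\<lambda>i. elementary_integral w (F i)) Y"
  proof (rule L2_complete)
    show "elementary_integral w (F n) \<in> borel_measurable M" for n by (rule elementary_integral_measurable[OF el])
    fix e :: real assume "e > 0"
    then have "0 < ennreal (e/4)" by simp
    then have "\<forall>\<^sub>F n in sequentially. sq_norm lborel (\<lambda>z. F n z - f z) < ennreal (e/4)"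
      by (rule L2_limit_eventually_less[OF L2])
    then obtain n0 where n0: "\<And>n. n \<ge> n0 \<Longrightarrow> sq_norm lborel (\<lambda>z. F n z - f z) < ennreal (e/4)"
      unfolding eventually_sequentially by blast
    show "\<exists>n0. \<forall>m\<ge>n0. \<forall>n\<ge>n0. sq_norm M (\<lambda>x. elementary_integral w (F m) x - elementary_integral w (F n) x) \<le> ennreal e"
    proof (intro exI[of _ n0] allI impI)
      fix m n assume mn: "m \<ge> n0" "n \<ge> n0"
      have "sq_norm lborel (\<lambda>z. F m z - F n z) \<le> 2 * sq_norm lborel (\<lambda>z. F m z - f z) + 2 * sq_norm lborel (\<lambda>z. f z - F n z)"
        by (rule sq_norm_triangle) simp_all
      also have "\<dots> \<le> 2 * ennreal (e/4) + 2 * ennreal (e/4)"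
        using n0[OF mn(1)] n0[OF mn(2)] unfolding sq_norm_commute[of lborel f "F n"]
        by (intro add_mono mult_left_mono) auto
      also have "\<dots> = ennreal e" using \<open>e > 0\<close> by (simp flip: ennreal_numeral ennreal_mult ennreal_plus)
      finally show "sq_norm M (\<lambda>x. elementary_integral w (F m) x - elementary_integral w (F n) x) \<le> ennreal e"
        by (simp add: elementary_isometry[OF el el])
    qed
  qed
  then show ?thesis unfolding has_wiener_integral_def using el L2 by blast
qed

text \<open>Elementary integrals are centred Gaussian, so their variance determines their moments.
  Late approximants have squared distance below 1 from \<open>Y\<close>, hence squared norm at most
  \<open>2 * sq_norm M Y + 2\<close>.\<close>

lemma wiener_integral_moment:
  assumes "has_wiener_integral M w f Y" and fin: "sq_norm M Y < \<infinity>"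
  shows "(\<integral>\<^sup>+\<omega>. ennreal (Y \<omega> ^ (2 * k)) \<partial>M) \<le> ennreal (gaussian_moment k) * (2 * sq_norm M Y + 2) ^ k"
proof -
  obtain g where g: "\<And>n. elementary_integrand (g n)" "L2_limit M (\<lambda>n. elementary_integral w (g n)) Y"
    using assms(1) unfolding has_wiener_integral_def by blast
  note [measurable] = elementary_integral_measurable[OF g(1)]
  have [measurable]: "Y \<in> borel_measurable M" using g(2) by (simp add: L2_limit_iff)
  show ?thesis
  proof (rule L2_limit_moment[OF g(2)])
    have "\<forall>\<^sub>F n in sequentially. sq_norm M (\<lambda>\<omega>. elementary_integral w (g n) \<omega> - Y \<omega>) < 1"
      by (rule L2_limit_eventually_less[OF g(2)]) simp
    then show "\<forall>\<^sub>F n in sequentially. (\<integral>\<^sup>+\<omega>. ennreal (elementary_integral w (g n) \<omega> ^ (2 * k)) \<partial>M)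
        \<le> ennreal (gaussian_moment k) * (2 * sq_norm M Y + 2) ^ k"
    proof eventually_elim
      case (elim n)
      have "sq_norm M (elementary_integral w (g n)) \<le> 2 * sq_norm M (\<lambda>\<omega>. elementary_integral w (g n) \<omega> - Y \<omega>) + 2 * sq_norm M Y"
        by (rule sq_norm_le_diff) simp_all
      also have "\<dots> \<le> 2 * 1 + 2 * sq_norm M Y"
        using elim by (intro add_right_mono mult_left_mono) auto
      finally have "sq_norm M (elementary_integral w (g n)) ^ k \<le> (2 * sq_norm M Y + 2) ^ k"
        by (intro power_mono) (simp_all add: add.commute)
      then show ?case
        unfolding gaussian_rv_centered_moment[OF elementary_integral_gaussian[OF g(1)]]
        by (intro mult_left_mono) auto
    qed
  qed simp
qed

end

subsection \<open>The Fourier transform of integrable functions\<close>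

text \<open>The sign of the exponent is that of characteristic functions, so that the adjoint
  semigroup acts by multiplication with the characteristic function itself and not with its
  conjugate.\<close>

definition fourier :: "(real \<Rightarrow> real) \<Rightarrow> real \<Rightarrow> complex" where
  "fourier f \<xi> = (CLBINT x. iexp (\<xi> * x) * complex_of_real (f x))"

lemma integrable_bounded_mult:
  fixes k :: "'b \<Rightarrow> complex" and f :: "'b \<Rightarrow> real"
  assumes f: "integrable M f" and k[measurable]: "k \<in> borel_measurable M" and le: "\<And>x. cmod (k x) \<le> C"
  shows "integrable M (\<lambda>x. k x * complex_of_real (f x))"
proof (rule Bochner_Integration.integrable_bound)
  have [measurable]: "f \<in> borel_measurable M" using f by simp
  show "integrable M (\<lambda>x. C * f x)" using f by simp
  show "(\<lambda>x. k x * complex_of_real (f x)) \<in> borel_measurable M" by measurable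
  have "cmod (k x) * \<bar>f x\<bar> \<le> \<bar>C\<bar> * \<bar>f x\<bar>" for x
    using le[of x] by (intro mult_right_mono) auto
  then show "AE x in M. cmod (k x * complex_of_real (f x)) \<le> norm (C * f x)"
    by (simp add: norm_mult abs_mult)
qed

text \<open>The exchanges of integrals in this part all have this shape: a bounded kernel against a
  product of two integrable functions.\<close>

lemma Fubini_bounded_kernel:
  fixes k :: "'b \<times> 'c \<Rightarrow> complex"
  assumes "sigma_finite_measure M1" "sigma_finite_measure M2"
    and a: "integrable M1 a" and b: "integrable M2 b"
    and k[measurable]: "k \<in> borel_measurable (M1 \<Otimes>\<^sub>M M2)" and le: "\<And>z. cmod (k z) \<le> C"
  shows "(\<integral>x. (\<integral>y. k (x, y) * complex_of_real (a x * b y) \<partial>M2) \<partial>M1)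
    = (\<integral>y. (\<integral>x. k (x, y) * complex_of_real (a x * b y) \<partial>M1) \<partial>M2)"
proof -
  interpret M1: sigma_finite_measure M1 by fact
  interpret M2: sigma_finite_measure M2 by fact
  interpret pair_sigma_finite M1 M2 ..
  have [measurable]: "a \<in> borel_measurable M1" "b \<in> borel_measurable M2" using a b by auto
  have "integrable (M1 \<Otimes>\<^sub>M M2) (\<lambda>z. a (fst z) * b (snd z))"
  proof (rule Fubini_integrable)
    have "integrable M1 (\<lambda>x. \<bar>a x\<bar> * (\<integral>y. \<bar>b y\<bar> \<partial>M2))" using a by simp
    then show "integrable M1 (\<lambda>x. \<integral>y. norm (a (fst (x, y)) * b (snd (x, y))) \<partial>M2)" by (simp add: abs_mult)
    show "AE x in M1. integrable M2 (\<lambda>y. a (fst (x, y)) * b (snd (x, y)))" using b by simp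
  qed simp
  then have "integrable (M1 \<Otimes>\<^sub>M M2) (\<lambda>z. k z * complex_of_real (a (fst z) * b (snd z)))"
    by (rule integrable_bounded_mult[OF _ k le])
  then have "integrable (M1 \<Otimes>\<^sub>M M2) (\<lambda>(x, y). k (x, y) * complex_of_real (a x * b y))"
    by (simp add: case_prod_beta')
  from Fubini_integral[OF this] show ?thesis by simp
qed

lemma fourier_integrable:
  assumes "integrable lborel f"
  shows "integrable lborel (\<lambda>x. iexp (\<xi> * x) * complex_of_real (f x))"
  using assms by (rule integrable_bounded_mult[where C=1]) simp_all

lemma fourier_measurable [measurable]:
  assumes [measurable]: "f \<in> borel_measurable borel"
  shows "fourier f \<in> borel_measurable borel"
proof -
  have "(\<lambda>z::real\<times>real. iexp (fst z * snd z) * complex_of_real (f (snd z))) \<in> borel_measurable (borel \<Otimes>\<^sub>M lborel)"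
    by measurable
  then show ?thesis unfolding fourier_def[abs_def]
    by (intro lborel.borel_measurable_lebesgue_integral) (simp add: case_prod_beta')
qed

lemma fourier_bound: "cmod (fourier f \<xi>) \<le> (\<integral>x. \<bar>f x\<bar> \<partial>lborel)"
proof -
  have "cmod (fourier f \<xi>) \<le> (\<integral>x. cmod (iexp (\<xi> * x) * complex_of_real (f x)) \<partial>lborel)"
    unfolding fourier_def by (rule integral_norm_bound)
  then show ?thesis by (simp add: norm_mult)
qed

lemma fourier_diff:
  "integrable lborel f \<Longrightarrow> integrable lborel g \<Longrightarrow> fourier (\<lambda>x. f x - g x) \<xi> = fourier f \<xi> - fourier g \<xi>"
  unfolding fourier_def using fourier_integrable[of f \<xi>] fourier_integrable[of g \<xi>]
  by (simp add: right_diff_distrib)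

lemma integral_iexp_std_normal:
  "(CLBINT z. iexp (t * z) * complex_of_real (std_normal_density z)) = complex_of_real (exp (- t\<^sup>2 / 2))"
proof -
  have "char std_normal_distribution t = complex_of_real (exp (- t\<^sup>2 / 2))"
    by (simp add: char_std_normal_distribution)
  then show ?thesis
    unfolding char_def
    by (subst (asm) integral_density) (simp_all add: scaleR_conv_of_real mult.commute)
qed

text \<open>The Gaussian factor is the characteristic function of a standard normal variable
  \<open>z\<close> at \<open>s * x\<close>. Multiplication by it therefore averages the transform
  over the random frequency shift \<open>s * z\<close>.\<close>

lemma fourier_mult_gaussian:
  assumes f: "integrable lborel f"
  shows "fourier (\<lambda>x. f x * exp (- (s * x)\<^sup>2 / 2)) \<xi>
    = (CLBINT z. fourier f (\<xi> + s * z) * complex_of_real (std_normal_density z))"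
proof -
  have "fourier (\<lambda>x. f x * exp (- (s * x)\<^sup>2 / 2)) \<xi>
      = (CLBINT x. (CLBINT z. iexp (\<xi> * x + s * x * z) * complex_of_real (f x * std_normal_density z)))"
    unfolding fourier_def
  proof (intro Bochner_Integration.integral_cong refl)
    fix x
    have "(CLBINT z. iexp (\<xi> * x + s * x * z) * complex_of_real (f x * std_normal_density z)) =
       (CLBINT z. (iexp (\<xi> * x) * complex_of_real (f x)) * (iexp (s * x * z) * complex_of_real (std_normal_density z)))"
      by (intro Bochner_Integration.integral_cong refl) (simp add: exp_add distrib_left algebra_simps)
    also have "\<dots> = iexp (\<xi> * x) * complex_of_real (f x) * complex_of_real (exp (- (s * x)\<^sup>2 / 2))"
      by (simp only: integral_mult_right_zero integral_iexp_std_normal)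
    finally show "iexp (\<xi> * x) * complex_of_real (f x * exp (- (s * x)\<^sup>2 / 2)) =
       (CLBINT z. iexp (\<xi> * x + s * x * z) * complex_of_real (f x * std_normal_density z))"
      by simp
  qed
  also have "\<dots> = (CLBINT z. (CLBINT x. iexp (\<xi> * x + s * x * z) * complex_of_real (f x * std_normal_density z)))"
    using Fubini_bounded_kernel[of lborel lborel f std_normal_density "\<lambda>(x, z). iexp (\<xi> * x + s * x * z)" 1] f
    by (simp add: case_prod_beta' lborel.sigma_finite_measure_axioms)
  also have "\<dots> = (CLBINT z. fourier f (\<xi> + s * z) * complex_of_real (std_normal_density z))"
    unfolding fourier_def
    by (intro Bochner_Integration.integral_cong refl, subst integral_mult_left_zero[symmetric])
      (auto intro!: Bochner_Integration.integral_cong simp: algebra_simps)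
  finally show ?thesis .
qed

text \<open>A regularised Plancherel identity. Both factors of the squared modulus are written as
  integrals, and averaging the exponentials over \<open>z\<close> leaves a Gaussian kernel in
  \<open>x - y\<close>. The normal density makes all integrals absolutely convergent.\<close>

lemma gaussian_energy:
  assumes f: "integrable lborel f"
  shows "(\<integral>z. (cmod (fourier f (m * z)))\<^sup>2 * std_normal_density z \<partial>lborel)
    = (\<integral>x. f x * (\<integral>y. f y * exp (- (m * (x - y))\<^sup>2 / 2) \<partial>lborel) \<partial>lborel)"
proof -
  have [measurable]: "f \<in> borel_measurable borel" using f by simp
  have [measurable]: "cnj \<in> borel_measurable borel"
    by (intro borel_measurable_continuous_onI continuous_intros)
  define B where "B = (\<integral>x. \<bar>f x\<bar> \<partial>lborel)"
  have fb: "cmod (fourier f \<xi>) \<le> B" for \<xi> unfolding B_def by (rule fourier_bound)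
  let ?n = std_normal_density
  have "complex_of_real (\<integral>z. (cmod (fourier f (m * z)))\<^sup>2 * ?n z \<partial>lborel)
      = (CLBINT z. (CLBINT x. (iexp (m * z * x) * cnj (fourier f (m * z))) * complex_of_real (?n z * f x)))"
    unfolding integral_complex_of_real[symmetric]
  proof (intro Bochner_Integration.integral_cong refl)
    fix z
    have "(CLBINT x. (iexp (m * z * x) * cnj (fourier f (m * z))) * complex_of_real (?n z * f x))
      = (CLBINT x. (cnj (fourier f (m * z)) * complex_of_real (?n z)) * (iexp (m * z * x) * complex_of_real (f x)))"
      by (intro Bochner_Integration.integral_cong refl) simp
    also have "\<dots> = cnj (fourier f (m * z)) * complex_of_real (?n z) * fourier f (m * z)"
      unfolding fourier_def by (rule integral_mult_right_zero)
    also have "\<dots> = complex_of_real ((cmod (fourier f (m * z)))\<^sup>2 * ?n z)"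
      unfolding of_real_mult complex_norm_square by simp
    finally show "complex_of_real ((cmod (fourier f (m * z)))\<^sup>2 * ?n z) =
       (CLBINT x. (iexp (m * z * x) * cnj (fourier f (m * z))) * complex_of_real (?n z * f x))" by simp
  qed
  also have "\<dots> = (CLBINT x. (CLBINT z. (iexp (m * z * x) * cnj (fourier f (m * z))) * complex_of_real (?n z * f x)))"
    using Fubini_bounded_kernel[of lborel lborel ?n f "\<lambda>(z, x). iexp (m * z * x) * cnj (fourier f (m * z))" B] f
    by (simp add: case_prod_beta' lborel.sigma_finite_measure_axioms norm_mult fb)
  also have "\<dots> = (CLBINT x. complex_of_real (f x * (\<integral>y. f y * exp (- (m * (x - y))\<^sup>2 / 2) \<partial>lborel)))"
  proof (intro Bochner_Integration.integral_cong refl)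
    fix x
    have c: "cnj (fourier f \<xi>) = (CLBINT y. iexp (- (\<xi> * y)) * complex_of_real (f y))" for \<xi>
      using Bochner_Integration.integral_cnj[of lborel "\<lambda>y. iexp (\<xi> * y) * complex_of_real (f y)"]
      unfolding fourier_def by (simp add: exp_cnj)
    have "(CLBINT z. (iexp (m * z * x) * cnj (fourier f (m * z))) * complex_of_real (?n z * f x))
      = complex_of_real (f x) * (CLBINT z. (CLBINT y. iexp (m * z * (x - y)) * complex_of_real (?n z * f y)))"
    proof -
      have "(CLBINT y. iexp (m * z * (x - y)) * complex_of_real (?n z * f y))
        = iexp (m * z * x) * complex_of_real (?n z) * cnj (fourier f (m * z))" for z
      proof -
        have "(CLBINT y. iexp (m * z * (x - y)) * complex_of_real (?n z * f y))
          = (CLBINT y. (iexp (m * z * x) * complex_of_real (?n z)) * (iexp (- (m * z * y)) * complex_of_real (f y)))"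
        proof (intro Bochner_Integration.integral_cong refl)
          fix y
          have "iexp (m * z * (x - y)) = iexp (m * z * x) * iexp (- (m * z * y))"
            by (simp add: algebra_simps flip: exp_add)
          then show "iexp (m * z * (x - y)) * complex_of_real (?n z * f y)
            = (iexp (m * z * x) * complex_of_real (?n z)) * (iexp (- (m * z * y)) * complex_of_real (f y))"
            by (simp only: of_real_mult mult_ac)
        qed
        then show ?thesis unfolding c by (simp only: integral_mult_right_zero)
      qed
      then have "complex_of_real (f x) * (CLBINT z. (CLBINT y. iexp (m * z * (x - y)) * complex_of_real (?n z * f y)))
        = (CLBINT z. complex_of_real (f x) * (iexp (m * z * x) * complex_of_real (?n z) * cnj (fourier f (m * z))))"
        by (simp only: integral_mult_right_zero)
      then show ?thesis by (simp only: of_real_mult mult_ac)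
    qed
    also have "(CLBINT z. (CLBINT y. iexp (m * z * (x - y)) * complex_of_real (?n z * f y)))
      = (CLBINT y. (CLBINT z. iexp (m * z * (x - y)) * complex_of_real (?n z * f y)))"
      using Fubini_bounded_kernel[of lborel lborel ?n f "\<lambda>(z, y). iexp (m * z * (x - y))" 1] f
      by (simp add: case_prod_beta' lborel.sigma_finite_measure_axioms)
    also have "\<dots> = (CLBINT y. complex_of_real (f y * exp (- (m * (x - y))\<^sup>2 / 2)))"
    proof (intro Bochner_Integration.integral_cong refl)
      fix y
      have "(CLBINT z. iexp (m * z * (x - y)) * complex_of_real (?n z * f y))
        = (CLBINT z. complex_of_real (f y) * (iexp (m * (x - y) * z) * complex_of_real (?n z)))"
        by (intro Bochner_Integration.integral_cong refl) (simp add: algebra_simps)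
      also have "\<dots> = complex_of_real (f y) * complex_of_real (exp (- (m * (x - y))\<^sup>2 / 2))"
        by (simp only: integral_mult_right_zero integral_iexp_std_normal)
      finally show "(CLBINT z. iexp (m * z * (x - y)) * complex_of_real (?n z * f y))
        = complex_of_real (f y * exp (- (m * (x - y))\<^sup>2 / 2))" by simp
    qed
    finally show "(CLBINT z. (iexp (m * z * x) * cnj (fourier f (m * z))) * complex_of_real (?n z * f x))
      = complex_of_real (f x * (\<integral>y. f y * exp (- (m * (x - y))\<^sup>2 / 2) \<partial>lborel))"
      by (simp only: integral_complex_of_real of_real_mult[of "f x"])
  qed
  also have "\<dots> = complex_of_real (\<integral>x. f x * (\<integral>y. f y * exp (- (m * (x - y))\<^sup>2 / 2) \<partial>lborel) \<partial>lborel)"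
    by (rule integral_complex_of_real)
  finally show ?thesis by (simp only: of_real_eq_iff)
qed

text \<open>The frequency side of \<open>gaussian_energy\<close> increases to the full integral as
  the Gaussian flattens. On the space side the kernel is an approximate identity: \<open>R k\<close>
  tends pointwise to the continuous function \<open>f\<close> and stays below its bound.\<close>

theorem plancherel:
  assumes f: "integrable lborel f" and cont: "continuous_on UNIV f" and bd: "bounded (range f)"
  shows "(\<integral>\<^sup>+\<xi>. ennreal ((cmod (fourier f \<xi>))\<^sup>2) \<partial>lborel) = ennreal (2 * pi) * sq_norm lborel f"
proof -
  have [measurable]: "f \<in> borel_measurable borel" using f by simp
  obtain C where C: "\<And>x. \<bar>f x\<bar> \<le> C" using bd by (auto simp: bounded_iff)
  then have C0: "0 \<le> C" using abs_ge_zero order_trans by blast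
  let ?n = std_normal_density
  let ?F = "\<lambda>\<xi>. (cmod (fourier f \<xi>))\<^sup>2"
  define m where "m k = real (Suc k)" for k
  have m0: "m k > 0" for k by (simp add: m_def)
  define R where "R k x = (\<integral>u. f (x - u / m k) * ?n u \<partial>lborel)" for k x
  \<comment> \<open>The substitutions \<open>\<xi> = m k * z\<close> in frequency and
    \<open>y = x - u / m k\<close> in space cancel the powers of \<open>m k\<close>. Each side turns
    an exponential into a normal density and contributes the square root of 2 pi.\<close>
  have scale: "(\<integral>\<^sup>+\<xi>. ennreal (?F \<xi> * exp (- (\<xi> / m k)\<^sup>2 / 2)) \<partial>lborel)
      = ennreal (2 * pi) * ennreal (\<integral>x. f x * R k x \<partial>lborel)" (is "?l = ?r") for k
  proof -
    have i: "integrable lborel (\<lambda>z. ?F (m k * z) * ?n z)"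
    proof (rule Bochner_Integration.integrable_bound)
      show "integrable lborel (\<lambda>z. (\<integral>x. \<bar>f x\<bar> \<partial>lborel)\<^sup>2 * ?n z)" by simp
      show "AE z in lborel. norm (?F (m k * z) * ?n z) \<le> norm ((\<integral>x. \<bar>f x\<bar> \<partial>lborel)\<^sup>2 * ?n z)"
        by (auto simp: abs_mult intro!: mult_right_mono power_mono fourier_bound)
    qed measurable
    have "?l = ennreal (m k) * (\<integral>\<^sup>+z. ennreal (?F (m k * z) * exp (- z\<^sup>2 / 2)) \<partial>lborel)"
      using m0[of k] by (subst nn_integral_real_affine[where c="m k" and t=0]) simp_all
    also have "(\<integral>\<^sup>+z. ennreal (?F (m k * z) * exp (- z\<^sup>2 / 2)) \<partial>lborel)
        = (\<integral>\<^sup>+z. ennreal (sqrt (2 * pi)) * ennreal (?F (m k * z) * ?n z) \<partial>lborel)"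
      by (intro nn_integral_cong) (simp add: std_normal_density_def flip: ennreal_mult)
    also have "\<dots> = ennreal (sqrt (2 * pi)) * ennreal (\<integral>z. ?F (m k * z) * ?n z \<partial>lborel)"
      using i by (subst nn_integral_cmult) (auto simp: nn_integral_eq_integral)
    also have "(\<integral>z. ?F (m k * z) * ?n z \<partial>lborel)
        = (\<integral>x. f x * (\<integral>y. f y * exp (- (m k * (x - y))\<^sup>2 / 2) \<partial>lborel) \<partial>lborel)"
      by (rule gaussian_energy[OF f])
    also have "\<dots> = (\<integral>x. sqrt (2 * pi) / m k * (f x * R k x) \<partial>lborel)"
    proof (intro Bochner_Integration.integral_cong refl)
      fix x
      have "(\<integral>y. f y * exp (- (m k * (x - y))\<^sup>2 / 2) \<partial>lborel)
          = \<bar>-1 / m k\<bar> *\<^sub>R (\<integral>u. f (x + (-1 / m k) * u) * exp (- (m k * (x - (x + (-1 / m k) * u)))\<^sup>2 / 2) \<partial>lborel)"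
        using m0[of k] by (intro lborel_integral_real_affine) simp
      also have "\<dots> = 1 / m k * (\<integral>u. sqrt (2 * pi) * (f (x - u / m k) * ?n u) \<partial>lborel)"
        using m0[of k] by (simp add: std_normal_density_def)
      also have "\<dots> = sqrt (2 * pi) / m k * R k x" unfolding R_def by simp
      finally show "f x * (\<integral>y. f y * exp (- (m k * (x - y))\<^sup>2 / 2) \<partial>lborel) = sqrt (2 * pi) / m k * (f x * R k x)"
        by simp
    qed
    also have "\<dots> = sqrt (2 * pi) / m k * (\<integral>x. f x * R k x \<partial>lborel)" by simp
    also have "ennreal (sqrt (2 * pi) / m k * (\<integral>x. f x * R k x \<partial>lborel)) = ennreal (sqrt (2 * pi) / m k) * ennreal (\<integral>x. f x * R k x \<partial>lborel)"
      using m0[of k] by (intro ennreal_mult') simp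
    finally have "?l = ennreal (m k) * (ennreal (sqrt (2 * pi)) * (ennreal (sqrt (2 * pi) / m k) * ennreal (\<integral>x. f x * R k x \<partial>lborel)))" .
    also have "\<dots> = ennreal (m k * (sqrt (2 * pi) * (sqrt (2 * pi) / m k))) * ennreal (\<integral>x. f x * R k x \<partial>lborel)"
      using m0[of k] by (simp only: ennreal_mult' mult.assoc less_imp_le real_sqrt_ge_zero pi_ge_zero zero_le_numeral mult_nonneg_nonneg)
    also have "m k * (sqrt (2 * pi) * (sqrt (2 * pi) / m k)) = 2 * pi"
      using m0[of k] by (simp add: field_simps)
    finally show ?thesis .
  qed
  have Rb: "\<bar>R k x\<bar> \<le> C" for k x
  proof -
    have "\<bar>R k x\<bar> \<le> (\<integral>u. C * ?n u \<partial>lborel)"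
      unfolding R_def
    proof (rule integral_abs_bound_integral)
      show "integrable lborel (\<lambda>u. f (x - u / m k) * ?n u)"
        by (rule Bochner_Integration.integrable_bound[of lborel "\<lambda>u. C * ?n u"])
          (auto simp: abs_mult intro!: mult_right_mono order_trans[OF C])
      show "\<bar>f (x - u / m k) * ?n u\<bar> \<le> C * ?n u" for u
        using C by (auto simp: abs_mult intro!: mult_right_mono)
    qed simp
    then show ?thesis by simp
  qed
  have Rm[measurable]: "R k \<in> borel_measurable borel" for k
    unfolding R_def[abs_def] by measurable
  have Rlim: "(\<lambda>k. R k x) \<longlonglongrightarrow> f x" for x
  proof -
    have "(\<lambda>k. R k x) \<longlonglongrightarrow> (\<integral>u. f x * ?n u \<partial>lborel)"
      unfolding R_def
    proof (rule integral_dominated_convergence[where w="\<lambda>u. C * ?n u"])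
      show "AE u in lborel. (\<lambda>k. f (x - u / m k) * ?n u) \<longlonglongrightarrow> f x * ?n u"
      proof (intro AE_I2 tendsto_intros)
        fix u
        have "(\<lambda>k. x - u * inverse (real (Suc k))) \<longlonglongrightarrow> x - u * 0"
          by (intro tendsto_intros LIMSEQ_inverse_real_of_nat)
        then have "(\<lambda>k. x - u / m k) \<longlonglongrightarrow> x" by (simp add: m_def divide_inverse)
        moreover have "isCont f x" using cont by (simp add: continuous_on_eq_continuous_at)
        ultimately show "(\<lambda>k. f (x - u / m k)) \<longlonglongrightarrow> f x" by (rule isCont_tendsto_compose[rotated])
      qed
      show "AE u in lborel. norm (f (x - u / m k) * ?n u) \<le> C * ?n u" for k
        using C by (auto simp: abs_mult intro!: mult_right_mono)
    qed simp_all
    then show ?thesis by simp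
  qed
  have "(\<lambda>k. \<integral>x. f x * R k x \<partial>lborel) \<longlonglongrightarrow> (\<integral>x. f x * f x \<partial>lborel)"
  proof (rule integral_dominated_convergence[where w="\<lambda>x. C * \<bar>f x\<bar>"])
    show "AE x in lborel. (\<lambda>k. f x * R k x) \<longlonglongrightarrow> f x * f x"
      by (intro AE_I2 tendsto_intros Rlim)
    show "AE x in lborel. norm (f x * R k x) \<le> C * \<bar>f x\<bar>" for k
      using Rb[of k] by (auto simp: abs_mult mult.commute[of C] intro!: mult_left_mono)
  qed (use f in simp_all)
  then have lim1: "(\<lambda>k. ennreal (2 * pi) * ennreal (\<integral>x. f x * R k x \<partial>lborel)) \<longlonglongrightarrow> ennreal (2 * pi) * ennreal (\<integral>x. f x * f x \<partial>lborel)"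
    by (intro ennreal_tendsto_cmult tendsto_ennrealI) simp_all
  have "norm (f x * f x) \<le> norm (C * \<bar>f x\<bar>)" for x
    using mult_right_mono[OF C[of x], of "\<bar>f x\<bar>"] C0 by (simp add: abs_mult)
  then have "AE x in lborel. norm (f x * f x) \<le> norm (C * \<bar>f x\<bar>)" by (rule AE_I2)
  moreover have "integrable lborel (\<lambda>x. C * \<bar>f x\<bar>)" "(\<lambda>x. f x * f x) \<in> borel_measurable lborel" using f by auto
  ultimately have "integrable lborel (\<lambda>x. f x * f x)"
    by (blast intro: Bochner_Integration.integrable_bound)
  then have sq: "ennreal (\<integral>x. f x * f x \<partial>lborel) = sq_norm lborel f"
    by (simp add: sq_norm_def power2_eq_square nn_integral_eq_integral)
  have "(\<lambda>k. \<integral>\<^sup>+\<xi>. ennreal (?F \<xi> * exp (- (\<xi> / m k)\<^sup>2 / 2)) \<partial>lborel) \<longlonglongrightarrow> (\<integral>\<^sup>+\<xi>. ennreal (?F \<xi>) \<partial>lborel)"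
  proof (rule nn_integral_LIMSEQ)
    show "incseq (\<lambda>k \<xi>. ennreal (?F \<xi> * exp (- (\<xi> / m k)\<^sup>2 / 2)))"
    proof (intro incseq_SucI le_funI ennreal_leI mult_left_mono)
      fix k \<xi>
      have "(\<bar>\<xi>\<bar> / m (Suc k))\<^sup>2 \<le> (\<bar>\<xi>\<bar> / m k)\<^sup>2"
        by (intro power_mono divide_left_mono) (auto simp: m_def)
      then show "exp (- (\<xi> / m k)\<^sup>2 / 2) \<le> exp (- (\<xi> / m (Suc k))\<^sup>2 / 2)" by (simp add: power_divide)
    qed simp
    fix \<xi>
    have "(\<lambda>k. \<xi> * inverse (real (Suc k))) \<longlonglongrightarrow> \<xi> * 0"
      by (intro tendsto_intros LIMSEQ_inverse_real_of_nat)
    then have l: "(\<lambda>k. \<xi> / m k) \<longlonglongrightarrow> 0" by (simp add: m_def divide_inverse)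
    have "(\<lambda>k. ?F \<xi> * exp (- (\<xi> / m k)\<^sup>2 / 2)) \<longlonglongrightarrow> ?F \<xi> * exp (- 0\<^sup>2 / 2)"
      by (intro tendsto_intros l) simp
    then show "(\<lambda>k. ennreal (?F \<xi> * exp (- (\<xi> / m k)\<^sup>2 / 2))) \<longlonglongrightarrow> ennreal (?F \<xi>)"
      by (intro tendsto_ennrealI) simp
  qed simp
  then show ?thesis using lim1 unfolding scale sq by (rule LIMSEQ_unique)
qed

text \<open>Jensen's inequality for the average over frequency shifts in
  \<open>fourier_mult_gaussian\<close>.\<close>

lemma fourier_mult_gaussian_energy:
  assumes f: "integrable lborel f"
  shows "ennreal ((cmod (fourier (\<lambda>x. f x * exp (- (s * x)\<^sup>2 / 2)) \<xi>))\<^sup>2)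
    \<le> (\<integral>\<^sup>+z. ennreal ((cmod (fourier f (\<xi> + s * z)))\<^sup>2) * ennreal (std_normal_density z) \<partial>lborel)"
proof -
  have [measurable]: "f \<in> borel_measurable borel" using f by simp
  let ?n = std_normal_density
  let ?G = "\<lambda>z. cmod (fourier f (\<xi> + s * z))"
  define B where "B = (\<integral>x. \<bar>f x\<bar> \<partial>lborel)"
  have fb: "cmod (fourier f \<xi>) \<le> B" for \<xi> unfolding B_def by (rule fourier_bound)
  have i1: "integrable lborel (\<lambda>z. ?G z * ?n z)"
    by (rule Bochner_Integration.integrable_bound[of lborel "\<lambda>z. B * ?n z"])
      (auto simp: abs_mult intro!: mult_right_mono order_trans[OF fb])
  have i2: "integrable lborel (\<lambda>z. (?G z)\<^sup>2 * ?n z)"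
    by (rule Bochner_Integration.integrable_bound[of lborel "\<lambda>z. B\<^sup>2 * ?n z"])
      (auto simp: abs_mult intro!: mult_right_mono power_mono fb)
  define c where "c = (\<integral>z. ?G z * ?n z \<partial>lborel)"
  have c0: "0 \<le> c" unfolding c_def by (intro integral_nonneg_AE AE_I2 mult_nonneg_nonneg) auto
  have "cmod (fourier (\<lambda>x. f x * exp (- (s * x)\<^sup>2 / 2)) \<xi>) \<le> (\<integral>z. cmod (fourier f (\<xi> + s * z) * complex_of_real (?n z)) \<partial>lborel)"
    unfolding fourier_mult_gaussian[OF f] by (rule integral_norm_bound)
  also have "\<dots> = c" unfolding c_def by (simp add: norm_mult)
  finally have "(cmod (fourier (\<lambda>x. f x * exp (- (s * x)\<^sup>2 / 2)) \<xi>))\<^sup>2 \<le> c\<^sup>2" by (intro power_mono) auto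
  \<comment> \<open>Jensen's inequality for the square says that a variance is nonnegative.\<close>
  also have "c\<^sup>2 \<le> (\<integral>z. (?G z)\<^sup>2 * ?n z \<partial>lborel)"
  proof -
    have "0 \<le> (\<integral>z. (?G z - c)\<^sup>2 * ?n z \<partial>lborel)" by (intro integral_nonneg_AE AE_I2 mult_nonneg_nonneg) auto
    also have "\<dots> = (\<integral>z. (?G z)\<^sup>2 * ?n z - 2 * c * (?G z * ?n z) + c\<^sup>2 * ?n z \<partial>lborel)"
      by (intro Bochner_Integration.integral_cong refl) (simp add: power2_eq_square algebra_simps)
    also have "\<dots> = (\<integral>z. (?G z)\<^sup>2 * ?n z \<partial>lborel) - 2 * c * c + c\<^sup>2"
      using i1 i2 by (simp add: c_def)
    finally show ?thesis by (simp add: power2_eq_square)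
  qed
  finally have "ennreal ((cmod (fourier (\<lambda>x. f x * exp (- (s * x)\<^sup>2 / 2)) \<xi>))\<^sup>2) \<le> ennreal (\<integral>z. (?G z)\<^sup>2 * ?n z \<partial>lborel)"
    by (rule ennreal_leI)
  also have "\<dots> = (\<integral>\<^sup>+z. ennreal ((?G z)\<^sup>2 * ?n z) \<partial>lborel)"
    using i2 by (intro nn_integral_eq_integral[symmetric]) auto
  finally show ?thesis by (simp add: ennreal_mult')
qed

subsection \<open>Test functions\<close>

text \<open>A class that contains \<open>schwartz\<close> and is closed under differences.
  Integrability, boundedness and continuity feed Plancherel's theorem; the Lipschitz constant
  controls the semigroup jointly in time and space.\<close>

definition test_function :: "(real \<Rightarrow> real) \<Rightarrow> bool" where
  "test_function f \<longleftrightarrow> integrable lborel f \<and> bounded (range f) \<and> (\<exists>L. L-lipschitz_on UNIV f)"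

lemma test_functionD:
  assumes "test_function f"
  shows "integrable lborel f" "bounded (range f)" "continuous_on UNIV f" "f \<in> borel_measurable borel"
  using assms unfolding test_function_def
  by (auto intro: lipschitz_on_continuous_on borel_measurable_continuous_onI)

lemma test_function_diff:
  assumes "test_function f" "test_function g"
  shows "test_function (\<lambda>x. f x - g x)"
proof -
  obtain L K where "L-lipschitz_on UNIV f" "K-lipschitz_on UNIV g"
    using assms unfolding test_function_def by blast
  then have "(L + K)-lipschitz_on UNIV (\<lambda>x. f x - g x)" by (rule lipschitz_on_diff)
  moreover have "bounded (range (\<lambda>x. f x - g x))"
  proof -
    obtain a b where "\<And>x. \<bar>f x\<bar> \<le> a" "\<And>x. \<bar>g x\<bar> \<le> b"
      using assms unfolding test_function_def bounded_iff by auto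
    then have "norm (f x - g x) \<le> a + b" for x
      by (metis abs_triangle_ineq4 add_mono order_trans real_norm_def)
    then show ?thesis by (auto simp: bounded_iff)
  qed
  ultimately show ?thesis using assms unfolding test_function_def by auto
qed

lemma integrable_inverse_one_plus_square: "integrable lborel (\<lambda>x::real. inverse (1 + x\<^sup>2))"
  using integrable_inverse_1_plus_square
  by (simp add: set_integrable_def)

text \<open>Three seminorms suffice: the sup norm, the sup norm of the derivative for the Lipschitz
  constant, and the sup norm of \<open>x\<^sup>2 * \<phi> x\<close>, which together with the first
  bounds \<open>\<phi>\<close> by a multiple of 1 / (1 + x^2).\<close>

lemma schwartz_test_function:
  assumes "\<phi> \<in> schwartz"
  shows "test_function \<phi>"
proof -
  have diff: "(deriv ^^ n) \<phi> field_differentiable at x" and bd: "bounded (range (\<lambda>x. x ^ k * (deriv ^^ n) \<phi> x))" for n k x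
    using assms by (auto simp: schwartz_def)
  have D: "(\<phi> has_field_derivative deriv \<phi> x) (at x)" for x
    using diff[of 0 x] by (simp add: DERIV_deriv_iff_field_differentiable)
  have b0: "bounded (range \<phi>)" using bd[of 0 0] by simp
  obtain B where B: "\<And>x. \<bar>deriv \<phi> x\<bar> \<le> B" using bd[of 0 1] by (auto simp: bounded_iff)
  have "0 \<le> B" using B[of 0] abs_ge_zero order_trans by blast
  have lip: "B-lipschitz_on UNIV \<phi>"
  proof (rule lipschitz_onI)
    fix x y :: real
    have "norm (\<phi> x - \<phi> y) \<le> B * norm (x - y)"
      by (rule field_differentiable_bound[of UNIV \<phi> "deriv \<phi>"]) (use D B in auto)
    then show "dist (\<phi> x) (\<phi> y) \<le> B * dist x y" by (simp add: dist_norm)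
  qed fact
  have [measurable]: "\<phi> \<in> borel_measurable borel"
    using lip by (intro borel_measurable_continuous_onI lipschitz_on_continuous_on)
  obtain a c where a: "\<And>x. \<bar>\<phi> x\<bar> \<le> a" and c: "\<And>x. \<bar>x\<^sup>2 * \<phi> x\<bar> \<le> c"
    using bd[of 0 0] bd[of 2 0] by (auto simp: bounded_iff)
  have "\<bar>\<phi> x\<bar> \<le> \<bar>(a + c) * inverse (1 + x\<^sup>2)\<bar>" for x
  proof -
    have "\<bar>\<phi> x\<bar> * (1 + x\<^sup>2) \<le> a + c" using a[of x] c[of x] by (simp add: algebra_simps abs_mult)
    then have "\<bar>\<phi> x\<bar> \<le> (a + c) * inverse (1 + x\<^sup>2)"
      by (simp add: field_simps add_pos_nonneg)
    then show ?thesis by linarith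
  qed
  then have "AE x in lborel. norm (\<phi> x) \<le> norm ((a + c) * inverse (1 + x\<^sup>2))"
    unfolding real_norm_def by (intro AE_I2)
  moreover have "integrable lborel (\<lambda>x. (a + c) * inverse (1 + x\<^sup>2))"
    by (intro integrable_mult_right integrable_inverse_one_plus_square)
  moreover have "\<phi> \<in> borel_measurable lborel" by simp
  ultimately have "integrable lborel \<phi>" by (blast intro: Bochner_Integration.integrable_bound)
  then show ?thesis using b0 lip unfolding test_function_def by blast
qed

section \<open>Gaussian test functions\<close>

lemma power_le_fact_mult_exp:
  fixes y :: real assumes "0 \<le> y"
  shows "y ^ k \<le> fact k * exp y"
proof -
  have "(\<Sum>n\<in>{k}. y ^ n /\<^sub>R fact n) \<le> (\<Sum>n. y ^ n /\<^sub>R fact n)"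
    using assms by (intro sum_le_suminf summable_exp_generic) auto
  then show ?thesis by (simp add: exp_def field_simps)
qed

text \<open>Even powers are controlled by one term of the exponential series at (s x)^2 / 2; odd
  powers follow from the bound of |x|^k by 1 + x^(2k).\<close>

lemma bounded_power_mult_gaussian:
  assumes "s \<noteq> 0"
  shows "bounded (range (\<lambda>x::real. x ^ k * exp (- (s * x)\<^sup>2 / 2)))"
proof -
  have "\<bar>x ^ k * exp (- (s * x)\<^sup>2 / 2)\<bar> \<le> 1 + fact k * (2 / s\<^sup>2) ^ k" for x
  proof -
    let ?E = "exp (- (s * x)\<^sup>2 / 2)"
    have "((s * x)\<^sup>2 / 2) ^ k * ?E \<le> fact k * exp ((s * x)\<^sup>2 / 2) * ?E"
      by (intro mult_right_mono power_le_fact_mult_exp) auto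
    also have "\<dots> = fact k" by (simp add: mult_exp_exp mult.assoc)
    finally have "(2 / s\<^sup>2) ^ k * (((s * x)\<^sup>2 / 2) ^ k * ?E) \<le> (2 / s\<^sup>2) ^ k * fact k"
      by (intro mult_left_mono) auto
    moreover have "(2 / s\<^sup>2) ^ k * ((s * x)\<^sup>2 / 2) ^ k = (x\<^sup>2) ^ k"
      unfolding power_mult_distrib[symmetric] using assms by (simp add: power_mult_distrib)
    ultimately have 1: "(x\<^sup>2) ^ k * ?E \<le> fact k * (2 / s\<^sup>2) ^ k" by (simp add: mult.assoc[symmetric] mult.commute)
    have "\<bar>x\<bar> ^ k \<le> 1 + (x\<^sup>2) ^ k"
    proof -
      have "2 * \<bar>x\<bar> ^ k \<le> 1 + (\<bar>x\<bar> ^ k)\<^sup>2" using sum_squares_bound[of 1 "\<bar>x\<bar> ^ k"] by simp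
      moreover have "(\<bar>x\<bar> ^ k)\<^sup>2 = (x\<^sup>2) ^ k" by (metis power2_abs power_commutes power_mult mult.commute)
      ultimately show ?thesis using zero_le_power[of "\<bar>x\<bar>" k] by linarith
    qed
    then have "\<bar>x\<bar> ^ k * ?E \<le> (1 + (x\<^sup>2) ^ k) * ?E" by (rule mult_right_mono) simp
    also have "\<dots> \<le> 1 + fact k * (2 / s\<^sup>2) ^ k" unfolding distrib_right using 1 by (intro add_mono) auto
    finally show ?thesis by (simp add: abs_mult power_abs)
  qed
  then show ?thesis by (auto simp: bounded_iff)
qed

lemma bounded_poly_mult_gaussian:
  assumes "s \<noteq> 0"
  shows "bounded (range (\<lambda>x::real. x ^ k * (poly p x * exp (- (s * x)\<^sup>2 / 2))))"
proof (induction p arbitrary: k)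
  case 0
  then show ?case by simp
next
  case (pCons a p)
  have "bounded (range (\<lambda>x. a * (x ^ k * exp (- (s * x)\<^sup>2 / 2)) + x ^ Suc k * (poly p x * exp (- (s * x)\<^sup>2 / 2))))"
    using bounded_scaleR_comp[OF bounded_power_mult_gaussian[OF assms, of k], of a]
    by (intro bounded_plus_comp pCons) simp
  then show ?case by (simp add: algebra_simps)
qed

text \<open>Constant polynomials give the real and imaginary parts of an exponential times a
  Gaussian, which are the test functions of interest. Polynomial coefficients make the family closed
  under differentiation.\<close>

definition poly_trig_gaussian :: "real \<Rightarrow> real \<Rightarrow> real poly \<Rightarrow> real poly \<Rightarrow> real \<Rightarrow> real" where
  "poly_trig_gaussian \<xi> s p q x = (poly p x * cos (\<xi> * x) + poly q x * sin (\<xi> * x)) * exp (- (s * x)\<^sup>2 / 2)"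

lemma poly_trig_gaussian_deriv:
  "(poly_trig_gaussian \<xi> s p q has_field_derivative
     poly_trig_gaussian \<xi> s (pderiv p + smult \<xi> q - smult (s\<^sup>2) (pCons 0 p))
       (pderiv q - smult \<xi> p - smult (s\<^sup>2) (pCons 0 q)) x) (at x)"
  unfolding poly_trig_gaussian_def[abs_def]
  by (rule derivative_eq_intros poly_DERIV refl | simp)+ (simp add: algebra_simps power2_eq_square)

lemma poly_trig_gaussian_schwartz:
  assumes "s \<noteq> 0"
  shows "poly_trig_gaussian \<xi> s p q \<in> schwartz"
proof -
  have D: "\<exists>p' q'. (deriv ^^ n) (poly_trig_gaussian \<xi> s p q) = poly_trig_gaussian \<xi> s p' q'" for n
  proof (induction n)
    case (Suc n)
    then obtain p' q' where "(deriv ^^ n) (poly_trig_gaussian \<xi> s p q) = poly_trig_gaussian \<xi> s p' q'" by blast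
    then have "(deriv ^^ Suc n) (poly_trig_gaussian \<xi> s p q) = deriv (poly_trig_gaussian \<xi> s p' q')" by simp
    also have "\<dots> = poly_trig_gaussian \<xi> s (pderiv p' + smult \<xi> q' - smult (s\<^sup>2) (pCons 0 p'))
       (pderiv q' - smult \<xi> p' - smult (s\<^sup>2) (pCons 0 q'))"
      by (intro ext DERIV_imp_deriv poly_trig_gaussian_deriv)
    finally show ?case by blast
  qed auto
  have "bounded (range (\<lambda>x. x ^ k * poly_trig_gaussian \<xi> s p q x))" for k p q
  proof -
    obtain a where a: "\<And>x. \<bar>x ^ k * (poly p x * exp (- (s * x)\<^sup>2 / 2))\<bar> \<le> a"
      using bounded_poly_mult_gaussian[OF assms, of k p] by (auto simp: bounded_iff)
    obtain b where b: "\<And>x. \<bar>x ^ k * (poly q x * exp (- (s * x)\<^sup>2 / 2))\<bar> \<le> b"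
      using bounded_poly_mult_gaussian[OF assms, of k q] by (auto simp: bounded_iff)
    have "\<bar>x ^ k * poly_trig_gaussian \<xi> s p q x\<bar> \<le> a + b" for x
    proof -
      let ?u = "x ^ k * (poly p x * exp (- (s * x)\<^sup>2 / 2))" and ?v = "x ^ k * (poly q x * exp (- (s * x)\<^sup>2 / 2))"
      have "x ^ k * poly_trig_gaussian \<xi> s p q x = ?u * cos (\<xi> * x) + ?v * sin (\<xi> * x)"
        by (simp add: poly_trig_gaussian_def algebra_simps)
      also have "\<bar>\<dots>\<bar> \<le> \<bar>?u * cos (\<xi> * x)\<bar> + \<bar>?v * sin (\<xi> * x)\<bar>" by (rule abs_triangle_ineq)
      also have "\<dots> \<le> \<bar>?u\<bar> + \<bar>?v\<bar>"
        unfolding abs_mult[of ?u] abs_mult[of ?v] by (intro add_mono mult_left_le) auto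
      also have "\<dots> \<le> a + b" by (intro add_mono a b)
      finally show ?thesis .
    qed
    then show ?thesis by (auto simp: bounded_iff)
  qed
  moreover have "poly_trig_gaussian \<xi> s p q field_differentiable at x" for p q x
    using poly_trig_gaussian_deriv field_differentiable_def by blast
  ultimately have "(deriv ^^ n) (poly_trig_gaussian \<xi> s p q) field_differentiable at x \<and>
      bounded (range (\<lambda>x. x ^ k * (deriv ^^ n) (poly_trig_gaussian \<xi> s p q) x))" for n k x
    using D[of n] by (elim exE) simp
  then show ?thesis unfolding schwartz_def by blast
qed

text \<open>The exponential itself is not in \<open>schwartz\<close>, but its real and imaginary
  parts are after multiplication by a Gaussian. The transform of the damped function at a fixed
  frequency is thus a pairing with test functions, to which the distributional limit
  applies.\<close>

lemma fourier_distributional_limit: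
  assumes \<phi>: "\<And>n. \<phi> n \<in> schwartz" and lim: "distributional_limit \<phi> (dirac x)" and s: "s \<noteq> 0"
  shows "(\<lambda>n. fourier (\<lambda>y. \<phi> n y * exp (- (s * y)\<^sup>2 / 2)) \<xi>) \<longlonglongrightarrow> iexp (\<xi> * x) * complex_of_real (exp (- (s * x)\<^sup>2 / 2))"
proof -
  let ?c = "poly_trig_gaussian \<xi> s 1 0" and ?s = "poly_trig_gaussian \<xi> s 0 1"
  have sch: "?c \<in> schwartz" "?s \<in> schwartz" using s by (simp_all add: poly_trig_gaussian_schwartz)
  have c: "?c y = cos (\<xi> * y) * exp (- (s * y)\<^sup>2 / 2)" and sn: "?s y = sin (\<xi> * y) * exp (- (s * y)\<^sup>2 / 2)" for y
    by (simp_all add: poly_trig_gaussian_def)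
  have eq: "iexp (\<xi> * y) * complex_of_real (a * exp (- (s * y)\<^sup>2 / 2)) = complex_of_real (a * ?c y) + \<i> * complex_of_real (a * ?s y)" for a y
    unfolding c sn by (simp add: complex_eq_iff Re_exp Im_exp)
  have "fourier (\<lambda>y. \<phi> n y * exp (- (s * y)\<^sup>2 / 2)) \<xi>
      = complex_of_real (\<integral>y. \<phi> n y * ?c y \<partial>lborel) + \<i> * complex_of_real (\<integral>y. \<phi> n y * ?s y \<partial>lborel)" for n
  proof -
    have int: "integrable lborel (\<lambda>y. \<phi> n y * \<psi> y)" if "\<psi> \<in> schwartz" for \<psi>
    proof -
      note t1 = test_functionD[OF schwartz_test_function[OF \<phi>[of n]]] and t2 = test_functionD[OF schwartz_test_function[OF that]]
      note [measurable] = t1(4) t2(4)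
      obtain B where B: "\<And>y. \<bar>\<psi> y\<bar> \<le> B" using t2(2) by (auto simp: bounded_iff)
      show ?thesis
      proof (rule Bochner_Integration.integrable_bound[of lborel "\<lambda>y. B * \<bar>\<phi> n y\<bar>"])
        show "AE y in lborel. norm (\<phi> n y * \<psi> y) \<le> norm (B * \<bar>\<phi> n y\<bar>)"
        proof (rule AE_I2)
          fix y
          have "\<bar>\<psi> y\<bar> * \<bar>\<phi> n y\<bar> \<le> \<bar>B\<bar> * \<bar>\<phi> n y\<bar>"
            using B[of y] by (intro mult_right_mono) auto
          then show "norm (\<phi> n y * \<psi> y) \<le> norm (B * \<bar>\<phi> n y\<bar>)" by (simp add: abs_mult mult.commute)
        qed
      qed (use t1 in simp_all)
    qed
    show ?thesis
      unfolding fourier_def eq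
      using int[OF sch(1)] int[OF sch(2)]
      by (subst Bochner_Integration.integral_add) (simp_all del: of_real_mult add: integral_complex_of_real)
  qed
  moreover have "(\<lambda>n. complex_of_real (\<integral>y. \<phi> n y * ?c y \<partial>lborel) + \<i> * complex_of_real (\<integral>y. \<phi> n y * ?s y \<partial>lborel))
      \<longlonglongrightarrow> complex_of_real (?c x) + \<i> * complex_of_real (?s x)"
    using lim sch unfolding distributional_limit_def dirac_def by (intro tendsto_intros) auto
  ultimately show ?thesis using eq[of x 1] by simp
qed

subsection \<open>The characteristic exponent\<close>

locale levy =
  fixes N :: "'o measure" and X :: "real \<Rightarrow> 'o \<Rightarrow> real"
  assumes levy: "levy_process N X"

sublocale levy \<subseteq> prob_space N
  using levy by (simp add: levy_process_def)

context levy
begin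

lemma X_measurable: "0 \<le> t \<Longrightarrow> X t \<in> borel_measurable N"
  using levy by (simp add: levy_process_def)

lemma increment_law: "0 \<le> s \<Longrightarrow> 0 \<le> t \<Longrightarrow> distr N borel (\<lambda>\<omega>. X (s + t) \<omega> - X s \<omega>) = distr N borel (X t)"
  using levy by (simp add: levy_process_def)

text \<open>In the notation of the theorem this is \<open>exp (- t * \<Psi> \<xi>)\<close>. Working
  with the function of \<open>t\<close> avoids choosing a branch of the complex logarithm.\<close>

definition chr :: "real \<Rightarrow> real \<Rightarrow> complex" where
  "chr t \<xi> = (CLINT \<omega>|N. iexp (\<xi> * X t \<omega>))"

lemma chr_eq_char: "0 \<le> t \<Longrightarrow> chr t = char (distr N borel (X t))"
  using X_measurable[of t] by (intro ext) (simp add: chr_def char_def integral_distr)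

lemma real_distribution_X: "0 \<le> t \<Longrightarrow> real_distribution (distr N borel (X t))"
  using X_measurable by simp

lemma chr_measurable: "0 \<le> t \<Longrightarrow> chr t \<in> borel_measurable borel"
  unfolding chr_eq_char by (rule real_distribution.char_measurable[OF real_distribution_X])

lemma chr_continuous: "0 \<le> t \<Longrightarrow> isCont (chr t) \<xi>"
  unfolding chr_eq_char by (rule real_distribution.isCont_char[OF real_distribution_X])

lemma cmod_chr_le_1: "0 \<le> t \<Longrightarrow> cmod (chr t \<xi>) \<le> 1"
  unfolding chr_eq_char by (rule real_distribution.cmod_char_le_1[OF real_distribution_X])

lemma iexp_X_integrable: "0 \<le> t \<Longrightarrow> integrable N (\<lambda>\<omega>. iexp (\<xi> * X t \<omega>))"
  using X_measurable[of t] by (intro integrable_const_bound[where B=1]) auto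

text \<open>The increments over the grid 0, s, s + t are independent and stationary, so the
  characteristic function of their sum factorises. \<open>X 0\<close> vanishes only almost surely
  and is therefore kept in the increments, where \<open>increment_law\<close> at time 0 disposes of
  it.\<close>

lemma chr_add:
  assumes "0 \<le> s" "0 \<le> t"
  shows "chr (s + t) \<xi> = chr s \<xi> * chr t \<xi>"
proof -
  define \<tau> :: "nat \<Rightarrow> real" where "\<tau> i = (if i = 0 then 0 else if i = 1 then s else s + t)" for i
  let ?D = "\<lambda>i \<omega>. X (\<tau> (Suc i)) \<omega> - X (\<tau> i) \<omega>"
  have "0 \<le> \<tau> 0 \<and> mono_on {..2} \<tau>" using assms by (auto simp: \<tau>_def mono_on_def)
  moreover have "\<forall>(t :: nat \<Rightarrow> real) n. 0 \<le> t 0 \<and> mono_on {..n} t \<longrightarrow>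
        indep_vars (\<lambda>_. borel) (\<lambda>i \<omega>. X (t (Suc i)) \<omega> - X (t i) \<omega>) {..<n}"
    using levy unfolding levy_process_def by blast
  ultimately have ind: "indep_vars (\<lambda>_. borel) ?D {..<2}" by blast
  have m: "random_variable borel (?D i)" for i
    using assms by (intro borel_measurable_diff X_measurable) (auto simp: \<tau>_def)
  have "char (distr N borel (\<lambda>\<omega>. \<Sum>i<2. ?D i \<omega>)) \<xi> = (\<Prod>i<2. char (distr N borel (?D i)) \<xi>)"
    by (rule char_distr_sum[OF ind])
  also have "(\<lambda>\<omega>. \<Sum>i<2. ?D i \<omega>) = (\<lambda>\<omega>. X (0 + (s + t)) \<omega> - X 0 \<omega>)"
    by (simp add: numeral_2_eq_2 \<tau>_def)
  also have "(\<Prod>i<2. char (distr N borel (?D i)) \<xi>)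
      = char (distr N borel (\<lambda>\<omega>. X (0 + s) \<omega> - X 0 \<omega>)) \<xi> * char (distr N borel (\<lambda>\<omega>. X (s + t) \<omega> - X s \<omega>)) \<xi>"
    by (simp add: numeral_2_eq_2 \<tau>_def)
  finally show ?thesis
    using assms increment_law[of 0 "s + t"] increment_law[of 0 s] increment_law[of s t]
    by (simp add: chr_eq_char)
qed

lemma chr_0: "chr 0 \<xi> = 1"
proof -
  have "AE \<omega> in N. X 0 \<omega> = 0" using levy by (simp add: levy_process_def)
  then have "chr 0 \<xi> = (CLINT \<omega>|N. 1)"
    unfolding chr_def using X_measurable[of 0] by (intro integral_cong_AE) auto
  then show ?thesis by (simp add: prob_space)
qed

text \<open>Right continuity at 0 along a sequence. Members with \<open>h n = 0\<close> need a case
  of their own, because \<open>at_right 0\<close> excludes 0.\<close>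

lemma X_tendsto_zero:
  assumes h: "\<And>n. 0 \<le> h n" "h \<longlonglongrightarrow> 0"
  shows "AE \<omega> in N. (\<lambda>n. X (h n) \<omega>) \<longlonglongrightarrow> 0"
proof -
  have "AE \<omega> in N. X 0 \<omega> = 0" and "AE \<omega> in N. ((\<lambda>s. X s \<omega>) \<longlongrightarrow> X 0 \<omega>) (at_right 0)"
    using levy by (auto simp: levy_process_def)
  then show ?thesis
  proof eventually_elim
    case (elim \<omega>)
    show ?case
    proof (rule tendstoI)
      fix e :: real assume e: "0 < e"
      have "\<forall>\<^sub>F s in at_right 0. dist (X s \<omega>) (X 0 \<omega>) < e" using elim(2) e by (rule tendstoD)
      then obtain d where d: "d > 0" "\<And>s. 0 < s \<Longrightarrow> s < d \<Longrightarrow> dist (X s \<omega>) (X 0 \<omega>) < e"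
        unfolding eventually_at_right_field by blast
      have "\<forall>\<^sub>F n in sequentially. h n < d" using h(2) d(1) by (rule order_tendstoD)
      then show "\<forall>\<^sub>F n in sequentially. dist (X (h n) \<omega>) 0 < e"
      proof eventually_elim
        case (elim n)
        then show ?case
          using d(2)[of "h n"] h(1)[of n] e \<open>X 0 \<omega> = 0\<close> by (cases "h n = 0") auto
      qed
    qed
  qed
qed

lemma chr_tendsto_1:
  assumes h: "\<And>n. 0 \<le> h n" "h \<longlonglongrightarrow> 0"
  shows "(\<lambda>n. chr (h n) \<xi>) \<longlonglongrightarrow> 1"
proof -
  have "(\<lambda>n. chr (h n) \<xi>) \<longlonglongrightarrow> (CLINT \<omega>|N. 1)"
    unfolding chr_def
  proof (rule integral_dominated_convergence[where w="\<lambda>_. 1"])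
    show "AE \<omega> in N. (\<lambda>n. iexp (\<xi> * X (h n) \<omega>)) \<longlonglongrightarrow> 1"
      using X_tendsto_zero[OF h]
    proof eventually_elim
      case (elim \<omega>)
      have "(\<lambda>n. iexp (\<xi> * X (h n) \<omega>)) \<longlonglongrightarrow> iexp (\<xi> * 0)"
        by (intro tendsto_intros elim)
      then show ?case by simp
    qed
  qed (use X_measurable[OF h(1)] in auto)
  then show ?thesis by (simp add: prob_space)
qed

lemma chr_of_nat_mult: "0 \<le> t \<Longrightarrow> chr (real n * t) \<xi> = chr t \<xi> ^ n"
proof (induction n)
  case (Suc n)
  have "chr (real (Suc n) * t) \<xi> = chr (t + real n * t) \<xi>" by (simp add: algebra_simps)
  also have "\<dots> = chr t \<xi> * chr (real n * t) \<xi>" using Suc by (intro chr_add) auto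
  finally show ?case using Suc by simp
qed (simp add: chr_0)

text \<open>A zero at time \<open>t\<close> would force a zero at each time \<open>t / n\<close> by
  taking roots, while the values at small times tend to 1.\<close>

lemma chr_nonzero: "0 \<le> t \<Longrightarrow> chr t \<xi> \<noteq> 0"
proof
  assume t: "0 \<le> t" and z: "chr t \<xi> = 0"
  have "(\<lambda>n. t * inverse (real (Suc n))) \<longlonglongrightarrow> t * 0"
    by (intro tendsto_intros LIMSEQ_inverse_real_of_nat)
  then have "(\<lambda>n. chr (t * inverse (real (Suc n))) \<xi>) \<longlonglongrightarrow> 1"
    using t by (intro chr_tendsto_1) auto
  moreover have "chr (t * inverse (real (Suc n))) \<xi> = 0" for n
  proof -
    have "chr (t * inverse (real (Suc n))) \<xi> ^ Suc n = chr (real (Suc n) * (t * inverse (real (Suc n)))) \<xi>"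
      using t by (intro chr_of_nat_mult[symmetric]) auto
    also have "real (Suc n) * (t * inverse (real (Suc n))) = t" by simp
    finally show ?thesis using z by (auto simp del: power_Suc of_nat_Suc)
  qed
  ultimately show False using LIMSEQ_unique[of "\<lambda>_. 0::complex" 0 1] by simp
qed

text \<open>The real part of the characteristic exponent, written \<open>\<rho>\<close> in the
  overview.\<close>

definition rate :: "real \<Rightarrow> real" where
  "rate \<xi> = - ln (cmod (chr 1 \<xi>))"

lemma rate_measurable [measurable]: "rate \<in> borel_measurable borel"
  unfolding rate_def[abs_def] using chr_measurable[of 1] by measurable

lemma rate_nonneg: "0 \<le> rate \<xi>"
  using cmod_chr_le_1[of 1 \<xi>] chr_nonzero[of 1 \<xi>] by (simp add: rate_def)

text \<open>Cauchy's functional equation: minus the logarithm of the modulus is additive and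
  nonnegative in \<open>t\<close>, hence monotone, hence linear.\<close>

lemma cmod_chr:
  assumes t: "0 \<le> t"
  shows "cmod (chr t \<xi>) = exp (- t * rate \<xi>)"
proof -
  define g where "g t = - ln (cmod (chr t \<xi>))" for t
  have g1: "g 1 = rate \<xi>" by (simp add: g_def rate_def)
  have add: "g (s + t) = g s + g t" if "0 \<le> s" "0 \<le> t" for s t
    using chr_nonzero[OF that(1), of \<xi>] chr_nonzero[OF that(2), of \<xi>]
    by (simp add: g_def chr_add[OF that] norm_mult ln_mult)
  have nn: "0 \<le> g t" if "0 \<le> t" for t
    using cmod_chr_le_1[OF that, of \<xi>] chr_nonzero[OF that, of \<xi>] by (simp add: g_def)
  have mono: "g s \<le> g t" if "0 \<le> s" "s \<le> t" for s t
    using add[of s "t - s"] nn[of "t - s"] that by simp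
  have nat: "g (real n * t) = real n * g t" if "0 \<le> t" for n t
    using chr_nonzero[OF that, of \<xi>] by (simp add: g_def chr_of_nat_mult[OF that] norm_power ln_realpow)
  \<comment> \<open>With \<open>k\<close> the integer part of \<open>n * t\<close>, both
    \<open>n * g t\<close> and \<open>n * t * g 1\<close> lie between \<open>k * g 1\<close> and
    \<open>(k + 1) * g 1\<close>. Their distance is at most \<open>g 1\<close> for every
    \<open>n\<close>, which forces equality in the limit.\<close>
  have bound: "real n * \<bar>g t - t * g 1\<bar> \<le> g 1" for n
  proof -
    define k where "k = nat \<lfloor>real n * t\<rfloor>"
    have k: "real k \<le> real n * t" "real n * t \<le> real (Suc k)"      using t by (simp_all add: k_def) linarith
    have "g (real k * 1) \<le> g (real n * t)" "g (real n * t) \<le> g (real (Suc k) * 1)"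
      using k t by (auto intro!: mono)
    then have "real k * g 1 \<le> real n * g t" "real n * g t \<le> (real k + 1) * g 1"
      unfolding nat[OF t] nat[OF zero_le_one] by (simp_all add: add.commute)
    moreover have "real k * g 1 \<le> (real n * t) * g 1" "(real n * t) * g 1 \<le> (real k + 1) * g 1"
      using k nn[of 1] by (intro mult_right_mono; simp)+
    ultimately have "\<bar>real n * g t - real n * t * g 1\<bar> \<le> g 1" by (simp add: distrib_right abs_le_iff)
    moreover have "real n * g t - real n * t * g 1 = real n * (g t - t * g 1)" by (simp add: algebra_simps)
    ultimately show ?thesis by (simp add: abs_mult)
  qed
  have "g t = t * g 1"
  proof (rule ccontr)
    assume "g t \<noteq> t * g 1"
    then have "0 < \<bar>g t - t * g 1\<bar>" by simp
    then obtain n where "g 1 < real n * \<bar>g t - t * g 1\<bar>" using reals_Archimedean3 by blast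
    then show False using bound[of n] by simp
  qed
  then have "ln (cmod (chr t \<xi>)) = - t * rate \<xi>" unfolding g1 by (simp add: g_def)
  then show ?thesis using chr_nonzero[OF t, of \<xi>] by (metis exp_ln zero_less_norm_iff)
qed

lemma cmod_chr_sq: "0 \<le> t \<Longrightarrow> (cmod (chr t \<xi>))\<^sup>2 = exp (- 2 * t * rate \<xi>)"
  by (simp add: cmod_chr exp_double[symmetric] algebra_simps)

lemma chr_uminus: "chr t (- \<xi>) = cnj (chr t \<xi>)"
  unfolding chr_def Bochner_Integration.integral_cnj[symmetric] by (simp add: exp_cnj)

lemma rate_uminus: "rate (- \<xi>) = rate \<xi>"
  by (simp add: rate_def chr_uminus)

lemma cmod_diff_sq_unit:
  assumes "cmod z = 1" "cmod w = 1"
  shows "(cmod (z - w))\<^sup>2 = 2 - 2 * Re (z * cnj w)"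
  using assms cmod_power2[of z] cmod_power2[of w]
  unfolding cmod_power2[of "z - w"] by (simp add: power2_eq_square algebra_simps)

text \<open>The unit vectors \<open>exp (i \<xi> X)\<close>, \<open>1\<close> and \<open>exp (- i \<eta> X)\<close> of \<open>L\<^sup>2\<close>, multiplied by suitable
  phases, have squared distances \<open>2 - 2 |\<phi>|\<close>, so this is the triangle inequality.\<close>

lemma one_minus_cmod_chr_add:
  assumes t: "0 \<le> t"
  shows "1 - cmod (chr t (\<xi> + \<eta>)) \<le> 2 * (1 - cmod (chr t \<xi>)) + 2 * (1 - cmod (chr t \<eta>))"
proof -
  let ?a = "chr t \<xi>" and ?b = "chr t \<eta>"
  \<comment> \<open>The phases rotate both expectations onto the positive axis, so that their real
    parts are the moduli. \<open>\<beta>\<close> enters conjugated because it belongs to the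
    frequency \<open>- \<eta>\<close>.\<close>
  define \<alpha> where "\<alpha> = cnj ?a / cmod ?a"
  define \<beta> where "\<beta> = ?b / cmod ?b"
  have u: "cmod \<alpha> = 1" "cmod \<beta> = 1"
    using chr_nonzero[OF t] by (simp_all add: \<alpha>_def \<beta>_def norm_divide)
  have \<alpha>a: "\<alpha> * ?a = complex_of_real (cmod ?a)"
    using chr_nonzero[OF t, of \<xi>] complex_norm_square[of ?a] by (simp add: \<alpha>_def field_simps power2_eq_square)
  have \<beta>b: "cnj \<beta> * ?b = complex_of_real (cmod ?b)"
    using chr_nonzero[OF t, of \<eta>] complex_norm_square[of ?b] by (simp add: \<beta>_def field_simps power2_eq_square)
  have pw: "2 - 2 * Re (\<alpha> * cnj \<beta> * iexp ((\<xi> + \<eta>) * x))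
      \<le> 2 * (2 - 2 * Re (\<alpha> * iexp (\<xi> * x))) + 2 * (2 - 2 * Re (cnj \<beta> * iexp (\<eta> * x)))" for x
  proof -
    let ?z = "\<alpha> * iexp (\<xi> * x)" and ?w = "\<beta> * iexp (- (\<eta> * x))"
    have z: "cmod ?z = 1" "cmod ?w = 1" using u by (simp_all add: norm_mult)
    have "cmod (?z - ?w) \<le> cmod (?z - 1) + cmod (1 - ?w)"      using norm_triangle_ineq[of "?z - 1" "1 - ?w"] by simp
    then have "(cmod (?z - ?w))\<^sup>2 \<le> (cmod (?z - 1) + cmod (1 - ?w))\<^sup>2" by (intro power_mono) auto
    also have "\<dots> \<le> 2 * (cmod (?z - 1))\<^sup>2 + 2 * (cmod (1 - ?w))\<^sup>2" by (rule sq_add_le)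
    finally have "2 - 2 * Re (?z * cnj ?w) \<le> 2 * (2 - 2 * Re (?z * cnj 1)) + 2 * (2 - 2 * Re (1 * cnj ?w))"
      using z by (simp only: cmod_diff_sq_unit norm_one)
    moreover have "cnj ?w = cnj \<beta> * iexp (\<eta> * x)" by (simp add: exp_cnj)
    moreover have "?z * (cnj \<beta> * iexp (\<eta> * x)) = \<alpha> * cnj \<beta> * iexp ((\<xi> + \<eta>) * x)"
      by (simp add: exp_add distrib_left distrib_right)
    ultimately show ?thesis by (simp only: complex_cnj_one mult_1_right mult_1_left)
  qed
  note I = iexp_X_integrable[OF t]
  have int: "integrable N (\<lambda>\<omega>. Re (c * iexp (\<zeta> * X t \<omega>)))" for c \<zeta>
    by (intro integrable_Re integrable_mult_right I)
  have ev: "(\<integral>\<omega>. Re (c * iexp (\<zeta> * X t \<omega>)) \<partial>N) = Re (c * chr t \<zeta>)" for c \<zeta>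
    unfolding chr_def by (subst integral_Re, rule integrable_mult_right[OF I], subst integral_mult_right_zero, rule refl)
  have "(\<integral>\<omega>. 2 - 2 * Re (\<alpha> * cnj \<beta> * iexp ((\<xi> + \<eta>) * X t \<omega>)) \<partial>N)
      \<le> (\<integral>\<omega>. 2 * (2 - 2 * Re (\<alpha> * iexp (\<xi> * X t \<omega>))) + 2 * (2 - 2 * Re (cnj \<beta> * iexp (\<eta> * X t \<omega>))) \<partial>N)"
    by (intro integral_mono pw Bochner_Integration.integrable_add Bochner_Integration.integrable_diff integrable_mult_right int integrable_const)
  moreover have "(\<integral>\<omega>. 2 - 2 * Re (\<alpha> * cnj \<beta> * iexp ((\<xi> + \<eta>) * X t \<omega>)) \<partial>N) = 2 - 2 * Re (\<alpha> * cnj \<beta> * chr t (\<xi> + \<eta>))"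
    by (subst Bochner_Integration.integral_diff, rule integrable_const, rule integrable_mult_right[OF int])
      (simp only: integral_mult_right_zero ev, simp add: prob_space)
  moreover have "(\<integral>\<omega>. 2 * (2 - 2 * Re (\<alpha> * iexp (\<xi> * X t \<omega>))) + 2 * (2 - 2 * Re (cnj \<beta> * iexp (\<eta> * X t \<omega>))) \<partial>N)
      = 2 * (2 - 2 * Re (\<alpha> * ?a)) + 2 * (2 - 2 * Re (cnj \<beta> * ?b))"
  proof -
    have i2: "integrable N (\<lambda>\<omega>. 2 * (2 - 2 * Re (c * iexp (\<zeta> * X t \<omega>))))" for c \<zeta>
      by (intro Bochner_Integration.integrable_diff integrable_mult_right int integrable_const)
    have ev2: "(\<integral>\<omega>. 2 * (2 - 2 * Re (c * iexp (\<zeta> * X t \<omega>))) \<partial>N) = 2 * (2 - 2 * Re (c * chr t \<zeta>))" for c \<zeta>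
      by (subst integral_mult_right_zero, subst Bochner_Integration.integral_diff, rule integrable_const, rule integrable_mult_right[OF int])
        (simp only: integral_mult_right_zero ev, simp add: prob_space)
    show ?thesis unfolding Bochner_Integration.integral_add[OF i2 i2] by (simp only: ev2)
  qed
  moreover have "Re (\<alpha> * cnj \<beta> * chr t (\<xi> + \<eta>)) \<le> cmod (chr t (\<xi> + \<eta>))"
    using complex_Re_le_cmod[of "\<alpha> * cnj \<beta> * chr t (\<xi> + \<eta>)"] u by (simp add: norm_mult)
  ultimately show ?thesis unfolding \<alpha>a \<beta>b by simp
qed

text \<open>The preceding inequality to first order at time 0: the bounds x / (1 + x) <= 1 - exp
  (-x) <= x replace a derivative, then \<open>s\<close> tends to 0.\<close>

lemma rate_add_le: "rate (\<xi> + \<eta>) \<le> 2 * rate \<xi> + 2 * rate \<eta>"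
proof -
  let ?r = "rate (\<xi> + \<eta>)" and ?q = "2 * rate \<xi> + 2 * rate \<eta>"
  have le: "?r \<le> ?q * (1 + s * ?r)" if s: "0 < s" for s
  proof -
    have pos: "0 < 1 + s * ?r" using s rate_nonneg[of "\<xi> + \<eta>"] by (simp add: add_pos_nonneg)
    have "exp (- (s * ?r)) \<le> inverse (1 + s * ?r)"
      unfolding exp_minus using pos exp_ge_add_one_self[of "s * ?r"] by (intro le_imp_inverse_le) auto
    then have "s * ?r / (1 + s * ?r) \<le> 1 - exp (- (s * ?r))" using pos by (simp add: field_simps)
    also have "\<dots> \<le> 2 * (1 - exp (- (s * rate \<xi>))) + 2 * (1 - exp (- (s * rate \<eta>)))"
      using one_minus_cmod_chr_add[of s \<xi> \<eta>] s by (simp add: cmod_chr)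
    also have "\<dots> \<le> 2 * (s * rate \<xi>) + 2 * (s * rate \<eta>)"
      using exp_ge_add_one_self[of "- (s * rate \<xi>)"] exp_ge_add_one_self[of "- (s * rate \<eta>)"] by simp
    also have "\<dots> = s * ?q" by (simp add: algebra_simps)
    finally have "s * ?r \<le> s * (?q * (1 + s * ?r))" using pos by (simp add: divide_le_eq mult.assoc)
    then show ?thesis using s by simp
  qed
  have "((\<lambda>s. ?q * (1 + s * ?r)) \<longlongrightarrow> ?q * (1 + 0 * ?r)) (at_right 0)"
    by (intro tendsto_intros)
  then have "?r \<le> ?q * (1 + 0 * ?r)"
    by (rule tendsto_lowerbound) (auto simp: eventually_at_right_field intro!: le exI[of _ 1])
  then show ?thesis by simp
qed

text \<open>Halving the argument costs a factor 4, so a bound on [-1, 1] propagates through the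
  dyadic scales to quadratic growth. The form \<open>max 1 (4 * \<xi>\<^sup>2)\<close> is made for
  the induction: outside [-1, 1] its value at \<open>\<xi> / 2\<close> is exactly
  \<open>\<xi>\<^sup>2\<close>.\<close>

lemma rate_quadratic_bound: "\<exists>K\<ge>0. \<forall>\<xi>. rate \<xi> \<le> K * (1 + \<xi>\<^sup>2)"
proof -
  have "isCont rate \<xi>" for \<xi>
    unfolding rate_def[abs_def] using chr_continuous[of 1 \<xi>] chr_nonzero[of 1 \<xi>]
    by (intro continuous_intros) auto
  then have "continuous_on {-1..1} rate" by (simp add: continuous_at_imp_continuous_on)
  then have "bounded (rate ` {-1..1})" by (intro compact_imp_bounded compact_continuous_image) auto
  then obtain K where "\<forall>r\<in>rate ` {-1..1}. norm r \<le> K" unfolding bounded_iff by blast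
  then have K: "\<bar>rate \<xi>\<bar> \<le> K" if "\<bar>\<xi>\<bar> \<le> 1" for \<xi> using that by (simp add: abs_le_iff)
  have K0: "0 \<le> K" using K[of 0] by simp
  have "\<bar>\<xi>\<bar> \<le> 2 ^ k \<Longrightarrow> rate \<xi> \<le> K * max 1 (4 * \<xi>\<^sup>2)" for k \<xi>
  proof (induction k arbitrary: \<xi>)
    case 0
    then have "rate \<xi> \<le> K * 1" using K[of \<xi>] by simp
    also have "\<dots> \<le> K * max 1 (4 * \<xi>\<^sup>2)" using K0 by (intro mult_left_mono) auto
    finally show ?case .
  next
    case (Suc k)
    show ?case
    proof (cases "\<bar>\<xi>\<bar> \<le> 1")
      case True
      then have "rate \<xi> \<le> K * 1" using K[of \<xi>] by simp
      also have "\<dots> \<le> K * max 1 (4 * \<xi>\<^sup>2)" using K0 by (intro mult_left_mono) auto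
      finally show ?thesis .
    next
      case False
      then have "1 \<le> \<bar>\<xi>\<bar>\<^sup>2" by (intro one_le_power) simp
      then have sq: "1 \<le> \<xi>\<^sup>2" by simp
      have "rate \<xi> \<le> 4 * rate (\<xi> / 2)" using rate_add_le[of "\<xi> / 2" "\<xi> / 2"] by simp
      also have "\<dots> \<le> 4 * (K * max 1 (4 * (\<xi> / 2)\<^sup>2))"
        by (intro mult_left_mono Suc.IH) (use Suc.prems in auto)
      also have "max 1 (4 * (\<xi> / 2)\<^sup>2) = \<xi>\<^sup>2" using sq by (simp add: power_divide)
      also have "4 * (K * \<xi>\<^sup>2) = K * (4 * \<xi>\<^sup>2)" by simp
      also have "\<dots> \<le> K * max 1 (4 * \<xi>\<^sup>2)" using K0 by (intro mult_left_mono) auto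
      finally show ?thesis .
    qed
  qed
  moreover have "\<exists>k. \<bar>\<xi>\<bar> \<le> 2 ^ k" for \<xi> :: real
    using real_arch_pow[of 2 "\<bar>\<xi>\<bar>"] by (auto intro: less_imp_le)
  ultimately have "rate \<xi> \<le> K * max 1 (4 * \<xi>\<^sup>2)" for \<xi> by blast
  moreover have "K * max 1 (4 * \<xi>\<^sup>2) \<le> (4 * K) * (1 + \<xi>\<^sup>2)" for \<xi>
    using mult_left_mono[OF _ K0, of "max 1 (4 * \<xi>\<^sup>2)" "4 * (1 + \<xi>\<^sup>2)"] by (simp add: algebra_simps)
  ultimately have "rate \<xi> \<le> (4 * K) * (1 + \<xi>\<^sup>2)" for \<xi> by (rule order_trans)
  then show ?thesis using K0 by (intro exI[of _ "4 * K"]) auto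
qed

text \<open>The weight of the overview: by \<open>cmod_chr_sq\<close> the integrand is the squared
  modulus of \<open>chr s\<close> at \<open>\<xi>\<close>.\<close>

definition weight :: "real \<Rightarrow> real \<Rightarrow> ennreal" where
  "weight t \<xi> = (\<integral>\<^sup>+s. indicator {0..t} s * ennreal (exp (- 2 * s * rate \<xi>)) \<partial>lborel)"

lemma weight_measurable [measurable]: "weight t \<in> borel_measurable borel"
  unfolding weight_def[abs_def] by measurable

lemma weight_mono: "t \<le> t' \<Longrightarrow> weight t \<xi> \<le> weight t' \<xi>"
  unfolding weight_def by (intro nn_integral_mono mult_right_mono) (auto simp: indicator_def)

lemma weight_le: "0 \<le> t \<Longrightarrow> weight t \<xi> \<le> ennreal t"
proof -
  assume t: "0 \<le> t"
  have "weight t \<xi> \<le> (\<integral>\<^sup>+s. indicator {0..t} s \<partial>lborel)"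
    unfolding weight_def
    by (intro nn_integral_mono) (auto simp: indicator_def rate_nonneg)
  also have "\<dots> = ennreal t" using t by simp
  finally show ?thesis .
qed

text \<open>The integrand decreases in time. This converts integrability of the weight at time
  \<open>t\<close> into integrability of the characteristic function at time
  \<open>2 * t\<close>.\<close>

lemma weight_ge: "0 \<le> t \<Longrightarrow> ennreal t * ennreal (exp (- 2 * t * rate \<xi>)) \<le> weight t \<xi>"
proof -
  assume t: "0 \<le> t"
  have "ennreal t * ennreal (exp (- 2 * t * rate \<xi>)) = (\<integral>\<^sup>+s. ennreal (exp (- 2 * t * rate \<xi>)) * indicator {0..t} s \<partial>lborel)"
    using t by (subst nn_integral_cmult_indicator) (auto simp: mult.commute)
  also have "\<dots> \<le> weight t \<xi>"
    unfolding weight_def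
    by (intro nn_integral_mono) (auto simp: indicator_def mult_right_mono rate_nonneg intro!: ennreal_leI)
  finally show ?thesis .
qed

text \<open>The factor 2 in \<open>rate_add_le\<close> sits in an exponent and cannot be pulled out
  as a constant. Slowing time down by a factor \<open>\<theta>\<close> absorbs it, and the change of
  variable costs 1 / \<open>\<theta>\<close>, which is linear in \<open>rate \<eta>\<close> and so
  polynomial in the shift.\<close>

lemma weight_shift:
  assumes t: "0 \<le> t"
  shows "weight t (\<zeta> + \<eta>) \<le> ennreal (2 * exp 1 * (1 + 2 * t * rate \<eta>)) * weight t \<zeta>"
proof -
  let ?a = "rate (\<zeta> + \<eta>)" and ?b = "rate \<zeta>" and ?c = "rate \<eta>"
  have b: "?b \<le> 2 * ?a + 2 * ?c"
    using rate_add_le[of "\<zeta> + \<eta>" "- \<eta>"] by (simp add: rate_uminus)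
  \<comment> \<open>The choice makes \<open>2 * \<theta> \<le> 1\<close>, which absorbs the factor
    2, and \<open>4 * \<theta> * t * rate \<eta> \<le> 1\<close>, so that the remaining term costs
    at most a factor \<open>exp 1\<close>.\<close>
  define \<theta> where "\<theta> = 1 / (2 * (1 + 2 * t * ?c))"
  have den: "0 < 1 + 2 * t * ?c" using t rate_nonneg[of \<eta>] by (simp add: add_pos_nonneg)
  have \<theta>: "0 < \<theta>" "2 * \<theta> \<le> 1" "4 * \<theta> * t * ?c \<le> 1"
    using den t rate_nonneg[of \<eta>] by (auto simp: \<theta>_def field_simps)
  have "ennreal (exp (-1)) * weight t (\<zeta> + \<eta>) = (\<integral>\<^sup>+r. ennreal (exp (-1)) * (indicator {0..t} r * ennreal (exp (- 2 * r * ?a))) \<partial>lborel)"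
    unfolding weight_def by (rule nn_integral_cmult[symmetric]) simp
  also have "\<dots> \<le> (\<integral>\<^sup>+r. indicator {0..\<theta> * t} (0 + \<theta> * r) * ennreal (exp (- 2 * (0 + \<theta> * r) * ?b)) \<partial>lborel)"
  proof (intro nn_integral_mono)
    fix r
    show "ennreal (exp (-1)) * (indicator {0..t} r * ennreal (exp (- 2 * r * ?a)))
       \<le> indicator {0..\<theta> * t} (0 + \<theta> * r) * ennreal (exp (- 2 * (0 + \<theta> * r) * ?b))"
    proof (cases "r \<in> {0..t}")
      case True
      then have r: "0 \<le> r" "r \<le> t" by auto
      have "2 * (\<theta> * r) * ?b \<le> 2 * (\<theta> * r) * (2 * ?a + 2 * ?c)"
        using b r \<theta> by (intro mult_left_mono) auto
      also have "\<dots> = (2 * \<theta>) * (2 * r * ?a) + (4 * \<theta> * ?c) * r" by (simp add: algebra_simps)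
      also have "\<dots> \<le> 1 * (2 * r * ?a) + (4 * \<theta> * ?c) * t"
        using r \<theta> rate_nonneg by (intro add_mono mult_right_mono mult_left_mono) auto
      also have "\<dots> \<le> 2 * r * ?a + 1" using \<theta>(3) by (simp add: mult_ac)
      finally have "-1 + - 2 * r * ?a \<le> - 2 * (\<theta> * r) * ?b" by simp
      then have "exp (-1) * exp (- 2 * r * ?a) \<le> exp (- 2 * (\<theta> * r) * ?b)"
        by (simp flip: exp_add)
      moreover have "\<theta> * r \<in> {0..\<theta> * t}" using r \<theta> by (auto intro: mult_left_mono)
      ultimately show ?thesis using True by (simp add: ennreal_leI flip: ennreal_mult)
    qed simp
  qed
  also have "\<dots> \<le> ennreal (1 / \<theta>) * weight t \<zeta>"
  proof -
    have "ennreal \<theta> * (\<integral>\<^sup>+r. indicator {0..\<theta> * t} (0 + \<theta> * r) * ennreal (exp (- 2 * (0 + \<theta> * r) * ?b)) \<partial>lborel)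
        = (\<integral>\<^sup>+s. indicator {0..\<theta> * t} s * ennreal (exp (- 2 * s * ?b)) \<partial>lborel)"
      using \<theta>(1) by (subst nn_integral_real_affine[where c=\<theta> and t=0]) auto
    also have "\<dots> \<le> weight t \<zeta>"
    proof -
      have "\<theta> * t \<le> t" using \<theta> t mult_right_mono[of \<theta> 1 t] by simp
      then show ?thesis using weight_mono[of "\<theta> * t" t \<zeta>] by (simp add: weight_def)
    qed
    finally have "ennreal (1 / \<theta>) * (ennreal \<theta> * (\<integral>\<^sup>+r. indicator {0..\<theta> * t} (0 + \<theta> * r) * ennreal (exp (- 2 * (0 + \<theta> * r) * ?b)) \<partial>lborel))
        \<le> ennreal (1 / \<theta>) * weight t \<zeta>" by (rule mult_left_mono) simp
    moreover have "ennreal (1 / \<theta>) * ennreal \<theta> = 1" using \<theta>(1) by (simp flip: ennreal_mult)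
    ultimately show ?thesis by (simp flip: mult.assoc)
  qed
  finally have "ennreal (exp 1) * (ennreal (exp (-1)) * weight t (\<zeta> + \<eta>)) \<le> ennreal (exp 1) * (ennreal (1 / \<theta>) * weight t \<zeta>)"
    by (rule mult_left_mono) simp
  moreover have "ennreal (exp 1) * ennreal (exp (-1)) = 1" by (simp add: exp_minus flip: ennreal_mult)
  moreover have "ennreal (exp 1) * ennreal (1 / \<theta>) = ennreal (2 * exp 1 * (1 + 2 * t * ?c))"
    using den by (simp add: \<theta>_def mult_ac flip: ennreal_mult)
  ultimately show ?thesis by (simp flip: mult.assoc)
qed

end

subsection \<open>The adjoint semigroup on the Fourier side\<close>

lemma abs_integral_le:
  fixes f g :: "'b \<Rightarrow> real"
  assumes "integrable M g" "\<And>x. \<bar>f x\<bar> \<le> g x"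
  shows "\<bar>\<integral>x. f x \<partial>M\<bar> \<le> (\<integral>x. g x \<partial>M)"
proof -
  have "\<bar>\<integral>x. f x \<partial>M\<bar> \<le> (\<integral>x. \<bar>f x\<bar> \<partial>M)" using integral_norm_bound[of M f] by simp
  also have "\<dots> \<le> (\<integral>x. g x \<partial>M)"
    using assms by (intro integral_mono') (auto intro: order_trans[OF abs_ge_zero])
  finally show ?thesis .
qed

context levy
begin

abbreviation P :: "real \<Rightarrow> (real \<Rightarrow> real) \<Rightarrow> real \<Rightarrow> real" where
  "P \<equiv> adjoint_semigroup N X"

lemma P_integrable:
  assumes "test_function f" "0 \<le> t"
  shows "integrable N (\<lambda>\<omega>. f (y - X t \<omega>))"
proof -
  note [measurable] = test_functionD(4)[OF assms(1)] X_measurable[OF assms(2)]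
  obtain C where C: "\<And>x. \<bar>f x\<bar> \<le> C" using test_functionD(2)[OF assms(1)] by (auto simp: bounded_iff)
  show ?thesis by (rule integrable_const_bound[where B=C]) (auto intro: C)
qed

lemma P_bound:
  assumes "0 \<le> t" and C: "\<And>x. \<bar>f x\<bar> \<le> C" and f: "test_function f"
  shows "\<bar>P t f y\<bar> \<le> C"
proof -
  have "\<bar>P t f y\<bar> \<le> (\<integral>\<omega>. C \<partial>N)"
    unfolding adjoint_semigroup_def
    by (rule abs_integral_le) (auto intro: C)
  then show ?thesis by (simp add: prob_space)
qed

text \<open>The error of the semigroup under a time step \<open>h\<close> for a function bounded by
  \<open>C\<close> with Lipschitz constant \<open>L\<close>. The minimum is taken because
  \<open>X h\<close> may have no first moment.\<close>

definition displacement :: "real \<Rightarrow> real \<Rightarrow> real \<Rightarrow> real" where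
  "displacement C L h = (\<integral>\<omega>. min (2 * C) (L * \<bar>X h \<omega>\<bar>) \<partial>N)"

lemma displacement_tendsto_0:
  assumes "\<And>n. 0 \<le> h n" "h \<longlonglongrightarrow> 0" "0 \<le> C" "0 \<le> L"
  shows "(\<lambda>n. displacement C L (h n)) \<longlonglongrightarrow> 0"
proof -
  have "(\<lambda>n. displacement C L (h n)) \<longlonglongrightarrow> (\<integral>\<omega>. 0 \<partial>N)"
    unfolding displacement_def
  proof (rule integral_dominated_convergence[where w="\<lambda>_. 2 * C"])
    show "AE \<omega> in N. (\<lambda>n. min (2 * C) (L * \<bar>X (h n) \<omega>\<bar>)) \<longlonglongrightarrow> 0"
      using X_tendsto_zero[OF assms(1,2)]
    proof eventually_elim
      case (elim \<omega>)
      have "(\<lambda>n. min (2 * C) (L * \<bar>X (h n) \<omega>\<bar>)) \<longlonglongrightarrow> min (2 * C) (L * \<bar>0\<bar>)"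
        by (intro tendsto_intros elim)
      then show ?case using assms by simp
    qed
  qed (use X_measurable[OF assms(1)] assms in auto)
  then show ?thesis by simp
qed

text \<open>Both values are expectations over the same path, whose increment has the law of
  \<open>X (s' - s)\<close>. The Lipschitz bound handles small increments, the sup bound large
  ones.\<close>

lemma P_increment_le:
  assumes f: "test_function f" and C: "\<And>x. \<bar>f x\<bar> \<le> C" and L: "L-lipschitz_on UNIV f" and s: "0 \<le> s" "s \<le> s'"
  shows "\<bar>P s f y - P s' f y'\<bar> \<le> L * \<bar>y - y'\<bar> + displacement C L (s' - s)"
proof -
  have s': "0 \<le> s'" "0 \<le> s' - s" using s by auto
  have L0: "0 \<le> L" using L by (rule lipschitz_on_nonneg)
  have C0: "0 \<le> C" using C abs_ge_zero order_trans by blast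
  note [measurable] = X_measurable[OF s(1)] X_measurable[OF s'(1)] X_measurable[OF s'(2)]
  let ?m = "\<lambda>z. min (2 * C) (L * \<bar>z\<bar>)"
  have intm: "integrable N (\<lambda>\<omega>. ?m (X s' \<omega> - X s \<omega>))"
    by (rule integrable_const_bound[where B="2 * C"]) (use C0 L0 in auto)
  have pw: "\<bar>f (y - a) - f (y' - b)\<bar> \<le> L * \<bar>y - y'\<bar> + ?m (b - a)" for a b
  proof -
    have "\<bar>f (y - a) - f (y' - a)\<bar> \<le> L * \<bar>y - y'\<bar>"
      using lipschitz_onD[OF L, of "y - a" "y' - a"] by (simp add: dist_real_def)
    moreover have "\<bar>f (y' - a) - f (y' - b)\<bar> \<le> L * \<bar>b - a\<bar>"
      using lipschitz_onD[OF L, of "y' - a" "y' - b"] by (simp add: dist_real_def abs_minus_commute)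
    moreover have "\<bar>f (y' - a) - f (y' - b)\<bar> \<le> 2 * C" using C[of "y' - a"] C[of "y' - b"] by linarith
    ultimately show ?thesis by linarith
  qed
  have "\<bar>P s f y - P s' f y'\<bar> = \<bar>\<integral>\<omega>. f (y - X s \<omega>) - f (y' - X s' \<omega>) \<partial>N\<bar>"
    unfolding adjoint_semigroup_def
    by (subst Bochner_Integration.integral_diff) (auto intro: P_integrable f s s')
  also have "\<dots> \<le> (\<integral>\<omega>. L * \<bar>y - y'\<bar> + ?m (X s' \<omega> - X s \<omega>) \<partial>N)"
    by (intro abs_integral_le pw Bochner_Integration.integrable_add intm integrable_const)
  also have "\<dots> = L * \<bar>y - y'\<bar> + (\<integral>\<omega>. ?m (X s' \<omega> - X s \<omega>) \<partial>N)"
    using intm by (subst Bochner_Integration.integral_add) (auto simp: prob_space)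
  also have "(\<integral>\<omega>. ?m (X s' \<omega> - X s \<omega>) \<partial>N) = (\<integral>z. ?m z \<partial>distr N borel (\<lambda>\<omega>. X (s + (s' - s)) \<omega> - X s \<omega>))"
    by (subst integral_distr) auto
  also have "\<dots> = displacement C L (s' - s)"
    unfolding increment_law[OF s(1) s'(2)] displacement_def by (subst integral_distr) auto
  finally show ?thesis .
qed

text \<open>Negative times are clamped to 0, since the process is specified only from time 0 on.
  Continuity on the whole plane is what makes \<open>mild\<close> Borel measurable.\<close>

lemma P_continuous:
  assumes f: "test_function f"
  shows "continuous_on UNIV (\<lambda>z. P (max 0 (fst z)) f (snd z))"
proof -
  obtain C where C: "\<And>x. \<bar>f x\<bar> \<le> C" using test_functionD(2)[OF f] by (auto simp: bounded_iff)
  have C0: "0 \<le> C" using C abs_ge_zero order_trans by blast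
  obtain L where L: "L-lipschitz_on UNIV f" using f by (auto simp: test_function_def)
  have L0: "0 \<le> L" using L by (rule lipschitz_on_nonneg)
  have le: "\<bar>P s f y - P s' f y'\<bar> \<le> L * \<bar>y - y'\<bar> + displacement C L \<bar>s - s'\<bar>" if "0 \<le> s" "0 \<le> s'" for s s' y y'
  proof (cases "s \<le> s'")
    case True
    then show ?thesis using P_increment_le[OF f C L, of s s' y y'] that by simp
  next
    case False
    then show ?thesis using P_increment_le[OF f C L, of s' s y' y] that by (simp add: abs_minus_commute)
  qed
  show ?thesis
    unfolding continuous_on_sequentially
  proof (intro ballI allI impI, elim conjE)
    fix z and u :: "nat \<Rightarrow> real \<times> real" assume u: "u \<longlonglongrightarrow> z"
    let ?d = "\<lambda>n. \<bar>max 0 (fst (u n)) - max 0 (fst z)\<bar>"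
    have "(\<lambda>n. \<bar>max 0 (fst (u n)) - max 0 (fst z)\<bar>) \<longlonglongrightarrow> \<bar>max 0 (fst z) - max 0 (fst z)\<bar>"
      by (intro tendsto_intros u)
    then have d: "?d \<longlonglongrightarrow> 0" by simp
    have "(\<lambda>n. L * \<bar>snd (u n) - snd z\<bar> + displacement C L (?d n)) \<longlonglongrightarrow> L * \<bar>snd z - snd z\<bar> + 0"
      by (intro tendsto_intros u displacement_tendsto_0 d C0 L0) simp
    then have lim: "(\<lambda>n. L * \<bar>snd (u n) - snd z\<bar> + displacement C L (?d n)) \<longlonglongrightarrow> 0" by simp
    have "(\<lambda>n. P (max 0 (fst (u n))) f (snd (u n)) - P (max 0 (fst z)) f (snd z)) \<longlonglongrightarrow> 0"
      by (rule Lim_null_comparison[OF _ lim]) (auto intro!: always_eventually le)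
    then show "((\<lambda>z. P (max 0 (fst z)) f (snd z)) \<circ> u) \<longlonglongrightarrow> P (max 0 (fst z)) f (snd z)"
      unfolding o_def by (rule LIM_zero_cancel)
  qed
qed

lemma P_continuous_space:
  assumes "test_function f" "0 \<le> t"
  shows "continuous_on UNIV (P t f)"
proof -
  have "continuous_on UNIV (\<lambda>y. (\<lambda>z. P (max 0 (fst z)) f (snd z)) (t, y))"
    by (rule continuous_on_compose2[OF P_continuous[OF assms(1)]]) (auto intro!: continuous_intros)
  then show ?thesis using assms by simp
qed

lemma P_space_integrable:
  assumes f: "test_function f" and t: "0 \<le> t"
  shows "integrable lborel (P t f)"
proof -
  note [measurable] = test_functionD(4)[OF f] X_measurable[OF t]
  interpret Q: pair_sigma_finite N lborel ..
  have "(\<integral>\<^sup>+y. ennreal (norm (f (y - a))) \<partial>lborel) = (\<integral>\<^sup>+y. ennreal (norm (f y)) \<partial>lborel)" for a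
    by (subst (2) nn_integral_real_affine[where c=1 and t="-a"]) auto
  then have "(\<integral>\<^sup>+y. (\<integral>\<^sup>+\<omega>. ennreal (norm (f (y - X t \<omega>))) \<partial>N) \<partial>lborel) = (\<integral>\<^sup>+y. ennreal (norm (f y)) \<partial>lborel)"
    by (subst Q.Fubini') (auto simp: emeasure_space_1)
  moreover have "(\<integral>\<^sup>+y. ennreal (norm (P t f y)) \<partial>lborel) \<le> (\<integral>\<^sup>+y. (\<integral>\<^sup>+\<omega>. ennreal (norm (f (y - X t \<omega>))) \<partial>N) \<partial>lborel)"
    unfolding adjoint_semigroup_def
    by (intro nn_integral_mono integral_norm_bound_ennreal P_integrable f t)
  ultimately have "(\<integral>\<^sup>+y. ennreal (norm (P t f y)) \<partial>lborel) < \<infinity>"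
    using test_functionD(1)[OF f] unfolding integrable_iff_bounded by (auto intro: le_less_trans)
  moreover have "P t f \<in> borel_measurable borel"
    by (intro borel_measurable_continuous_onI P_continuous_space f t)
  ultimately show ?thesis unfolding integrable_iff_bounded by simp
qed

lemma P_bounded: "test_function f \<Longrightarrow> 0 \<le> t \<Longrightarrow> bounded (range (P t f))"
proof -
  assume f: "test_function f" and t: "0 \<le> t"
  obtain C where C: "\<And>x. \<bar>f x\<bar> \<le> C" using test_functionD(2)[OF f] by (auto simp: bounded_iff)
  show ?thesis unfolding bounded_iff using P_bound[OF t C f] by auto
qed

text \<open>The semigroup is convolution with the law of \<open>X t\<close>: by Fubini's theorem and
  a translation along each path, the transform picks up the factor \<open>chr t\<close>.\<close>

lemma fourier_P:
  assumes f: "test_function f" and t: "0 \<le> t"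
  shows "fourier (P t f) \<xi> = chr t \<xi> * fourier f \<xi>"
proof -
  note [measurable] = test_functionD(4)[OF f] X_measurable[OF t]
  interpret Q: pair_sigma_finite N lborel ..
  have int: "integrable (N \<Otimes>\<^sub>M lborel) (\<lambda>(\<omega>, y). iexp (\<xi> * y) * complex_of_real (f (y - X t \<omega>)))"
  proof (rule Q.Fubini_integrable)
    have i: "integrable lborel (\<lambda>y. f (y - a))" for a
      using lborel_integrable_real_affine[OF test_functionD(1)[OF f], of 1 "-a"] by simp
    then show "AE \<omega> in N. integrable lborel (\<lambda>y. case (\<omega>, y) of (\<omega>, y) \<Rightarrow> iexp (\<xi> * y) * complex_of_real (f (y - X t \<omega>)))"
      unfolding prod.case by (intro AE_I2 fourier_integrable)
    have "(\<integral>y. \<bar>f (y - a)\<bar> \<partial>lborel) = (\<integral>y. \<bar>f y\<bar> \<partial>lborel)" for a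
      by (subst (2) lborel_integral_real_affine[where c=1 and t="-a"]) auto
    then show "integrable N (\<lambda>\<omega>. \<integral>y. norm (case (\<omega>, y) of (\<omega>, y) \<Rightarrow> iexp (\<xi> * y) * complex_of_real (f (y - X t \<omega>))) \<partial>lborel)"
      by (simp add: norm_mult)
  qed measurable
  have "fourier (P t f) \<xi> = (CLBINT y. (CLINT \<omega>|N. iexp (\<xi> * y) * complex_of_real (f (y - X t \<omega>))))"
    unfolding fourier_def adjoint_semigroup_def
    by (intro Bochner_Integration.integral_cong refl)
      (simp only: integral_mult_right_zero integral_complex_of_real)
  also have "\<dots> = (CLINT \<omega>|N. (CLBINT y. iexp (\<xi> * y) * complex_of_real (f (y - X t \<omega>))))"
    by (rule Q.Fubini_integral[OF int])
  also have "\<dots> = (CLINT \<omega>|N. iexp (\<xi> * X t \<omega>) * fourier f \<xi>)"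
  proof (intro Bochner_Integration.integral_cong refl)
    fix \<omega>
    have "(CLBINT y. iexp (\<xi> * y) * complex_of_real (f (y - X t \<omega>))) =
        (CLBINT y. iexp (\<xi> * (X t \<omega> + 1 * y)) * complex_of_real (f ((X t \<omega> + 1 * y) - X t \<omega>)))"
      by (subst lborel_integral_real_affine[where c=1 and t="X t \<omega>"]) simp_all
    also have "\<dots> = (CLBINT y. iexp (\<xi> * X t \<omega>) * (iexp (\<xi> * y) * complex_of_real (f y)))"
      by (intro Bochner_Integration.integral_cong refl) (simp add: exp_add distrib_left)
    also have "\<dots> = iexp (\<xi> * X t \<omega>) * fourier f \<xi>" unfolding fourier_def by (rule integral_mult_right_zero)
    finally show "(CLBINT y. iexp (\<xi> * y) * complex_of_real (f (y - X t \<omega>))) = iexp (\<xi> * X t \<omega>) * fourier f \<xi>" .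
  qed
  also have "\<dots> = chr t \<xi> * fourier f \<xi>" unfolding chr_def by (rule integral_mult_left_zero)
  finally show ?thesis .
qed

text \<open>The integrand of the Wiener integral in \<open>weak_solution\<close>, as a function on
  space-time.\<close>

definition mild :: "real \<Rightarrow> (real \<Rightarrow> real) \<Rightarrow> real \<times> real \<Rightarrow> real" where
  "mild t f = (\<lambda>(s, y). indicator {0..t} s * P (t - s) f y)"

lemma mild_measurable:
  assumes f: "test_function f"
  shows "mild t f \<in> borel_measurable borel"
proof -
  have "continuous_on UNIV (\<lambda>z::real\<times>real. (\<lambda>z. P (max 0 (fst z)) f (snd z)) (t - fst z, snd z))"
    by (rule continuous_on_compose2[OF P_continuous[OF f]]) (auto intro!: continuous_intros)
  then have [measurable]: "(\<lambda>z. P (max 0 (t - fst z)) f (snd z)) \<in> borel_measurable borel"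
    by (intro borel_measurable_continuous_onI) simp
  have "(\<lambda>z::real\<times>real. indicator {0..t} (fst z) * P (max 0 (t - fst z)) f (snd z)) \<in> borel_measurable (borel \<Otimes>\<^sub>M borel)"
    by (intro borel_measurable_times) (measurable, simp add: borel_prod)
  also have "(\<lambda>z::real\<times>real. indicator {0..t} (fst z) * P (max 0 (t - fst z)) f (snd z)) = mild t f"
    by (auto simp: mild_def fun_eq_iff indicator_def)
  finally show ?thesis by (simp add: borel_prod)
qed

text \<open>Plancherel's theorem in space, for each time \<open>s\<close> separately. Up to time
  \<open>t\<close> both integrands are present and have the common factor
  \<open>chr (t - s)\<close>; between \<open>t\<close> and \<open>t'\<close> only the second one is.
  Integrating over \<open>s\<close> first yields the two weights.\<close>

lemma energy:
  assumes f: "test_function f" and g: "test_function g" and t: "0 \<le> t" "t \<le> t'"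
  shows "ennreal (2 * pi) * sq_norm lborel (\<lambda>z. mild t f z - mild t' g z) =
    (\<integral>\<^sup>+\<xi>. weight t \<xi> * ennreal ((cmod (fourier f \<xi> - chr (t' - t) \<xi> * fourier g \<xi>))\<^sup>2)
      + weight (t' - t) \<xi> * ennreal ((cmod (fourier g \<xi>))\<^sup>2) \<partial>lborel)"
proof -
  have t': "0 \<le> t' - t" "0 \<le> t'" using t by auto
  note [measurable] = test_functionD(4)[OF f] test_functionD(4)[OF g] chr_measurable[OF t'(1)]
    mild_measurable[OF f] mild_measurable[OF g]
  let ?A = "\<lambda>\<xi>. ennreal ((cmod (fourier f \<xi> - chr (t' - t) \<xi> * fourier g \<xi>))\<^sup>2)"
  let ?B = "\<lambda>\<xi>. ennreal ((cmod (fourier g \<xi>))\<^sup>2)"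
  let ?K = "\<lambda>s \<xi>. indicator {0..t} s * ennreal (exp (- 2 * (t - s) * rate \<xi>)) * ?A \<xi>
      + indicator {t<..t'} s * ennreal (exp (- 2 * (t' - s) * rate \<xi>)) * ?B \<xi>"
  have slice: "ennreal (2 * pi) * (\<integral>\<^sup>+y. ennreal ((mild t f (s, y) - mild t' g (s, y))\<^sup>2) \<partial>lborel) = (\<integral>\<^sup>+\<xi>. ?K s \<xi> \<partial>lborel)" for s
  proof -
    consider "s \<in> {0..t}" | "s \<in> {t<..t'}" | "s \<notin> {0..t}" "s \<notin> {t<..t'}" by blast
    then show ?thesis
    proof cases
      case 1
      then have s: "0 \<le> t - s" "0 \<le> t' - s" "s \<le> t'" using t by auto
      let ?u = "\<lambda>y. P (t - s) f y - P (t' - s) g y"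
      have "ennreal (2 * pi) * (\<integral>\<^sup>+y. ennreal ((mild t f (s, y) - mild t' g (s, y))\<^sup>2) \<partial>lborel) = ennreal (2 * pi) * sq_norm lborel ?u"
        using 1 s by (simp add: sq_norm_def mild_def)
      also have "\<dots> = (\<integral>\<^sup>+\<xi>. ennreal ((cmod (fourier ?u \<xi>))\<^sup>2) \<partial>lborel)"
      proof (rule plancherel[symmetric])
        show "integrable lborel ?u" using P_space_integrable f g s by simp
        show "continuous_on UNIV ?u" by (intro continuous_intros P_continuous_space f g s)
        obtain a b where "\<And>y. \<bar>P (t - s) f y\<bar> \<le> a" "\<And>y. \<bar>P (t' - s) g y\<bar> \<le> b"
          using P_bounded[OF f s(1)] P_bounded[OF g s(2)] by (auto simp: bounded_iff)
        then have "\<bar>?u y\<bar> \<le> a + b" for y          by (intro order_trans[OF abs_triangle_ineq4 add_mono])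
        then show "bounded (range ?u)" by (auto simp: bounded_iff)
      qed
      also have "\<dots> = (\<integral>\<^sup>+\<xi>. ?K s \<xi> \<partial>lborel)"
      proof (intro nn_integral_cong)
        fix \<xi>
        have "chr (t' - s) \<xi> = chr (t - s) \<xi> * chr (t' - t) \<xi>"
          using chr_add[of "t - s" "t' - t" \<xi>] s t' by simp
        then have "fourier ?u \<xi> = chr (t - s) \<xi> * (fourier f \<xi> - chr (t' - t) \<xi> * fourier g \<xi>)"
          using f g s by (simp add: fourier_diff P_space_integrable fourier_P algebra_simps)
        then have "(cmod (fourier ?u \<xi>))\<^sup>2 = exp (- 2 * (t - s) * rate \<xi>) * (cmod (fourier f \<xi> - chr (t' - t) \<xi> * fourier g \<xi>))\<^sup>2"
          using s by (simp only: norm_mult power_mult_distrib cmod_chr_sq)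
        then show "ennreal ((cmod (fourier ?u \<xi>))\<^sup>2) = ?K s \<xi>" using 1 by (simp add: ennreal_mult)
      qed
      finally show ?thesis .
    next
      case 2
      then have s: "0 \<le> t' - s" "s \<le> t'" "0 \<le> s" "\<not> s \<le> t" using t by auto
      have "ennreal (2 * pi) * (\<integral>\<^sup>+y. ennreal ((mild t f (s, y) - mild t' g (s, y))\<^sup>2) \<partial>lborel) = ennreal (2 * pi) * sq_norm lborel (P (t' - s) g)"
        using s by (simp add: sq_norm_def mild_def)
      also have "\<dots> = (\<integral>\<^sup>+\<xi>. ennreal ((cmod (fourier (P (t' - s) g) \<xi>))\<^sup>2) \<partial>lborel)"
        by (intro plancherel[symmetric] P_space_integrable P_continuous_space P_bounded g s)
      also have "\<dots> = (\<integral>\<^sup>+\<xi>. ?K s \<xi> \<partial>lborel)"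
      proof (intro nn_integral_cong)
        fix \<xi>
        have "(cmod (fourier (P (t' - s) g) \<xi>))\<^sup>2 = exp (- 2 * (t' - s) * rate \<xi>) * (cmod (fourier g \<xi>))\<^sup>2"
          using g s by (simp only: fourier_P norm_mult power_mult_distrib cmod_chr_sq)
        then show "ennreal ((cmod (fourier (P (t' - s) g) \<xi>))\<^sup>2) = ?K s \<xi>" using 2 by (simp add: ennreal_mult)
      qed
      finally show ?thesis .
    next
      case 3
      then have "mild t f (s, y) = 0" "mild t' g (s, y) = 0" for y
        using t by (auto simp: mild_def indicator_def)
      then show ?thesis using 3 by simp
    qed
  qed
  have W1: "(\<integral>\<^sup>+s. indicator {0..t} s * ennreal (exp (- 2 * (t - s) * rate \<xi>)) \<partial>lborel) = weight t \<xi>" for \<xi>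
    unfolding weight_def
    by (subst nn_integral_real_affine[where c="-1" and t=t]) (auto intro!: nn_integral_cong simp: indicator_def)
  \<comment> \<open>Time reversal maps the half-open interval to one that misses the endpoint
    \<open>t' - t\<close> of the interval in \<open>weight\<close>, a null set.\<close>
  have W2: "(\<integral>\<^sup>+s. indicator {t<..t'} s * ennreal (exp (- 2 * (t' - s) * rate \<xi>)) \<partial>lborel) = weight (t' - t) \<xi>" for \<xi>
  proof -
    have "(\<integral>\<^sup>+s. indicator {t<..t'} s * ennreal (exp (- 2 * (t' - s) * rate \<xi>)) \<partial>lborel)
      = (\<integral>\<^sup>+s. indicator {0..<t' - t} s * ennreal (exp (- 2 * s * rate \<xi>)) \<partial>lborel)"
      by (subst nn_integral_real_affine[where c="-1" and t=t']) (auto intro!: nn_integral_cong simp: indicator_def)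
    also have "\<dots> = weight (t' - t) \<xi>"
      unfolding weight_def
    proof (rule nn_integral_cong_AE)
      show "AE s in lborel. indicator {0..<t' - t} s * ennreal (exp (- 2 * s * rate \<xi>)) = indicator {0..t' - t} s * ennreal (exp (- 2 * s * rate \<xi>))"
        using AE_lborel_singleton[of "t' - t"] by eventually_elim (auto simp: indicator_def)
    qed
    finally show ?thesis .
  qed
  have "ennreal (2 * pi) * sq_norm lborel (\<lambda>z. mild t f z - mild t' g z)
      = ennreal (2 * pi) * (\<integral>\<^sup>+s. (\<integral>\<^sup>+y. ennreal ((mild t f (s, y) - mild t' g (s, y))\<^sup>2) \<partial>lborel) \<partial>lborel)"
    unfolding sq_norm_def lborel_prod[symmetric]
    by (subst lborel.nn_integral_fst[symmetric]) (simp_all add: lborel_prod)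
  also have "\<dots> = (\<integral>\<^sup>+s. ennreal (2 * pi) * (\<integral>\<^sup>+y. ennreal ((mild t f (s, y) - mild t' g (s, y))\<^sup>2) \<partial>lborel) \<partial>lborel)"
  proof (rule nn_integral_cmult[symmetric])
    have "(\<lambda>z. ennreal ((mild t f z - mild t' g z)\<^sup>2)) \<in> borel_measurable (lborel \<Otimes>\<^sub>M lborel)"
      by (simp add: lborel_prod)
    then show "(\<lambda>s. \<integral>\<^sup>+y. ennreal ((mild t f (s, y) - mild t' g (s, y))\<^sup>2) \<partial>lborel) \<in> borel_measurable lborel"
      by (rule lborel.borel_measurable_nn_integral_fst)
  qed
  also have "\<dots> = (\<integral>\<^sup>+s. (\<integral>\<^sup>+\<xi>. ?K s \<xi> \<partial>lborel) \<partial>lborel)" by (simp only: slice)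
  also have "\<dots> = (\<integral>\<^sup>+\<xi>. (\<integral>\<^sup>+s. ?K s \<xi> \<partial>lborel) \<partial>lborel)"
    by (rule lborel_pair.Fubini') measurable
  also have "\<dots> = (\<integral>\<^sup>+\<xi>. weight t \<xi> * ?A \<xi> + weight (t' - t) \<xi> * ?B \<xi> \<partial>lborel)"
    by (intro nn_integral_cong) (simp add: nn_integral_add nn_integral_multc W1[simplified] W2[simplified] del: mult_minus_left)
  finally show ?thesis .
qed

lemma energy_single:
  assumes f: "test_function f" and t: "0 \<le> t"
  shows "ennreal (2 * pi) * sq_norm lborel (mild t f) = (\<integral>\<^sup>+\<xi>. weight t \<xi> * ennreal ((cmod (fourier f \<xi>))\<^sup>2) \<partial>lborel)"
proof -
  have 0: "test_function (\<lambda>_. 0)" by (auto simp: test_function_def intro!: exI[of _ 0] lipschitz_onI)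
  have "mild t (\<lambda>_. 0) z = 0" for z by (cases z) (simp add: mild_def adjoint_semigroup_def)
  moreover have "fourier (\<lambda>_. 0) \<xi> = 0" for \<xi> by (simp add: fourier_def)
  ultimately show ?thesis using energy[OF f 0 t order_refl] by simp
qed

lemma sq_norm_test_function: "test_function f \<Longrightarrow> sq_norm lborel f < \<infinity>"
proof -
  assume f: "test_function f"
  obtain C where C: "\<And>x. \<bar>f x\<bar> \<le> C" using test_functionD(2)[OF f] by (auto simp: bounded_iff)
  have "sq_norm lborel f \<le> (\<integral>\<^sup>+x. ennreal C * ennreal (norm (f x)) \<partial>lborel)"
    unfolding sq_norm_def
  proof (intro nn_integral_mono)
    fix x
    have "(f x)\<^sup>2 \<le> C * \<bar>f x\<bar>"
      using mult_right_mono[OF C[of x], of "\<bar>f x\<bar>"] by (simp add: power2_eq_square flip: abs_mult)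
    then show "ennreal ((f x)\<^sup>2) \<le> ennreal C * ennreal (norm (f x))"
      by (simp add: ennreal_leI flip: ennreal_mult'')
  qed
  also have "\<dots> = ennreal C * (\<integral>\<^sup>+x. ennreal (norm (f x)) \<partial>lborel)"
    using test_functionD(4)[OF f] by (intro nn_integral_cmult) simp
  also have "\<dots> < \<infinity>"
    using test_functionD(1)[OF f] by (simp add: integrable_iff_bounded ennreal_mult_less_top)
  finally show ?thesis .
qed

lemma weight_energy_finite:
  assumes f: "test_function f" and t: "0 \<le> t"
  shows "(\<integral>\<^sup>+\<xi>. weight t \<xi> * ennreal ((cmod (fourier f \<xi>))\<^sup>2) \<partial>lborel) < \<infinity>"
proof -
  note [measurable] = test_functionD(4)[OF f]
  have "(\<integral>\<^sup>+\<xi>. weight t \<xi> * ennreal ((cmod (fourier f \<xi>))\<^sup>2) \<partial>lborel) \<le> (\<integral>\<^sup>+\<xi>. ennreal t * ennreal ((cmod (fourier f \<xi>))\<^sup>2) \<partial>lborel)"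
    using t by (intro nn_integral_mono mult_right_mono weight_le) auto
  also have "\<dots> = ennreal t * (ennreal (2 * pi) * sq_norm lborel f)"
    using plancherel[OF test_functionD(1,3,2)[OF f]] by (simp add: nn_integral_cmult)
  also have "\<dots> < \<infinity>" using sq_norm_test_function[OF f] by (simp add: ennreal_mult_less_top)
  finally show ?thesis .
qed

lemma sq_norm_mild_finite:
  assumes f: "test_function f" and t: "0 \<le> t"
  shows "sq_norm lborel (mild t f) < \<infinity>"
proof -
  have "ennreal (2 * pi) * sq_norm lborel (mild t f) < \<infinity>"
    using weight_energy_finite[OF f t] by (simp only: energy_single[OF f t])
  then show ?thesis by (auto simp: ennreal_mult_less_top)
qed

end

subsection \<open>Point masses and the weighted energy\<close>

context levy
begin

text \<open>Defined for arbitrary functions of the frequency, since the limit of interest, an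
  exponential, is not the transform of an integrable function.\<close>

abbreviation energy_norm :: "real \<Rightarrow> (real \<Rightarrow> complex) \<Rightarrow> ennreal" where
  "energy_norm t F \<equiv> (\<integral>\<^sup>+\<xi>. weight t \<xi> * ennreal ((cmod (F \<xi>))\<^sup>2) \<partial>lborel)"

lemma energy_norm_add_le:
  assumes [measurable]: "F \<in> borel_measurable borel" "G \<in> borel_measurable borel"
  shows "energy_norm t (\<lambda>\<xi>. F \<xi> + G \<xi>) \<le> 2 * energy_norm t F + 2 * energy_norm t G"
proof -
  have "weight t \<xi> * ennreal ((cmod (F \<xi> + G \<xi>))\<^sup>2)
      \<le> 2 * (weight t \<xi> * ennreal ((cmod (F \<xi>))\<^sup>2)) + 2 * (weight t \<xi> * ennreal ((cmod (G \<xi>))\<^sup>2))" for \<xi>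
  proof -
    have "(cmod (F \<xi> + G \<xi>))\<^sup>2 \<le> (cmod (F \<xi>) + cmod (G \<xi>))\<^sup>2"
      by (intro power_mono norm_triangle_ineq) simp
    also have "\<dots> \<le> 2 * (cmod (F \<xi>))\<^sup>2 + 2 * (cmod (G \<xi>))\<^sup>2" by (rule sq_add_le)
    finally have "ennreal ((cmod (F \<xi> + G \<xi>))\<^sup>2) \<le> ennreal (2 * (cmod (F \<xi>))\<^sup>2 + 2 * (cmod (G \<xi>))\<^sup>2)" by (rule ennreal_leI)
    also have "\<dots> = 2 * ennreal ((cmod (F \<xi>))\<^sup>2) + 2 * ennreal ((cmod (G \<xi>))\<^sup>2)" by (simp add: ennreal_mult')
    finally have "weight t \<xi> * ennreal ((cmod (F \<xi> + G \<xi>))\<^sup>2)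
      \<le> weight t \<xi> * (2 * ennreal ((cmod (F \<xi>))\<^sup>2) + 2 * ennreal ((cmod (G \<xi>))\<^sup>2))" by (rule mult_left_mono) simp
    then show ?thesis by (simp add: distrib_left mult_ac)
  qed
  then have "energy_norm t (\<lambda>\<xi>. F \<xi> + G \<xi>)
      \<le> (\<integral>\<^sup>+\<xi>. 2 * (weight t \<xi> * ennreal ((cmod (F \<xi>))\<^sup>2)) + 2 * (weight t \<xi> * ennreal ((cmod (G \<xi>))\<^sup>2)) \<partial>lborel)"
    by (intro nn_integral_mono)
  also have "\<dots> = 2 * energy_norm t F + 2 * energy_norm t G"
    by (subst nn_integral_add) (simp_all add: nn_integral_cmult)
  finally show ?thesis .
qed

lemma energy_norm_mono_time: "t \<le> t' \<Longrightarrow> energy_norm t F \<le> energy_norm t' F"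
  by (intro nn_integral_mono mult_right_mono weight_mono) auto

text \<open>Jensen's inequality moves the average over shifts outside the energy, where each shift
  is transferred to the weight by \<open>weight_shift\<close>. The resulting factor is quadratic in
  \<open>z\<close>, so its normal expectation \<open>K\<close> is finite, and it does not depend on
  \<open>f\<close> or on \<open>s\<close> in [-1, 1].\<close>

lemma gaussian_smoothing_energy:
  assumes t: "0 \<le> t"
  shows "\<exists>K\<ge>0. \<forall>f s. test_function f \<longrightarrow> \<bar>s\<bar> \<le> 1 \<longrightarrow>
      energy_norm t (fourier (\<lambda>x. f x * exp (- (s * x)\<^sup>2 / 2))) \<le> ennreal K * energy_norm t (fourier f)"
proof -
  obtain B where B: "0 \<le> B" "\<And>\<xi>. rate \<xi> \<le> B * (1 + \<xi>\<^sup>2)" using rate_quadratic_bound by blast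
  let ?n = std_normal_density
  \<comment> \<open>The factor of \<open>weight_shift\<close> for the shift \<open>s * z\<close>,
    with \<open>rate\<close> replaced by its quadratic bound and \<open>\<bar>s\<bar>\<close> by
    1.\<close>
  define c where "c z = 2 * exp 1 * (1 + 2 * t * (B * (1 + z\<^sup>2)))" for z :: real
  have c0: "0 \<le> c z" for z using t B by (simp add: c_def)
  define K where "K = (\<integral>z. c z * ?n z \<partial>lborel)"
  have "integrable lborel (\<lambda>z. ?n z * z ^ 2)" using integrable_normal_moment[of 1 0 2] by simp
  then have "integrable lborel (\<lambda>z. 2 * exp 1 * (1 + 2 * t * B) * ?n z + 2 * exp 1 * (2 * t * B) * (?n z * z ^ 2))"
    by (intro Bochner_Integration.integrable_add integrable_mult_right integrable_normal_density) auto
  also have "(\<lambda>z. 2 * exp 1 * (1 + 2 * t * B) * ?n z + 2 * exp 1 * (2 * t * B) * (?n z * z ^ 2)) = (\<lambda>z. c z * ?n z)"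
    by (simp add: c_def fun_eq_iff algebra_simps)
  finally have K: "(\<integral>\<^sup>+z. ennreal (c z * ?n z) \<partial>lborel) = ennreal K"
    unfolding K_def by (intro nn_integral_eq_integral) (auto simp: c0)
  have "energy_norm t (fourier (\<lambda>x. f x * exp (- (s * x)\<^sup>2 / 2))) \<le> ennreal K * energy_norm t (fourier f)"
    if f: "test_function f" and s: "\<bar>s\<bar> \<le> 1" for f s
  proof -
    note [measurable] = test_functionD(4)[OF f]
    let ?F = "\<lambda>\<xi>. ennreal ((cmod (fourier f \<xi>))\<^sup>2)"
    have "energy_norm t (fourier (\<lambda>x. f x * exp (- (s * x)\<^sup>2 / 2)))
        \<le> (\<integral>\<^sup>+\<xi>. weight t \<xi> * (\<integral>\<^sup>+z. ?F (\<xi> + s * z) * ennreal (?n z) \<partial>lborel) \<partial>lborel)"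
      by (intro nn_integral_mono mult_left_mono fourier_mult_gaussian_energy test_functionD(1)[OF f]) auto
    also have "\<dots> = (\<integral>\<^sup>+\<xi>. (\<integral>\<^sup>+z. weight t \<xi> * (?F (\<xi> + s * z) * ennreal (?n z)) \<partial>lborel) \<partial>lborel)"
      by (intro nn_integral_cong nn_integral_cmult[symmetric]) measurable
    also have "\<dots> = (\<integral>\<^sup>+z. (\<integral>\<^sup>+\<xi>. weight t \<xi> * (?F (\<xi> + s * z) * ennreal (?n z)) \<partial>lborel) \<partial>lborel)"
      by (rule lborel_pair.Fubini') measurable
    also have "\<dots> \<le> (\<integral>\<^sup>+z. ennreal (c z * ?n z) * energy_norm t (fourier f) \<partial>lborel)"
    proof (intro nn_integral_mono)
      fix z
      have "(\<integral>\<^sup>+\<xi>. weight t \<xi> * (?F (\<xi> + s * z) * ennreal (?n z)) \<partial>lborel)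
        = (\<integral>\<^sup>+\<zeta>. weight t (- (s * z) + 1 * \<zeta>) * (?F ((- (s * z) + 1 * \<zeta>) + s * z) * ennreal (?n z)) \<partial>lborel)"
        by (subst nn_integral_real_affine[where c=1 and t="- (s * z)"]) simp_all
      also have "\<dots> \<le> (\<integral>\<^sup>+\<zeta>. ennreal (c z * ?n z) * (weight t \<zeta> * ?F \<zeta>) \<partial>lborel)"
      proof (intro nn_integral_mono)
        fix \<zeta>
        have "rate (- (s * z)) \<le> B * (1 + (s * z)\<^sup>2)" using B(2)[of "- (s * z)"] by simp
        also have "\<dots> \<le> B * (1 + z\<^sup>2)"
        proof -
          have "\<bar>s * z\<bar>\<^sup>2 \<le> \<bar>z\<bar>\<^sup>2"
            using s mult_right_mono[of "\<bar>s\<bar>" 1 "\<bar>z\<bar>"] by (intro power_mono) (auto simp: abs_mult)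
          then show ?thesis using B(1) by (intro mult_left_mono) auto
        qed
        finally have "2 * exp 1 * (1 + 2 * t * rate (- (s * z))) \<le> c z"
          unfolding c_def using t by (intro mult_left_mono add_left_mono) auto
        then have "weight t (\<zeta> + - (s * z)) \<le> ennreal (c z) * weight t \<zeta>"
          by (intro order_trans[OF weight_shift[OF t]] mult_right_mono ennreal_leI) auto
        then have "weight t (\<zeta> + - (s * z)) * (?F \<zeta> * ennreal (?n z)) \<le> (ennreal (c z) * weight t \<zeta>) * (?F \<zeta> * ennreal (?n z))"
          by (rule mult_right_mono) simp
        then show "weight t (- (s * z) + 1 * \<zeta>) * (?F ((- (s * z) + 1 * \<zeta>) + s * z) * ennreal (?n z))
            \<le> ennreal (c z * ?n z) * (weight t \<zeta> * ?F \<zeta>)"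
          using c0 by (simp add: ennreal_mult mult_ac)
      qed
      also have "\<dots> = ennreal (c z * ?n z) * energy_norm t (fourier f)"
        by (rule nn_integral_cmult) measurable
      finally show "(\<integral>\<^sup>+\<xi>. weight t \<xi> * (?F (\<xi> + s * z) * ennreal (?n z)) \<partial>lborel)
        \<le> ennreal (c z * ?n z) * energy_norm t (fourier f)" .
    qed
    also have "\<dots> = ennreal K * energy_norm t (fourier f)"
      unfolding K[symmetric] by (rule nn_integral_multc) (simp add: c_def)
    finally show ?thesis .
  qed
  moreover have "0 \<le> K" unfolding K_def by (intro integral_nonneg_AE AE_I2 mult_nonneg_nonneg) (auto simp: c0)
  ultimately show ?thesis by blast
qed

text \<open>Multiplication by a Gaussian turns distributional convergence into pointwise convergence of
  the Fourier transforms; two applications of Fatou's lemma then remove the Gaussian again.\<close>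

lemma closable_bound:
  assumes t: "0 \<le> t"
  shows "\<exists>K\<ge>0. \<forall>\<phi> x n n0 e. (\<forall>n. \<phi> n \<in> schwartz) \<longrightarrow> distributional_limit \<phi> (dirac x) \<longrightarrow>
      (\<forall>m\<ge>n0. energy_norm t (\<lambda>\<xi>. fourier (\<phi> m) \<xi> - fourier (\<phi> n) \<xi>) \<le> e) \<longrightarrow>
      energy_norm t (\<lambda>\<xi>. iexp (\<xi> * x) - fourier (\<phi> n) \<xi>) \<le> ennreal K * e"
proof -
  obtain K where K: "0 \<le> K" "\<forall>f s. test_function f \<longrightarrow> \<bar>s\<bar> \<le> 1 \<longrightarrow>
      energy_norm t (fourier (\<lambda>x. f x * exp (- (s * x)\<^sup>2 / 2))) \<le> ennreal K * energy_norm t (fourier f)"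
    using gaussian_smoothing_energy[OF t] by blast
  have "energy_norm t (\<lambda>\<xi>. iexp (\<xi> * x) - fourier (\<phi> n) \<xi>) \<le> ennreal K * e"
    if \<phi>_all: "\<forall>n. \<phi> n \<in> schwartz" and lim: "distributional_limit \<phi> (dirac x)"
      and le: "\<forall>m\<ge>n0. energy_norm t (\<lambda>\<xi>. fourier (\<phi> m) \<xi> - fourier (\<phi> n) \<xi>) \<le> e" for \<phi> x n n0 e
  proof -
    have \<phi>: "\<phi> n \<in> schwartz" for n using \<phi>_all by blast
    note tf = schwartz_test_function[OF \<phi>]
    note [measurable] = test_functionD(4)[OF tf]
    let ?g = "\<lambda>s y. exp (- (s * y)\<^sup>2 / 2) :: real"
    let ?\<phi> = "\<lambda>s m y. \<phi> m y * ?g s y"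
    have gi: "integrable lborel (?\<phi> s m)" for s m
    proof (rule Bochner_Integration.integrable_bound[OF test_functionD(1)[OF tf[of m]]])
      show "AE y in lborel. norm (?\<phi> s m y) \<le> norm (\<phi> m y)"
        by (auto simp: abs_mult intro!: mult_left_le)
    qed measurable
    have step1: "energy_norm t (\<lambda>\<xi>. iexp (\<xi> * x) * complex_of_real (?g s x) - fourier (?\<phi> s n) \<xi>) \<le> ennreal K * e"
      if s: "s \<noteq> 0" "\<bar>s\<bar> \<le> 1" for s
    proof -
      have "energy_norm t (\<lambda>\<xi>. iexp (\<xi> * x) * complex_of_real (?g s x) - fourier (?\<phi> s n) \<xi>)
          = (\<integral>\<^sup>+\<xi>. liminf (\<lambda>m. weight t \<xi> * ennreal ((cmod (fourier (?\<phi> s m) \<xi> - fourier (?\<phi> s n) \<xi>))\<^sup>2)) \<partial>lborel)"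
      proof (rule nn_integral_cong)
        fix \<xi>
        have "(\<lambda>m. weight t \<xi> * ennreal ((cmod (fourier (?\<phi> s m) \<xi> - fourier (?\<phi> s n) \<xi>))\<^sup>2))
          \<longlonglongrightarrow> weight t \<xi> * ennreal ((cmod (iexp (\<xi> * x) * complex_of_real (?g s x) - fourier (?\<phi> s n) \<xi>))\<^sup>2)"
          using t weight_le[OF t, of \<xi>]
          by (intro ennreal_tendsto_cmult tendsto_ennrealI tendsto_intros fourier_distributional_limit \<phi> lim s)
            (auto intro: le_less_trans)
        then show "weight t \<xi> * ennreal ((cmod (iexp (\<xi> * x) * complex_of_real (?g s x) - fourier (?\<phi> s n) \<xi>))\<^sup>2)
          = liminf (\<lambda>m. weight t \<xi> * ennreal ((cmod (fourier (?\<phi> s m) \<xi> - fourier (?\<phi> s n) \<xi>))\<^sup>2))"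
          by (intro lim_imp_Liminf[symmetric]) simp_all
      qed
      also have "\<dots> \<le> liminf (\<lambda>m. energy_norm t (\<lambda>\<xi>. fourier (?\<phi> s m) \<xi> - fourier (?\<phi> s n) \<xi>))"
        by (rule nn_integral_liminf) measurable
      also have "\<dots> \<le> ennreal K * e"
      proof (rule Liminf_le)
        show "\<forall>\<^sub>F m in sequentially. energy_norm t (\<lambda>\<xi>. fourier (?\<phi> s m) \<xi> - fourier (?\<phi> s n) \<xi>) \<le> ennreal K * e"
          using eventually_ge_at_top[of n0]
        proof eventually_elim
          case (elim m)
          have "energy_norm t (\<lambda>\<xi>. fourier (?\<phi> s m) \<xi> - fourier (?\<phi> s n) \<xi>)
             = energy_norm t (fourier (\<lambda>y. (\<phi> m y - \<phi> n y) * ?g s y))"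
            by (simp only: fourier_diff[OF gi gi, symmetric] left_diff_distrib)
          also have "\<dots> \<le> ennreal K * energy_norm t (fourier (\<lambda>y. \<phi> m y - \<phi> n y))"
            by (intro K(2)[rule_format] test_function_diff tf s)
          also have "energy_norm t (fourier (\<lambda>y. \<phi> m y - \<phi> n y)) = energy_norm t (\<lambda>\<xi>. fourier (\<phi> m) \<xi> - fourier (\<phi> n) \<xi>)"
            by (simp only: fourier_diff[OF test_functionD(1)[OF tf] test_functionD(1)[OF tf]])
          also have "ennreal K * \<dots> \<le> ennreal K * e" by (intro mult_left_mono le[rule_format] elim) simp
          finally show ?case .
        qed
      qed simp
      finally show ?thesis .
    qed
    define s where "s k = inverse (real (Suc k))" for k
    have s: "s k \<noteq> 0" "\<bar>s k\<bar> \<le> 1" for k by (auto simp: s_def field_simps)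
    have s_lim: "s \<longlonglongrightarrow> 0" unfolding s_def by (rule LIMSEQ_inverse_real_of_nat)
    have g_lim: "(\<lambda>k. ?g (s k) y) \<longlonglongrightarrow> 1" for y
    proof -
      have "(\<lambda>k. ?g (s k) y) \<longlonglongrightarrow> ?g 0 y" by (intro tendsto_intros s_lim) simp
      then show ?thesis by simp
    qed
    have f_lim: "(\<lambda>k. fourier (?\<phi> (s k) n) \<xi>) \<longlonglongrightarrow> fourier (\<phi> n) \<xi>" for \<xi>
      unfolding fourier_def
    proof (rule integral_dominated_convergence[where w="\<lambda>y. \<bar>\<phi> n y\<bar>"])
      show "AE y in lborel. (\<lambda>k. iexp (\<xi> * y) * complex_of_real (?\<phi> (s k) n y)) \<longlonglongrightarrow> iexp (\<xi> * y) * complex_of_real (\<phi> n y)"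
      proof (rule AE_I2)
        fix y
        have "(\<lambda>k. iexp (\<xi> * y) * complex_of_real (?\<phi> (s k) n y)) \<longlonglongrightarrow> iexp (\<xi> * y) * complex_of_real (\<phi> n y * 1)"
          by (intro tendsto_intros g_lim)
        then show "(\<lambda>k. iexp (\<xi> * y) * complex_of_real (?\<phi> (s k) n y)) \<longlonglongrightarrow> iexp (\<xi> * y) * complex_of_real (\<phi> n y)" by simp
      qed
      show "AE y in lborel. norm (iexp (\<xi> * y) * complex_of_real (?\<phi> (s k) n y)) \<le> \<bar>\<phi> n y\<bar>" for k
        by (auto simp: norm_mult abs_mult intro!: mult_left_le)
    qed (use test_functionD(1)[OF tf[of n]] in \<open>simp_all add: integrable_abs\<close>)
    have "energy_norm t (\<lambda>\<xi>. iexp (\<xi> * x) - fourier (\<phi> n) \<xi>)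
        = (\<integral>\<^sup>+\<xi>. liminf (\<lambda>k. weight t \<xi> * ennreal ((cmod (iexp (\<xi> * x) * complex_of_real (?g (s k) x) - fourier (?\<phi> (s k) n) \<xi>))\<^sup>2)) \<partial>lborel)"
    proof (rule nn_integral_cong)
      fix \<xi>
      have "(\<lambda>k. weight t \<xi> * ennreal ((cmod (iexp (\<xi> * x) * complex_of_real (?g (s k) x) - fourier (?\<phi> (s k) n) \<xi>))\<^sup>2))
        \<longlonglongrightarrow> weight t \<xi> * ennreal ((cmod (iexp (\<xi> * x) * complex_of_real 1 - fourier (\<phi> n) \<xi>))\<^sup>2)"
        using t weight_le[OF t, of \<xi>]
        by (intro ennreal_tendsto_cmult tendsto_ennrealI tendsto_intros g_lim f_lim)
          (auto intro: le_less_trans)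
      then show "weight t \<xi> * ennreal ((cmod (iexp (\<xi> * x) - fourier (\<phi> n) \<xi>))\<^sup>2)
        = liminf (\<lambda>k. weight t \<xi> * ennreal ((cmod (iexp (\<xi> * x) * complex_of_real (?g (s k) x) - fourier (?\<phi> (s k) n) \<xi>))\<^sup>2))"
        by (intro lim_imp_Liminf[symmetric]) simp_all
    qed
    also have "\<dots> \<le> liminf (\<lambda>k. energy_norm t (\<lambda>\<xi>. iexp (\<xi> * x) * complex_of_real (?g (s k) x) - fourier (?\<phi> (s k) n) \<xi>))"
      by (rule nn_integral_liminf) measurable
    also have "\<dots> \<le> ennreal K * e"
    proof (rule Liminf_le)
      show "\<forall>\<^sub>F k in sequentially. energy_norm t (\<lambda>\<xi>. iexp (\<xi> * x) * complex_of_real (?g (s k) x) - fourier (?\<phi> (s k) n) \<xi>) \<le> ennreal K * e"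
        by (rule always_eventually) (intro allI step1 s)
    qed simp
    finally show ?thesis .
  qed
  with K(1) show ?thesis by blast
qed

text \<open>An exponential has modulus 1, so its energy is the integral of the weight. Being close
  to a transform of finite energy, it has finite energy itself, and this is how the existence of a
  random field yields integrability of the weight.\<close>

lemma energy_cauchy_tendsto:
  assumes t: "0 \<le> t" and \<phi>: "\<And>n. \<phi> n \<in> schwartz" and lim: "distributional_limit \<phi> (dirac x)"
    and cauchy: "\<And>e. e > 0 \<Longrightarrow> \<exists>n0. \<forall>m\<ge>n0. \<forall>n\<ge>n0. energy_norm t (\<lambda>\<xi>. fourier (\<phi> m) \<xi> - fourier (\<phi> n) \<xi>) \<le> ennreal e"
  shows "(\<lambda>n. energy_norm t (\<lambda>\<xi>. iexp (\<xi> * x) - fourier (\<phi> n) \<xi>)) \<longlonglongrightarrow> 0"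
    and "(\<integral>\<^sup>+\<xi>. weight t \<xi> \<partial>lborel) < \<infinity>"
proof -
  note tf = schwartz_test_function[OF \<phi>]
  note [measurable] = test_functionD(4)[OF tf]
  obtain K where K: "0 \<le> K"
    "\<forall>\<phi> x n n0 e. (\<forall>n. \<phi> n \<in> schwartz) \<longrightarrow> distributional_limit \<phi> (dirac x) \<longrightarrow>
      (\<forall>m\<ge>n0. energy_norm t (\<lambda>\<xi>. fourier (\<phi> m) \<xi> - fourier (\<phi> n) \<xi>) \<le> e) \<longrightarrow>
      energy_norm t (\<lambda>\<xi>. iexp (\<xi> * x) - fourier (\<phi> n) \<xi>) \<le> ennreal K * e"
    using closable_bound[OF t] by blast
  have ev: "\<forall>\<^sub>F n in sequentially. energy_norm t (\<lambda>\<xi>. iexp (\<xi> * x) - fourier (\<phi> n) \<xi>) \<le> ennreal e" if e: "e > 0" for e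
  proof -
    \<comment> \<open>The divisor is \<open>K + 1\<close> because \<open>K\<close> may be 0.\<close>
    have "0 < e / (K + 1)" using e K(1) by simp
    then obtain n0 where n0: "\<And>m n. m \<ge> n0 \<Longrightarrow> n \<ge> n0 \<Longrightarrow>
        energy_norm t (\<lambda>\<xi>. fourier (\<phi> m) \<xi> - fourier (\<phi> n) \<xi>) \<le> ennreal (e / (K + 1))"
      using cauchy by meson
    have "energy_norm t (\<lambda>\<xi>. iexp (\<xi> * x) - fourier (\<phi> n) \<xi>) \<le> ennreal K * ennreal (e / (K + 1))" if "n \<ge> n0" for n
      using \<phi> lim n0[OF _ that] by (intro K(2)[rule_format]) auto
    moreover have "ennreal K * ennreal (e / (K + 1)) \<le> ennreal e"
      using e K(1) unfolding ennreal_mult''[symmetric, OF less_imp_le[OF \<open>0 < e / (K + 1)\<close>]]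
      by (intro ennreal_leI) (simp add: field_simps)
    ultimately show ?thesis unfolding eventually_sequentially by (meson order_trans)
  qed
  show "(\<lambda>n. energy_norm t (\<lambda>\<xi>. iexp (\<xi> * x) - fourier (\<phi> n) \<xi>)) \<longlonglongrightarrow> 0"
  proof (rule order_tendstoI)
    fix a :: ennreal assume "0 < a"
    then obtain b where b: "0 < b" "b < a" using dense by blast
    then obtain e where e: "b = ennreal e" "0 \<le> e" by (cases b) auto
    then have "e > 0" using b by (simp add: ennreal_less_zero_iff)
    from ev[OF this] show "\<forall>\<^sub>F n in sequentially. energy_norm t (\<lambda>\<xi>. iexp (\<xi> * x) - fourier (\<phi> n) \<xi>) < a"
      by eventually_elim (use b e in auto)
  qed simp
  obtain n where n: "energy_norm t (\<lambda>\<xi>. iexp (\<xi> * x) - fourier (\<phi> n) \<xi>) \<le> ennreal 1"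
    using ev[of 1] by (auto simp: eventually_sequentially)
  have "(\<integral>\<^sup>+\<xi>. weight t \<xi> \<partial>lborel) = energy_norm t (\<lambda>\<xi>. (iexp (\<xi> * x) - fourier (\<phi> n) \<xi>) + fourier (\<phi> n) \<xi>)"
    by simp
  also have "\<dots> \<le> 2 * energy_norm t (\<lambda>\<xi>. iexp (\<xi> * x) - fourier (\<phi> n) \<xi>) + 2 * energy_norm t (fourier (\<phi> n))"
    by (rule energy_norm_add_le) measurable
  also have "\<dots> < \<infinity>"
    using n weight_energy_finite[OF tf t, of n] by (auto simp: ennreal_mult_less_top intro: le_less_trans)
  finally show "(\<integral>\<^sup>+\<xi>. weight t \<xi> \<partial>lborel) < \<infinity>" .
qed

end

subsection \<open>Continuity in mean square of the linear solution\<close>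

locale heat = L: levy N X + W: noise M w
  for N :: "'o measure" and X :: "real \<Rightarrow> 'o \<Rightarrow> real"
    and M :: "'a measure" and w :: "(real \<times> real) set \<Rightarrow> 'a \<Rightarrow> real"
begin

text \<open>Existence of the integral justifies the choice made in \<open>wiener_integral\<close>,
  whose value can be used only through this property.\<close>

lemma weak_solution_has_wiener_integral:
  assumes f: "test_function f" and t: "0 \<le> t"
  shows "has_wiener_integral M w (L.mild t f) (weak_solution N X M w t f)"
proof -
  have "\<exists>Y. has_wiener_integral M w (L.mild t f) Y"
    by (rule W.has_wiener_integral_exists[OF L.mild_measurable[OF f] _ L.sq_norm_mild_finite[OF f t]])
      (simp add: L.mild_def)
  then have "has_wiener_integral M w (L.mild t f) (wiener_integral M w (L.mild t f))"
    unfolding wiener_integral_def by (rule someI_ex)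
  then show ?thesis by (simp add: weak_solution_def L.mild_def)
qed

lemma weak_solution_measurable:
  "test_function f \<Longrightarrow> 0 \<le> t \<Longrightarrow> weak_solution N X M w t f \<in> borel_measurable M"
  using weak_solution_has_wiener_integral[of f t] by (auto simp: has_wiener_integral_def L2_limit_iff)

lemma energy_one_le: "x \<le> ennreal (2 * pi) * x"
proof -
  have "ennreal 1 \<le> ennreal (2 * pi)" using pi_ge_two by (intro ennreal_leI) simp
  then have "ennreal 1 * x \<le> ennreal (2 * pi) * x" by (rule mult_right_mono) simp
  then show ?thesis by simp
qed

lemma weak_solution_norm_le:
  assumes f: "test_function f" and t: "0 \<le> t"
  shows "sq_norm M (weak_solution N X M w t f) \<le> 8 * L.energy_norm t (fourier f)"
proof -
  have "sq_norm M (weak_solution N X M w t f) \<le> 8 * sq_norm lborel (L.mild t f)"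
    by (rule W.wiener_integral_norm[OF weak_solution_has_wiener_integral[OF f t]])
  also have "\<dots> \<le> 8 * (ennreal (2 * pi) * sq_norm lborel (L.mild t f))"
    by (intro mult_left_mono energy_one_le) simp
  also have "\<dots> = 8 * L.energy_norm t (fourier f)" by (simp only: L.energy_single[OF f t])
  finally show ?thesis .
qed

lemma heat_cauchy_energy:
  assumes t: "0 \<le> t" and \<phi>: "\<And>n. \<phi> n \<in> schwartz" and cauchy: "heat_cauchy N X M w t \<phi>" and e: "e > 0"
  shows "\<exists>n0. \<forall>m\<ge>n0. \<forall>n\<ge>n0. L.energy_norm t (\<lambda>\<xi>. fourier (\<phi> m) \<xi> - fourier (\<phi> n) \<xi>) \<le> ennreal e"
proof -
  note tf = schwartz_test_function[OF \<phi>]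
  \<comment> \<open>Solves 2 pi * 8 * d^2 = e: the factor 2 pi stems from Plancherel's theorem, the
    8 from \<open>W.wiener_integral_norm\<close>.\<close>
  define d where "d = sqrt (e / (2 * pi * 8))"
  have d: "d > 0" using e by (simp add: d_def)
  have d2: "2 * pi * (8 * d\<^sup>2) = e" using e by (simp add: d_def)
  obtain n0 where n0: "\<And>m n. m \<ge> n0 \<Longrightarrow> n \<ge> n0 \<Longrightarrow> heat_norm N X M w t (\<lambda>x. \<phi> m x - \<phi> n x) < d"
    using cauchy d unfolding heat_cauchy_def by meson
  show ?thesis
  proof (intro exI[of _ n0] allI impI)
    fix m n assume mn: "m \<ge> n0" "n \<ge> n0"
    let ?f = "\<lambda>x. \<phi> m x - \<phi> n x"
    have f: "test_function ?f" by (intro test_function_diff tf)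
    let ?Y = "weak_solution N X M w t ?f"
    have [measurable]: "?Y \<in> borel_measurable M" by (rule weak_solution_measurable[OF f t])
    note Y = W.wiener_integral_norm[OF weak_solution_has_wiener_integral[OF f t]]
    have "sq_norm M ?Y < \<infinity>"
      using Y(1) L.sq_norm_mild_finite[OF f t] by (auto simp: ennreal_mult_less_top intro: le_less_trans)
    \<comment> \<open>\<open>heat_norm\<close> is built on a Bochner integral, which would be 0 for
      a nonintegrable square. It can be read as a norm only once integrability is known.\<close>
    then have int: "integrable M (\<lambda>\<omega>. (?Y \<omega>)\<^sup>2)"
      unfolding sq_norm_def integrable_iff_bounded by simp
    then have eq: "sq_norm M ?Y = ennreal (\<integral>\<omega>. (?Y \<omega>)\<^sup>2 \<partial>M)"
      unfolding sq_norm_def by (intro nn_integral_eq_integral) auto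
    have "sqrt (\<integral>\<omega>. (?Y \<omega>)\<^sup>2 \<partial>M) < d" using n0[OF mn] by (simp add: heat_norm_def)
    then have "(\<integral>\<omega>. (?Y \<omega>)\<^sup>2 \<partial>M) \<le> d\<^sup>2"
      using d by (metis less_eq_real_def real_sqrt_less_iff real_sqrt_abs abs_of_pos)
    then have le: "sq_norm M ?Y \<le> ennreal (d\<^sup>2)" unfolding eq by (rule ennreal_leI)
    have "L.energy_norm t (\<lambda>\<xi>. fourier (\<phi> m) \<xi> - fourier (\<phi> n) \<xi>) = L.energy_norm t (fourier ?f)"
      by (simp only: fourier_diff[OF test_functionD(1)[OF tf] test_functionD(1)[OF tf]])
    also have "\<dots> = ennreal (2 * pi) * sq_norm lborel (L.mild t ?f)" by (simp only: L.energy_single[OF f t])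
    also have "\<dots> \<le> ennreal (2 * pi) * (8 * ennreal (d\<^sup>2))"
      by (intro mult_left_mono order_trans[OF Y(2)] le) auto
    also have "\<dots> = ennreal (2 * pi * (8 * d\<^sup>2))" by (simp add: ennreal_mult' mult_ac)
    finally show "L.energy_norm t (\<lambda>\<xi>. fourier (\<phi> m) \<xi> - fourier (\<phi> n) \<xi>) \<le> ennreal e" unfolding d2 .
  qed
qed

text \<open>The energy of a point mass, the same at every position; up to constants it bounds the
  variance of the solution at time \<open>t\<close>.\<close>

definition total_weight :: "real \<Rightarrow> ennreal" where
  "total_weight t = (\<integral>\<^sup>+\<xi>. L.weight t \<xi> \<partial>lborel)"

lemma total_weight_mono: "t \<le> t' \<Longrightarrow> total_weight t \<le> total_weight t'"
  unfolding total_weight_def by (intro nn_integral_mono L.weight_mono)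

text \<open>Trades the distributional limit for convergence in energy, the form in which the
  approximation enters the bounds on moments and increments.\<close>

lemma extension_sequence:
  assumes t: "0 \<le> t" and ext: "weak_solution_extension N X M w t (dirac x) Y"
  obtains \<phi> where "\<And>n. test_function (\<phi> n)"
    "(\<lambda>n. L.energy_norm t (\<lambda>\<xi>. iexp (\<xi> * x) - fourier (\<phi> n) \<xi>)) \<longlonglongrightarrow> 0"
    "L2_limit M (\<lambda>n. weak_solution N X M w t (\<phi> n)) Y"
proof -
  obtain \<phi> where \<phi>: "\<And>n. \<phi> n \<in> schwartz" "heat_cauchy N X M w t \<phi>" "distributional_limit \<phi> (dirac x)"
      "L2_limit M (\<lambda>n. weak_solution N X M w t (\<phi> n)) Y"
    using ext unfolding weak_solution_extension_def by blast
  show thesis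
  proof (rule that)
    show "test_function (\<phi> n)" for n by (rule schwartz_test_function[OF \<phi>(1)])
    show "(\<lambda>n. L.energy_norm t (\<lambda>\<xi>. iexp (\<xi> * x) - fourier (\<phi> n) \<xi>)) \<longlonglongrightarrow> 0"
      by (rule L.energy_cauchy_tendsto(1)[OF t \<phi>(1) \<phi>(3) heat_cauchy_energy[OF t \<phi>(1) \<phi>(2)]])
  qed fact
qed

lemma total_weight_finite:
  assumes t: "0 \<le> t" and ext: "weak_solution_extension N X M w t (dirac x) Y"
  shows "total_weight t < \<infinity>"
proof -
  obtain \<phi> where \<phi>: "\<And>n. \<phi> n \<in> schwartz" "heat_cauchy N X M w t \<phi>" "distributional_limit \<phi> (dirac x)"
    using ext unfolding weak_solution_extension_def by blast
  show ?thesis unfolding total_weight_def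
    by (rule L.energy_cauchy_tendsto(2)[OF t \<phi>(1) \<phi>(3) heat_cauchy_energy[OF t \<phi>(1) \<phi>(2)]])
qed

lemma iexp_measurable [measurable]: "(\<lambda>\<xi>. iexp (\<xi> * x)) \<in> borel_measurable borel"
  by (intro borel_measurable_continuous_onI continuous_intros)

lemma fourier_energy_le:
  assumes "test_function f"
  shows "L.energy_norm t (fourier f) \<le> 2 * L.energy_norm t (\<lambda>\<xi>. iexp (\<xi> * x) - fourier f \<xi>) + 2 * total_weight t"
proof -
  note [measurable] = test_functionD(4)[OF assms]
  have "L.energy_norm t (\<lambda>\<xi>. (fourier f \<xi> - iexp (\<xi> * x)) + iexp (\<xi> * x))
    \<le> 2 * L.energy_norm t (\<lambda>\<xi>. fourier f \<xi> - iexp (\<xi> * x)) + 2 * L.energy_norm t (\<lambda>\<xi>. iexp (\<xi> * x))"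
    by (rule L.energy_norm_add_le) measurable
  then show ?thesis by (simp add: norm_minus_commute total_weight_def)
qed

text \<open>The approximation errors vanish in the limit. The constant 32 is 2 * 8 * 2: a triangle
  inequality, the comparison of an integral with its integrand, and the split in
  \<open>fourier_energy_le\<close>.\<close>

lemma extension_norm_le:
  assumes t: "0 \<le> t" and ext: "weak_solution_extension N X M w t (dirac x) Y"
  shows "sq_norm M Y \<le> 32 * total_weight t"
proof -
  obtain \<phi> where tf: "\<And>n. test_function (\<phi> n)"
    and e: "(\<lambda>n. L.energy_norm t (\<lambda>\<xi>. iexp (\<xi> * x) - fourier (\<phi> n) \<xi>)) \<longlonglongrightarrow> 0" (is "?e \<longlonglongrightarrow> 0")
    and l: "L2_limit M (\<lambda>n. weak_solution N X M w t (\<phi> n)) Y"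
    using extension_sequence[OF t ext] by blast
  note [measurable] = weak_solution_measurable[OF tf t]
  have [measurable]: "Y \<in> borel_measurable M" using l by (simp add: L2_limit_iff)
  let ?d = "\<lambda>n. sq_norm M (\<lambda>\<omega>. weak_solution N X M w t (\<phi> n) \<omega> - Y \<omega>)"
  have le: "sq_norm M Y \<le> 2 * ?d n + (32 * ?e n + 32 * total_weight t)" for n
  proof -
    have "sq_norm M Y \<le> 2 * ?d n + 2 * sq_norm M (weak_solution N X M w t (\<phi> n))"
      unfolding sq_norm_commute[of M "weak_solution N X M w t (\<phi> n)" Y] by (rule sq_norm_le_diff) measurable
    also have "\<dots> \<le> 2 * ?d n + 2 * (8 * (2 * ?e n + 2 * total_weight t))"
      by (intro add_left_mono mult_left_mono order_trans[OF weak_solution_norm_le[OF tf t]] fourier_energy_le tf) auto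
    finally show ?thesis by (simp add: distrib_left flip: mult.assoc)
  qed
  have "(\<lambda>n. 2 * ?d n + (32 * ?e n + 32 * total_weight t)) \<longlonglongrightarrow> 2 * 0 + (32 * 0 + 32 * total_weight t)"
    using l e unfolding L2_limit_iff by (intro tendsto_add ennreal_tendsto_cmult tendsto_const) auto
  then show ?thesis using le LIMSEQ_le_const[of "\<lambda>n. 2 * ?d n + (32 * ?e n + 32 * total_weight t)"] by simp
qed

text \<open>The bound is the same for all positions and increases with \<open>t\<close>, hence is
  uniform on bounded boxes. Late approximants have squared norm at most 2 * 1 plus twice the bound
  of \<open>extension_norm_le\<close>, and Gaussian moments do the rest.\<close>

lemma extension_moment_le:
  assumes t: "0 \<le> t" and ext: "weak_solution_extension N X M w t (dirac x) Y"
  shows "(\<integral>\<^sup>+\<omega>. ennreal (Y \<omega> ^ (2 * k)) \<partial>M) \<le> ennreal (gaussian_moment k) * (2 * (2 + 64 * total_weight t) + 2) ^ k"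
proof -
  obtain \<phi> where tf: "\<And>n. test_function (\<phi> n)"
    and "(\<lambda>n. L.energy_norm t (\<lambda>\<xi>. iexp (\<xi> * x) - fourier (\<phi> n) \<xi>)) \<longlonglongrightarrow> 0"
    and l: "L2_limit M (\<lambda>n. weak_solution N X M w t (\<phi> n)) Y"
    using extension_sequence[OF t ext] by blast
  note [measurable] = weak_solution_measurable[OF tf t]
  have [measurable]: "Y \<in> borel_measurable M" using l by (simp add: L2_limit_iff)
  let ?Y = "\<lambda>n. weak_solution N X M w t (\<phi> n)"
  have "total_weight t < \<infinity>" by (rule total_weight_finite[OF t ext])
  show ?thesis
  proof (rule L2_limit_moment[OF l])
    have "\<forall>\<^sub>F n in sequentially. sq_norm M (\<lambda>\<omega>. ?Y n \<omega> - Y \<omega>) < 1"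
      by (rule L2_limit_eventually_less[OF l]) simp
    then show "\<forall>\<^sub>F n in sequentially. (\<integral>\<^sup>+\<omega>. ennreal (?Y n \<omega> ^ (2 * k)) \<partial>M)
        \<le> ennreal (gaussian_moment k) * (2 * (2 + 64 * total_weight t) + 2) ^ k"
    proof eventually_elim
      case (elim n)
      have "sq_norm M (?Y n) \<le> 2 * sq_norm M (\<lambda>\<omega>. ?Y n \<omega> - Y \<omega>) + 2 * sq_norm M Y"
        by (rule sq_norm_le_diff) measurable
      also have "\<dots> \<le> 2 * 1 + 2 * (32 * total_weight t)"
        using elim by (intro add_mono mult_left_mono extension_norm_le[OF t ext]) auto
      finally have le: "sq_norm M (?Y n) \<le> 2 + 64 * total_weight t" by (simp flip: mult.assoc)
      also have "\<dots> < \<infinity>" using \<open>total_weight t < \<infinity>\<close> by (simp add: ennreal_mult_less_top)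
      finally have "(\<integral>\<^sup>+\<omega>. ennreal (?Y n \<omega> ^ (2 * k)) \<partial>M) \<le> ennreal (gaussian_moment k) * (2 * sq_norm M (?Y n) + 2) ^ k"
        by (rule W.wiener_integral_moment[OF weak_solution_has_wiener_integral[OF tf t]])
      also have "\<dots> \<le> ennreal (gaussian_moment k) * (2 * (2 + 64 * total_weight t) + 2) ^ k"
        by (intro mult_left_mono power_mono add_right_mono le) auto
      finally show ?case .
    qed
  qed measurable
qed

text \<open>The first term is the change of the kernel on the common past, the second the noise of
  the last \<open>h\<close> units of time, which only the later value sees. With a fixed horizon
  \<open>T\<close>, the expression depends on differences of the two points alone.\<close>

definition increment_energy :: "real \<Rightarrow> real \<Rightarrow> real \<Rightarrow> ennreal" where
  "increment_energy T h d = L.energy_norm T (\<lambda>\<xi>. 1 - L.chr h \<xi> * iexp (\<xi> * d)) + total_weight h"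

text \<open>Each point has its own approximating sequence. The identity \<open>L.energy\<close>
  relates the approximants, both transforms are exchanged for their limit exponentials, and the
  errors tend to 0. The constant 64 is 4 * 8 * 2.\<close>

lemma extension_increment_le:
  assumes t: "0 \<le> t" "t \<le> t'" "t' \<le> T"
    and ext: "weak_solution_extension N X M w t (dirac x) Y"
    and ext': "weak_solution_extension N X M w t' (dirac x') Y'"
  shows "sq_norm M (\<lambda>\<omega>. Y \<omega> - Y' \<omega>) \<le> 64 * increment_energy T (t' - t) (x' - x)"
proof -
  have t': "0 \<le> t'" "0 \<le> t' - t" "t' - t \<le> t'" using t by auto
  let ?h = "t' - t"
  obtain \<phi> where tf: "\<And>n. test_function (\<phi> n)"
    and e: "(\<lambda>n. L.energy_norm t (\<lambda>\<xi>. iexp (\<xi> * x) - fourier (\<phi> n) \<xi>)) \<longlonglongrightarrow> 0" (is "?e \<longlonglongrightarrow> 0")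
    and l: "L2_limit M (\<lambda>n. weak_solution N X M w t (\<phi> n)) Y"
    using extension_sequence[OF t(1) ext] by blast
  obtain \<psi> where tf': "\<And>n. test_function (\<psi> n)"
    and e': "(\<lambda>n. L.energy_norm t' (\<lambda>\<xi>. iexp (\<xi> * x') - fourier (\<psi> n) \<xi>)) \<longlonglongrightarrow> 0" (is "?e' \<longlonglongrightarrow> 0")
    and l': "L2_limit M (\<lambda>n. weak_solution N X M w t' (\<psi> n)) Y'"
    using extension_sequence[OF t'(1) ext'] by blast
  let ?Y = "\<lambda>n. weak_solution N X M w t (\<phi> n)" and ?Y' = "\<lambda>n. weak_solution N X M w t' (\<psi> n)"
  note [measurable] = weak_solution_measurable[OF tf t(1)] weak_solution_measurable[OF tf' t'(1)]
    test_functionD(4)[OF tf] test_functionD(4)[OF tf'] L.chr_measurable[OF t'(2)]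
  have [measurable]: "Y \<in> borel_measurable M" "Y' \<in> borel_measurable M" using l l' by (simp_all add: L2_limit_iff)
  let ?c = "L.energy_norm t (\<lambda>\<xi>. iexp (\<xi> * x) - L.chr ?h \<xi> * iexp (\<xi> * x'))"
  have mid: "sq_norm M (\<lambda>\<omega>. ?Y n \<omega> - ?Y' n \<omega>) \<le> 8 * (2 * ?c + (4 * ?e n + 4 * ?e' n) + (2 * ?e' n + 2 * total_weight ?h))" for n
  proof -
    have "sq_norm M (\<lambda>\<omega>. ?Y n \<omega> - ?Y' n \<omega>) \<le> 8 * sq_norm lborel (\<lambda>z. L.mild t (\<phi> n) z - L.mild t' (\<psi> n) z)"
      by (rule W.wiener_integral_comparison(1)) (intro weak_solution_has_wiener_integral tf tf' t t')+
    also have "\<dots> \<le> 8 * (ennreal (2 * pi) * sq_norm lborel (\<lambda>z. L.mild t (\<phi> n) z - L.mild t' (\<psi> n) z))"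
      by (intro mult_left_mono energy_one_le) simp
    also have "ennreal (2 * pi) * sq_norm lborel (\<lambda>z. L.mild t (\<phi> n) z - L.mild t' (\<psi> n) z)
       = L.energy_norm t (\<lambda>\<xi>. fourier (\<phi> n) \<xi> - L.chr ?h \<xi> * fourier (\<psi> n) \<xi>) + L.energy_norm ?h (fourier (\<psi> n))"
      unfolding L.energy[OF tf tf' t(1,2)] by (rule nn_integral_add) measurable
    also have "L.energy_norm t (\<lambda>\<xi>. fourier (\<phi> n) \<xi> - L.chr ?h \<xi> * fourier (\<psi> n) \<xi>) \<le> 2 * ?c + (4 * ?e n + 4 * ?e' n)"
    proof -
      let ?q1 = "\<lambda>\<xi>. fourier (\<phi> n) \<xi> - iexp (\<xi> * x)" and ?q2 = "\<lambda>\<xi>. L.chr ?h \<xi> * (iexp (\<xi> * x') - fourier (\<psi> n) \<xi>)"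
      have "L.energy_norm t (\<lambda>\<xi>. fourier (\<phi> n) \<xi> - L.chr ?h \<xi> * fourier (\<psi> n) \<xi>)
        = L.energy_norm t (\<lambda>\<xi>. (iexp (\<xi> * x) - L.chr ?h \<xi> * iexp (\<xi> * x')) + (?q1 \<xi> + ?q2 \<xi>))"
        by (intro nn_integral_cong arg_cong2[where f="(*)"] refl arg_cong[where f="\<lambda>z. ennreal ((cmod z)\<^sup>2)"])
          (simp only: right_diff_distrib, simp)
      also have "\<dots> \<le> 2 * ?c + 2 * L.energy_norm t (\<lambda>\<xi>. ?q1 \<xi> + ?q2 \<xi>)"
        by (rule L.energy_norm_add_le) measurable
      also have "\<dots> \<le> 2 * ?c + 2 * (2 * L.energy_norm t ?q1 + 2 * L.energy_norm t ?q2)"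
        by (intro add_left_mono mult_left_mono L.energy_norm_add_le) measurable
      also have "L.energy_norm t ?q1 = ?e n" by (simp add: norm_minus_commute)
      also have "L.energy_norm t ?q2 \<le> L.energy_norm t (\<lambda>\<xi>. iexp (\<xi> * x') - fourier (\<psi> n) \<xi>)"
      proof (intro nn_integral_mono mult_left_mono ennreal_leI power_mono)
        fix \<xi>
        show "cmod (?q2 \<xi>) \<le> cmod (iexp (\<xi> * x') - fourier (\<psi> n) \<xi>)"
          unfolding norm_mult using L.cmod_chr_le_1[OF t'(2), of \<xi>]
          by (rule mult_left_le_one_le[rotated 2]) auto
      qed auto
      also have "\<dots> \<le> ?e' n" by (rule L.energy_norm_mono_time[OF t(2)])
      finally show ?thesis by (simp add: distrib_left add_left_mono mult_left_mono flip: mult.assoc)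
    qed
    also have "L.energy_norm ?h (fourier (\<psi> n)) \<le> 2 * ?e' n + 2 * total_weight ?h"
      by (rule order_trans[OF fourier_energy_le[OF tf', where x=x']])
        (intro add_right_mono mult_left_mono L.energy_norm_mono_time[OF t'(3)], simp)
    finally show ?thesis by (simp add: add_mono mult_left_mono)
  qed
  let ?d = "\<lambda>n. sq_norm M (\<lambda>\<omega>. ?Y n \<omega> - Y \<omega>)" and ?d' = "\<lambda>n. sq_norm M (\<lambda>\<omega>. ?Y' n \<omega> - Y' \<omega>)"
  let ?R = "\<lambda>n. 2 * ?d n + (4 * (8 * (2 * ?c + (4 * ?e n + 4 * ?e' n) + (2 * ?e' n + 2 * total_weight ?h))) + 4 * ?d' n)"
  have le: "sq_norm M (\<lambda>\<omega>. Y \<omega> - Y' \<omega>) \<le> ?R n" for n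
  proof -
    have "sq_norm M (\<lambda>\<omega>. Y \<omega> - Y' \<omega>) \<le> 2 * sq_norm M (\<lambda>\<omega>. Y \<omega> - ?Y n \<omega>) + 2 * sq_norm M (\<lambda>\<omega>. ?Y n \<omega> - Y' \<omega>)"
      by (rule sq_norm_triangle) measurable
    also have "sq_norm M (\<lambda>\<omega>. Y \<omega> - ?Y n \<omega>) = ?d n" by (rule sq_norm_commute)
    also have "sq_norm M (\<lambda>\<omega>. ?Y n \<omega> - Y' \<omega>) \<le> 2 * sq_norm M (\<lambda>\<omega>. ?Y n \<omega> - ?Y' n \<omega>) + 2 * ?d' n"
      by (rule sq_norm_triangle) measurable
    also have "\<dots> \<le> 2 * (8 * (2 * ?c + (4 * ?e n + 4 * ?e' n) + (2 * ?e' n + 2 * total_weight ?h))) + 2 * ?d' n"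
      by (intro add_right_mono mult_left_mono mid) simp
    finally show ?thesis by (simp add: distrib_left add_left_mono mult_left_mono flip: mult.assoc)
  qed
  have "?R \<longlonglongrightarrow> 2 * 0 + (4 * (8 * (2 * ?c + (4 * 0 + 4 * 0) + (2 * 0 + 2 * total_weight ?h))) + 4 * 0)"
    using l l' e e' unfolding L2_limit_iff by (intro tendsto_add ennreal_tendsto_cmult tendsto_const) auto
  then have "sq_norm M (\<lambda>\<omega>. Y \<omega> - Y' \<omega>) \<le> 2 * 0 + (4 * (8 * (2 * ?c + (4 * 0 + 4 * 0) + (2 * 0 + 2 * total_weight ?h))) + 4 * 0)"
    by (rule LIMSEQ_le_const) (use le in auto)
  also have "\<dots> = 64 * (?c + total_weight ?h)" by (simp add: distrib_left flip: mult.assoc)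
  \<comment> \<open>Factoring out the exponential at \<open>x\<close>, which has modulus 1, leaves
    only the difference \<open>x' - x\<close>.\<close>
  also have "?c = L.energy_norm t (\<lambda>\<xi>. 1 - L.chr ?h \<xi> * iexp (\<xi> * (x' - x)))"
  proof (intro nn_integral_cong arg_cong2[where f="(*)"] refl arg_cong[where f="\<lambda>r. ennreal (r\<^sup>2)"])
    fix \<xi>
    have "iexp (\<xi> * x') = iexp (\<xi> * x) * iexp (\<xi> * (x' - x))" by (simp add: algebra_simps flip: exp_add)
    moreover have "a - c * (a * b) = a * (1 - c * b)" for a b c :: complex by (simp add: algebra_simps)
    ultimately have "iexp (\<xi> * x) - L.chr ?h \<xi> * iexp (\<xi> * x') = iexp (\<xi> * x) * (1 - L.chr ?h \<xi> * iexp (\<xi> * (x' - x)))"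
      by (simp only:)
    then show "cmod (iexp (\<xi> * x) - L.chr ?h \<xi> * iexp (\<xi> * x')) = cmod (1 - L.chr ?h \<xi> * iexp (\<xi> * (x' - x)))"
      by (simp only: norm_mult norm_exp_i_times mult_1_left)
  qed
  also have "64 * (\<dots> + total_weight ?h) \<le> 64 * increment_energy T ?h (x' - x)"
    unfolding increment_energy_def using t by (intro mult_left_mono add_right_mono L.energy_norm_mono_time) auto
  finally show ?thesis .
qed

text \<open>Dominated convergence with an integrable multiple of \<open>L.weight T\<close>, which is
  where finiteness of the total weight pays off.\<close>

lemma increment_energy_tendsto_0:
  assumes fin: "total_weight T < \<infinity>" and T: "0 < T"
    and h: "\<And>n. 0 \<le> h n" "h \<longlonglongrightarrow> 0" and d: "d \<longlonglongrightarrow> 0"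
  shows "(\<lambda>n. increment_energy T (h n) (d n)) \<longlonglongrightarrow> 0"
proof -
  note [measurable] = L.chr_measurable[OF h(1)]
  have wfin: "L.weight t \<xi> < top" if "0 \<le> t" for t \<xi> using L.weight_le[OF that, of \<xi>] by (auto intro: le_less_trans)
  have "(\<lambda>n. L.energy_norm T (\<lambda>\<xi>. 1 - L.chr (h n) \<xi> * iexp (\<xi> * d n))) \<longlonglongrightarrow> (\<integral>\<^sup>+\<xi>. (0::ennreal) \<partial>(lborel::real measure))"
  proof (rule nn_integral_dominated_convergence[where w="\<lambda>\<xi>. 4 * L.weight T \<xi>"])
    show "AE \<xi> in lborel. L.weight T \<xi> * ennreal ((cmod (1 - L.chr (h n) \<xi> * iexp (\<xi> * d n)))\<^sup>2) \<le> 4 * L.weight T \<xi>" for n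
    proof (rule AE_I2)
      fix \<xi>
      have "cmod (1 - L.chr (h n) \<xi> * iexp (\<xi> * d n)) \<le> 1 + cmod (L.chr (h n) \<xi>) * 1"
        using norm_triangle_ineq4[of 1 "L.chr (h n) \<xi> * iexp (\<xi> * d n)"] by (simp add: norm_mult)
      also have "\<dots> \<le> 2" using L.cmod_chr_le_1[OF h(1), of n \<xi>] by simp
      finally have "(cmod (1 - L.chr (h n) \<xi> * iexp (\<xi> * d n)))\<^sup>2 \<le> 2\<^sup>2" by (intro power_mono) auto
      then have "ennreal ((cmod (1 - L.chr (h n) \<xi> * iexp (\<xi> * d n)))\<^sup>2) \<le> 4" using ennreal_leI by fastforce
      then show "L.weight T \<xi> * ennreal ((cmod (1 - L.chr (h n) \<xi> * iexp (\<xi> * d n)))\<^sup>2) \<le> 4 * L.weight T \<xi>"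
        by (subst mult.commute) (rule mult_right_mono, simp_all)
    qed
    show "AE \<xi> in lborel. (\<lambda>n. L.weight T \<xi> * ennreal ((cmod (1 - L.chr (h n) \<xi> * iexp (\<xi> * d n)))\<^sup>2)) \<longlonglongrightarrow> 0"
    proof (rule AE_I2)
      fix \<xi>
      have "(\<lambda>n. L.weight T \<xi> * ennreal ((cmod (1 - L.chr (h n) \<xi> * iexp (\<xi> * d n)))\<^sup>2))
          \<longlonglongrightarrow> L.weight T \<xi> * ennreal ((cmod (1 - 1 * iexp (\<xi> * 0)))\<^sup>2)"
        by (intro ennreal_tendsto_cmult wfin less_imp_le[OF T] tendsto_ennrealI tendsto_intros L.chr_tendsto_1 h d)
      then show "(\<lambda>n. L.weight T \<xi> * ennreal ((cmod (1 - L.chr (h n) \<xi> * iexp (\<xi> * d n)))\<^sup>2)) \<longlonglongrightarrow> 0" by simp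
    qed
    show "(\<integral>\<^sup>+\<xi>. 4 * L.weight T \<xi> \<partial>lborel) < \<infinity>"
      using fin by (simp add: nn_integral_cmult ennreal_mult_less_top total_weight_def)
  qed measurable
  moreover have "(\<lambda>n. total_weight (h n)) \<longlonglongrightarrow> 0"
  proof -
    \<comment> \<open>Capping the times at \<open>T\<close> provides the dominating function for all
      \<open>n\<close>; the cap is eventually inactive.\<close>
    have T1: "(\<lambda>n. min (h n) T) \<longlonglongrightarrow> min 0 T" by (intro tendsto_intros h)
    have "(\<lambda>n. \<integral>\<^sup>+\<xi>. L.weight (min (h n) T) \<xi> \<partial>lborel) \<longlonglongrightarrow> (\<integral>\<^sup>+\<xi>. (0::ennreal) \<partial>(lborel::real measure))"
    proof (rule nn_integral_dominated_convergence[where w="L.weight T"])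
      show "AE \<xi> in lborel. L.weight (min (h n) T) \<xi> \<le> L.weight T \<xi>" for n by (intro AE_I2 L.weight_mono) simp
      show "AE \<xi> in lborel. (\<lambda>n. L.weight (min (h n) T) \<xi>) \<longlonglongrightarrow> 0"
      proof (rule AE_I2)
        fix \<xi>
        have "(\<lambda>n. ennreal (min (h n) T)) \<longlonglongrightarrow> ennreal 0" using T T1 by (intro tendsto_ennrealI) simp
        then have lim0: "(\<lambda>n. ennreal (min (h n) T)) \<longlonglongrightarrow> 0" by simp
        show "(\<lambda>n. L.weight (min (h n) T) \<xi>) \<longlonglongrightarrow> 0"
        proof (rule tendsto_sandwich[OF _ _ tendsto_const lim0])
          show "\<forall>\<^sub>F n in sequentially. L.weight (min (h n) T) \<xi> \<le> ennreal (min (h n) T)"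
            using T h(1) by (intro always_eventually allI L.weight_le) auto
        qed simp_all
      qed
      show "(\<integral>\<^sup>+\<xi>. L.weight T \<xi> \<partial>lborel) < \<infinity>" using fin by (simp add: total_weight_def)
    qed measurable
    then have lim: "(\<lambda>n. total_weight (min (h n) T)) \<longlonglongrightarrow> 0" by (simp add: total_weight_def)
    have "\<forall>\<^sub>F n in sequentially. h n < T" using h(2) T by (rule order_tendstoD)
    then have "\<forall>\<^sub>F n in sequentially. total_weight (min (h n) T) = total_weight (h n)"
      by eventually_elim simp
    then show ?thesis by (rule Lim_transform_eventually[OF lim])
  qed
  ultimately have "(\<lambda>n. increment_energy T (h n) (d n)) \<longlonglongrightarrow> 0 + 0"
    unfolding increment_energy_def by (intro tendsto_add) simp_all
  then show ?thesis by simp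
qed

end

subsection \<open>Measurable modifications and local integrability\<close>

definition dyadic_floor :: "nat \<Rightarrow> real \<Rightarrow> real" where
  "dyadic_floor m t = real_of_int \<lfloor>t * 2 ^ m\<rfloor> / 2 ^ m"

lemma dyadic_floor_bounds: "dyadic_floor m t \<le> t" "t - dyadic_floor m t < (1/2) ^ m"
  "0 \<le> t \<Longrightarrow> 0 \<le> dyadic_floor m t"
proof -
  show "dyadic_floor m t \<le> t" by (simp add: dyadic_floor_def divide_le_eq)
  have "t * 2 ^ m < real_of_int \<lfloor>t * 2 ^ m\<rfloor> + 1" by linarith
  then have "t < (real_of_int \<lfloor>t * 2 ^ m\<rfloor> + 1) / 2 ^ m" by (simp add: pos_less_divide_eq)
  then show "t - dyadic_floor m t < (1/2) ^ m"
    by (simp add: dyadic_floor_def add_divide_distrib power_one_over)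
qed (simp add: dyadic_floor_def)

text \<open>A field sampled on a countable grid is jointly measurable without any path regularity:
  the two grid indices are substituted one after the other. The maximum with 0 keeps the grid at
  times where \<open>Y\<close> is known to be measurable.\<close>

lemma measurable_dyadic_field:
  assumes Y: "\<And>t x. 0 \<le> t \<Longrightarrow> Y t x \<in> borel_measurable M"
  shows "(\<lambda>z. if fst (fst z) < 0 then 0 else Y (dyadic_floor m (fst (fst z))) (dyadic_floor m (snd (fst z))) (snd z) :: real)
    \<in> borel_measurable ((borel \<Otimes>\<^sub>M borel) \<Otimes>\<^sub>M M)"
proof -
  let ?P = "(borel \<Otimes>\<^sub>M borel) \<Otimes>\<^sub>M M :: ((real \<times> real) \<times> _) measure"
  have 1: "(\<lambda>z. Y (max 0 (real_of_int i / 2 ^ m)) (real_of_int j / 2 ^ m) (snd z)) \<in> borel_measurable ?P" for i j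
    by (rule measurable_compose[OF measurable_snd Y]) simp
  have 2: "(\<lambda>z. Y (max 0 (real_of_int i / 2 ^ m)) (real_of_int \<lfloor>snd (fst z) * 2 ^ m\<rfloor> / 2 ^ m) (snd z)) \<in> borel_measurable ?P" for i
    by (rule measurable_compose_countable[where f="\<lambda>j z. Y (max 0 (real_of_int i / 2 ^ m)) (real_of_int j / 2 ^ m) (snd z)"
          and g="\<lambda>z. \<lfloor>snd (fst z) * 2 ^ m\<rfloor>", OF 1]) measurable
  have 3: "(\<lambda>z. Y (max 0 (real_of_int \<lfloor>fst (fst z) * 2 ^ m\<rfloor> / 2 ^ m)) (real_of_int \<lfloor>snd (fst z) * 2 ^ m\<rfloor> / 2 ^ m) (snd z)) \<in> borel_measurable ?P"
    by (rule measurable_compose_countable[where f="\<lambda>i z. Y (max 0 (real_of_int i / 2 ^ m)) (real_of_int \<lfloor>snd (fst z) * 2 ^ m\<rfloor> / 2 ^ m) (snd z)"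
          and g="\<lambda>z. \<lfloor>fst (fst z) * 2 ^ m\<rfloor>", OF 2]) measurable
  have "(\<lambda>z. if fst (fst z) < 0 then 0 else Y (max 0 (real_of_int \<lfloor>fst (fst z) * 2 ^ m\<rfloor> / 2 ^ m)) (real_of_int \<lfloor>snd (fst z) * 2 ^ m\<rfloor> / 2 ^ m) (snd z)) \<in> borel_measurable ?P"
    by (intro measurable_If 3) measurable
  also have "(\<lambda>z. if fst (fst z) < 0 then 0 else Y (max 0 (real_of_int \<lfloor>fst (fst z) * 2 ^ m\<rfloor> / 2 ^ m)) (real_of_int \<lfloor>snd (fst z) * 2 ^ m\<rfloor> / 2 ^ m) (snd z))
    = (\<lambda>z. if fst (fst z) < 0 then 0 else Y (dyadic_floor m (fst (fst z))) (dyadic_floor m (snd (fst z))) (snd z))"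
    by (auto simp: fun_eq_iff dyadic_floor_def max_def)
  finally show ?thesis .
qed

text \<open>At level \<open>n\<close> the field is sampled on a dyadic mesh so fine that the squared
  error is at most 2^(-n) for times up to \<open>n\<close>. These errors are summable, so at each
  fixed point the samples converge almost surely; \<open>lim\<close> is measurable also where they
  do not converge.\<close>

lemma jointly_measurable_modification:
  assumes Y: "\<And>t x. 0 \<le> t \<Longrightarrow> Y t x \<in> borel_measurable M"
    and unif: "\<And>n::nat. \<exists>\<delta>>0. \<forall>t t' x x'. 0 \<le> t \<longrightarrow> t \<le> t' \<longrightarrow> t' \<le> real n \<longrightarrow> t' - t < \<delta> \<longrightarrow> \<bar>x' - x\<bar> < \<delta> \<longrightarrow>
      sq_norm M (\<lambda>\<omega>. Y t x \<omega> - Y t' x' \<omega>) \<le> ennreal ((1/2) ^ n)"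
  shows "\<exists>Z :: real \<Rightarrow> real \<Rightarrow> 'a \<Rightarrow> real. (\<lambda>z. Z (fst (fst z)) (snd (fst z)) (snd z)) \<in> borel_measurable ((borel \<Otimes>\<^sub>M borel) \<Otimes>\<^sub>M M) \<and>
    (\<forall>t\<ge>0. \<forall>x. AE \<omega> in M. Z t x \<omega> = Y t x \<omega>)"
proof -
  have "\<exists>m. \<forall>t t' x x'. 0 \<le> t \<longrightarrow> t \<le> t' \<longrightarrow> t' \<le> real n \<longrightarrow> t' - t < (1/2) ^ m \<longrightarrow> \<bar>x' - x\<bar> < (1/2) ^ m \<longrightarrow>
      sq_norm M (\<lambda>\<omega>. Y t x \<omega> - Y t' x' \<omega>) \<le> ennreal ((1/2) ^ n)" for n
  proof -
    obtain \<delta> where \<delta>: "\<delta> > 0" "\<forall>t t' x x'. 0 \<le> t \<longrightarrow> t \<le> t' \<longrightarrow> t' \<le> real n \<longrightarrow> t' - t < \<delta> \<longrightarrow> \<bar>x' - x\<bar> < \<delta> \<longrightarrow>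
      sq_norm M (\<lambda>\<omega>. Y t x \<omega> - Y t' x' \<omega>) \<le> ennreal ((1/2) ^ n)" using unif by blast
    obtain m where "(1/2) ^ m < \<delta>" using real_arch_pow_inv[OF \<delta>(1), of "1/2"] by auto
    then show ?thesis using \<delta>(2) by (intro exI[of _ m]) (meson less_trans)
  qed
  then obtain m where m: "\<And>n t t' x x'. 0 \<le> t \<Longrightarrow> t \<le> t' \<Longrightarrow> t' \<le> real n \<Longrightarrow> t' - t < (1/2) ^ m n \<Longrightarrow> \<bar>x' - x\<bar> < (1/2) ^ m n \<Longrightarrow>
      sq_norm M (\<lambda>\<omega>. Y t x \<omega> - Y t' x' \<omega>) \<le> ennreal ((1/2) ^ n)" by metis
  define V where "V n z = (if fst (fst z) < 0 then 0 else Y (dyadic_floor (m n) (fst (fst z))) (dyadic_floor (m n) (snd (fst z))) (snd z))" for n and z :: "(real \<times> real) \<times> 'a"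
  have V[measurable]: "V n \<in> borel_measurable ((borel \<Otimes>\<^sub>M borel) \<Otimes>\<^sub>M M)" for n
    unfolding V_def[abs_def] by (rule measurable_dyadic_field[OF Y])
  define Z where "Z t x \<omega> = lim (\<lambda>n. V n ((t, x), \<omega>))" for t x \<omega>
  have "(\<lambda>z. lim (\<lambda>n. V n z)) \<in> borel_measurable ((borel \<Otimes>\<^sub>M borel) \<Otimes>\<^sub>M M)"
    by (rule borel_measurable_lim_metric) (rule V)
  then have "(\<lambda>z. Z (fst (fst z)) (snd (fst z)) (snd z)) \<in> borel_measurable ((borel \<Otimes>\<^sub>M borel) \<Otimes>\<^sub>M M)"
    by (simp add: Z_def)
  moreover have "AE \<omega> in M. Z t x \<omega> = Y t x \<omega>" if t: "0 \<le> t" for t x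
  proof -
    \<comment> \<open>The modulus at level \<open>n\<close> covers times up to \<open>n\<close>
      only, so the summation starts at a level that covers \<open>t\<close>.\<close>
    define n0 where "n0 = nat \<lceil>t\<rceil>"
    have n0: "t \<le> real (k + n0)" for k using t by (simp add: n0_def) linarith
    note [measurable] = Y[OF t] Y[OF dyadic_floor_bounds(3)[OF t]]
    let ?D = "\<lambda>k \<omega>. V (k + n0) ((t, x), \<omega>) - Y t x \<omega>"
    have D: "?D k = (\<lambda>\<omega>. Y (dyadic_floor (m (k + n0)) t) (dyadic_floor (m (k + n0)) x) \<omega> - Y t x \<omega>)" for k
      using t by (simp add: V_def)
    have "sq_norm M (?D k) \<le> ennreal ((1/2) ^ k)" for k
    proof -
      have "sq_norm M (?D k) \<le> ennreal ((1/2) ^ (k + n0))"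
        unfolding D using t n0[of k] dyadic_floor_bounds[where m="m (k + n0)" and t=t] dyadic_floor_bounds[where m="m (k + n0)" and t=x]
        by (intro m) auto
      also have "\<dots> \<le> ennreal ((1/2) ^ k)" by (intro ennreal_leI power_decreasing) auto
      finally show ?thesis .
    qed
    then have "(\<Sum>k. sq_norm M (?D k)) \<le> (\<Sum>k. ennreal ((1/2) ^ k))" by (intro suminf_le) auto
    also have "\<dots> < \<infinity>" by (subst suminf_ennreal2) (auto intro: summable_geometric)
    finally have "AE \<omega> in M. (\<lambda>k. ?D k \<omega>) \<longlonglongrightarrow> 0"
      by (intro AE_tendsto_zero_of_sq_norm) (simp_all add: D)
    then show ?thesis
    proof eventually_elim
      case (elim \<omega>)
      then have "(\<lambda>k. V (k + n0) ((t, x), \<omega>)) \<longlonglongrightarrow> Y t x \<omega>" by (rule LIM_zero_cancel)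
      then have "(\<lambda>k. V k ((t, x), \<omega>)) \<longlonglongrightarrow> Y t x \<omega>" by (rule LIMSEQ_offset)
      then show ?case unfolding Z_def by (rule limI)
    qed
  qed
  ultimately show ?thesis by blast
qed

text \<open>A countable exhaustion of the half plane, which allows one null set to serve all compact
  sets.\<close>

definition time_box :: "nat \<Rightarrow> (real \<times> real) set" where
  "time_box n = {0..real n} \<times> {- real n..real n}"

lemma time_box_measurable [measurable]: "time_box n \<in> sets borel"
  unfolding time_box_def by (intro borel_closed closed_Times) auto

lemma emeasure_time_box: "emeasure lborel (time_box n) < \<infinity>"
  unfolding time_box_def by (intro emeasure_bounded_finite bounded_Times) auto

text \<open>Every power \<open>q\<close> is dominated by 1 plus an even power, and every compact
  subset of the half plane lies in a box. Countably many integrals thus decide about all compact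
  sets and all exponents.\<close>

lemma Lp_loc_of_even_moments:
  assumes [measurable]: "f \<in> borel_measurable borel"
    and fin: "\<And>n k. (\<integral>\<^sup>+z. indicator (time_box n) z * ennreal (f z ^ (2 * k)) \<partial>lborel) < \<infinity>" and q: "0 \<le> q"
  shows "Lp_loc ({0..} \<times> UNIV) q f"
  unfolding Lp_loc_def
proof (intro allI impI, elim conjE)
  fix K :: "(real \<times> real) set" assume K: "compact K" "K \<subseteq> {0..} \<times> UNIV"
  then have [measurable]: "K \<in> sets borel" by (intro borel_closed compact_imp_closed)
  obtain B where B: "\<And>z. z \<in> K \<Longrightarrow> norm z \<le> B" using compact_imp_bounded[OF K(1)] by (auto simp: bounded_iff)
  define n where "n = nat \<lceil>B\<rceil>"
  have n: "B \<le> real n" by (simp add: n_def) linarith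
  have sub: "K \<subseteq> time_box n"
  proof
    fix z assume z: "z \<in> K"
    have "\<bar>fst z\<bar> \<le> real n" "\<bar>snd z\<bar> \<le> real n"
      using B[OF z] n norm_fst_le[of "fst z" "snd z"] norm_snd_le[of "snd z" "fst z"] by auto
    then show "z \<in> time_box n" using K(2) z by (cases z) (auto simp: time_box_def abs_le_iff)
  qed
  define k where "k = nat \<lceil>q\<rceil>"
  have k: "q \<le> real (2 * k)" by (simp add: k_def) linarith
  have le: "\<bar>y\<bar> powr q \<le> 1 + y ^ (2 * k)" for y :: real
  proof (cases "\<bar>y\<bar> \<le> 1")
    case True
    then have "\<bar>y\<bar> powr q \<le> 1 powr q" using q by (intro powr_mono2) auto
    moreover have "0 \<le> y ^ (2 * k)" by simp
    ultimately show ?thesis unfolding powr_one_eq_one by linarith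
  next
    case False
    then have "\<bar>y\<bar> powr q \<le> \<bar>y\<bar> powr real (2 * k)" using k by (intro powr_mono) auto
    also have "\<dots> = y ^ (2 * k)" using False by (subst powr_realpow) (auto simp: power_even_abs)
    finally show ?thesis by simp
  qed
  have "(\<integral>\<^sup>+z. ennreal (norm (indicator K z *\<^sub>R (\<bar>f z\<bar> powr q))) \<partial>lborel)
      \<le> (\<integral>\<^sup>+z. indicator (time_box n) z * ennreal (f z ^ (2 * 0)) + indicator (time_box n) z * ennreal (f z ^ (2 * k)) \<partial>lborel)"
  proof (intro nn_integral_mono)
    fix z
    have "ennreal (\<bar>f z\<bar> powr q) \<le> 1 + ennreal (f z ^ (2 * k))"
      using ennreal_leI[OF le[of "f z"]] by (simp add: zero_le_even_power)
    then show "ennreal (norm (indicator K z *\<^sub>R (\<bar>f z\<bar> powr q)))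
      \<le> indicator (time_box n) z * ennreal (f z ^ (2 * 0)) + indicator (time_box n) z * ennreal (f z ^ (2 * k))"
      using sub by (auto simp: indicator_def)
  qed
  also have "\<dots> = (\<integral>\<^sup>+z. indicator (time_box n) z * ennreal (f z ^ (2 * 0)) \<partial>lborel) + (\<integral>\<^sup>+z. indicator (time_box n) z * ennreal (f z ^ (2 * k)) \<partial>lborel)"
    by (rule nn_integral_add) measurable
  also have "\<dots> < \<infinity>" using fin[of n 0] fin[of n k] by simp
  finally have "set_integrable lborel K (\<lambda>z. \<bar>f z\<bar> powr q)"
    unfolding set_integrable_def integrable_iff_bounded by simp
  moreover have "set_borel_measurable lborel K f" unfolding set_borel_measurable_def by measurable
  ultimately show "set_borel_measurable lborel K f \<and> set_integrable lborel K (\<lambda>z. \<bar>f z\<bar> powr q)" by blast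
qed

text \<open>Meant for \<open>f\<close> a path of the linear solution and \<open>u\<close> the drift
  part. The factor 4^k is 2^(2k), from bounding a sum by twice its larger term.\<close>

lemma Lp_loc_of_moments_plus_bounded:
  assumes [measurable]: "f \<in> borel_measurable borel" "u \<in> borel_measurable borel"
    and fin: "\<And>n k. (\<integral>\<^sup>+z. indicator (time_box n) z * ennreal (f z ^ (2 * k)) \<partial>lborel) < \<infinity>"
    and bd: "\<And>n z. z \<in> time_box n \<Longrightarrow> \<bar>u z\<bar> \<le> C n" and q: "0 \<le> q"
  shows "Lp_loc ({0..} \<times> UNIV) q (\<lambda>z. f z + u z)"
proof (rule Lp_loc_of_even_moments[OF _ _ q])
  fix n k
  have le: "(a + b) ^ (2 * k) \<le> 4 ^ k * (a ^ (2 * k) + b ^ (2 * k))" for a b :: real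
  proof -
    have "\<bar>a + b\<bar> ^ (2 * k) \<le> (2 * max \<bar>a\<bar> \<bar>b\<bar>) ^ (2 * k)" by (intro power_mono) auto
    also have "\<dots> = 4 ^ k * max \<bar>a\<bar> \<bar>b\<bar> ^ (2 * k)" by (simp add: power_mult_distrib power_mult)
    also have "\<dots> \<le> 4 ^ k * (\<bar>a\<bar> ^ (2 * k) + \<bar>b\<bar> ^ (2 * k))" by (intro mult_left_mono) (auto simp: max_def)
    finally show ?thesis by (simp add: power_even_abs)
  qed
  have "(\<integral>\<^sup>+z. indicator (time_box n) z * ennreal ((f z + u z) ^ (2 * k)) \<partial>lborel)
     \<le> (\<integral>\<^sup>+z. ennreal (4 ^ k) * (indicator (time_box n) z * ennreal (f z ^ (2 * k))) + ennreal (4 ^ k * \<bar>C n\<bar> ^ (2 * k)) * indicator (time_box n) z \<partial>lborel)"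
  proof (intro nn_integral_mono)
    fix z
    show "indicator (time_box n) z * ennreal ((f z + u z) ^ (2 * k))
      \<le> ennreal (4 ^ k) * (indicator (time_box n) z * ennreal (f z ^ (2 * k))) + ennreal (4 ^ k * \<bar>C n\<bar> ^ (2 * k)) * indicator (time_box n) z"
    proof (cases "z \<in> time_box n")
      case True
      have "u z ^ (2 * k) \<le> \<bar>C n\<bar> ^ (2 * k)"
        using power_mono[of "\<bar>u z\<bar>" "\<bar>C n\<bar>" "2 * k"] bd[OF True] by (simp add: power_even_abs)
      then have "(f z + u z) ^ (2 * k) \<le> 4 ^ k * (f z ^ (2 * k)) + 4 ^ k * \<bar>C n\<bar> ^ (2 * k)"
        using le[of "f z" "u z"] by (simp add: distrib_left mult_left_mono order_trans)
      then have "ennreal ((f z + u z) ^ (2 * k)) \<le> ennreal (4 ^ k * (f z ^ (2 * k)) + 4 ^ k * \<bar>C n\<bar> ^ (2 * k))" by (rule ennreal_leI)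
      then show ?thesis using True by (simp add: ennreal_mult' zero_le_even_power)
    qed simp
  qed
  also have "\<dots> = ennreal (4 ^ k) * (\<integral>\<^sup>+z. indicator (time_box n) z * ennreal (f z ^ (2 * k)) \<partial>lborel) + ennreal (4 ^ k * \<bar>C n\<bar> ^ (2 * k)) * emeasure lborel (time_box n)"
    by (subst nn_integral_add) (simp_all add: nn_integral_cmult nn_integral_cmult_indicator)
  also have "\<dots> < \<infinity>" using fin[of n k] emeasure_time_box[of n] by (simp add: ennreal_mult_less_top)
  finally show "(\<integral>\<^sup>+z. indicator (time_box n) z * ennreal ((f z + u z) ^ (2 * k)) \<partial>lborel) < \<infinity>" .
qed measurable

subsection \<open>The transition density\<close>

lemma integrable_indicator_Icc: "integrable lborel (\<lambda>x. indicator {a..b::real} x * (c::real))"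
proof -
  have "integrable lborel (indicator {a..b} :: real \<Rightarrow> real)"
    by (rule integrable_real_indicator) (auto simp: emeasure_lborel_Icc_eq)
  then show ?thesis by simp
qed

section \<open>Densities of laws with integrable characteristic function\<close>

context real_distribution
begin

text \<open>The density given by Fourier inversion. Its integral is real by symmetry of
  \<open>char M\<close>; taking the real part makes the definition real valued from the
  start.\<close>

definition inverse_char :: "real \<Rightarrow> real" where
  "inverse_char x = Re (CLBINT \<xi>. iexp (- (\<xi> * x)) * char M \<xi>) / (2 * pi)"

lemma inverse_char_integrand:
  assumes "integrable lborel (char M)"
  shows "integrable lborel (\<lambda>\<xi>. iexp (- (\<xi> * x)) * char M \<xi>)"
  by (rule Bochner_Integration.integrable_bound[OF assms]) (auto simp: norm_mult)

lemma inverse_char_continuous: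
  assumes int: "integrable lborel (char M)"
  shows "continuous_on UNIV inverse_char"
  unfolding continuous_on_sequentially
proof (intro ballI allI impI, elim conjE)
  fix x and u :: "nat \<Rightarrow> real" assume u: "u \<longlonglongrightarrow> x"
  have "(\<lambda>n. CLBINT \<xi>. iexp (- (\<xi> * u n)) * char M \<xi>) \<longlonglongrightarrow> (CLBINT \<xi>. iexp (- (\<xi> * x)) * char M \<xi>)"
  proof (rule integral_dominated_convergence[where w="\<lambda>\<xi>. cmod (char M \<xi>)"])
    show "AE \<xi> in lborel. (\<lambda>n. iexp (- (\<xi> * u n)) * char M \<xi>) \<longlonglongrightarrow> iexp (- (\<xi> * x)) * char M \<xi>"
      by (intro AE_I2 tendsto_intros u)
  qed (use int in \<open>auto simp: norm_mult\<close>)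
  then show "(inverse_char \<circ> u) \<longlonglongrightarrow> inverse_char x"
    unfolding o_def inverse_char_def by (intro tendsto_intros) simp_all
qed

lemma inverse_char_bound:
  assumes int: "integrable lborel (char M)"
  shows "\<bar>inverse_char x\<bar> \<le> (\<integral>\<xi>. cmod (char M \<xi>) \<partial>lborel)"
proof -
  let ?I = "CLBINT \<xi>. iexp (- (\<xi> * x)) * char M \<xi>"
  have "\<bar>inverse_char x\<bar> = \<bar>Re ?I\<bar> / (2 * pi)" by (simp add: inverse_char_def)
  also have "\<dots> \<le> \<bar>Re ?I\<bar> / 1" using pi_ge_two by (intro divide_left_mono) auto
  also have "\<dots> \<le> cmod ?I" using abs_Re_le_cmod[of ?I] by simp
  also have "\<dots> \<le> (\<integral>\<xi>. cmod (iexp (- (\<xi> * x)) * char M \<xi>) \<partial>lborel)" by (rule integral_norm_bound)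
  also have "\<dots> = (\<integral>\<xi>. cmod (char M \<xi>) \<partial>lborel)" by (simp add: norm_mult)
  finally show ?thesis .
qed

lemma integral_iexp_interval:
  assumes "a \<le> b" "t \<noteq> 0"
  shows "(CLBINT x. indicator {a..b} x *\<^sub>R iexp (- (t * x))) = (iexp (- (t * a)) - iexp (- (t * b))) / (\<i> * t)"
proof -
  let ?F = "\<lambda>x. - iexp (- (t * x)) / (\<i> * t)"
  have "(CLBINT x. indicator {a..b} x *\<^sub>R iexp (- (t * x))) = ?F b - ?F a"
  proof (rule integral_FTC_Icc[OF assms(1)])
    fix x assume "a \<le> x" "x \<le> b"
    have "((\<lambda>z. - exp (- (\<i> * t * z)) / (\<i> * t)) has_field_derivative exp (- (\<i> * t * complex_of_real x))) (at (complex_of_real x))"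
      using assms(2) by (auto intro!: derivative_eq_intros)
    then have "((\<lambda>x. - exp (- (\<i> * t * complex_of_real x)) / (\<i> * t)) has_vector_derivative exp (- (\<i> * t * complex_of_real x))) (at x)"
      by (rule has_vector_derivative_real_field)
    then show "(?F has_vector_derivative iexp (- (t * x))) (at x within {a..b})"
      by (auto simp: mult.assoc intro: has_vector_derivative_at_within)
  qed (intro continuous_intros)
  then show ?thesis by (simp add: diff_divide_distrib)
qed

text \<open>Levy's inversion formula expresses the measure as a limit of truncated integrals.
  Integrability of \<open>char M\<close> removes the truncation, the quotient is the integral of an
  exponential over the interval, and Fubini's theorem exposes \<open>inverse_char\<close>.\<close>

lemma measure_Ioc_inverse_char:
  assumes int: "integrable lborel (char M)" and ab: "a \<le> b" and zero: "measure M {a} = 0" "measure M {b} = 0"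
  shows "measure M {a<..b} = (\<integral>x. indicator {a..b} x * inverse_char x \<partial>lborel)"
proof -
  let ?G = "\<lambda>t. (iexp (- (t * a)) - iexp (- (t * b))) / (\<i> * complex_of_real t) * char M t"
  have Gb: "cmod (?G t) \<le> (b - a) * cmod (char M t)" for t
  proof (cases "t = 0")
    case False
    have "cmod ((iexp (t * - a) - iexp (t * - b)) / (\<i> * t)) \<le> - a - - b"
      using ab False by (intro Levy_Inversion_aux2) auto
    then show ?thesis unfolding norm_mult by (intro mult_right_mono) auto
  qed (use ab in auto)
  have [measurable]: "(\<lambda>t. ?G t) \<in> borel_measurable borel" by measurable
  have lim1: "(\<lambda>T. 1 / (2 * pi) * (CLBINT t=-real T..real T. ?G t)) \<longlonglongrightarrow> complex_of_real (measure M {a<..b})"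
    using Levy_Inversion[OF ab zero] by simp
  have "(\<lambda>T. CLBINT t. indicator {- real T..real T} t *\<^sub>R ?G t) \<longlonglongrightarrow> (CLBINT t. ?G t)"
  proof (rule integral_dominated_convergence[where w="\<lambda>t. (b - a) * cmod (char M t)"])
    show "AE t in lborel. (\<lambda>T. indicator {- real T..real T} t *\<^sub>R ?G t) \<longlonglongrightarrow> ?G t"
    proof (rule AE_I2)
      fix t
      have "\<forall>\<^sub>F T in sequentially. ?G t = indicator {- real T..real T} t *\<^sub>R ?G t"
        using eventually_ge_at_top[of "nat \<lceil>\<bar>t\<bar>\<rceil>"]
      proof eventually_elim
        case (elim T)
        then have "\<bar>t\<bar> \<le> real T" by linarith
        then show ?case by (auto simp: indicator_def)
      qed
      then show "(\<lambda>T. indicator {- real T..real T} t *\<^sub>R ?G t) \<longlonglongrightarrow> ?G t"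
        by (rule Lim_transform_eventually[OF tendsto_const])
    qed
    show "AE t in lborel. norm (indicator {- real T..real T} t *\<^sub>R ?G t) \<le> (b - a) * cmod (char M t)" for T
    proof (rule AE_I2)
      fix t
      have "norm (indicator {- real T..real T} t *\<^sub>R ?G t) \<le> cmod (?G t)" by (simp add: indicator_def)
      then show "norm (indicator {- real T..real T} t *\<^sub>R ?G t) \<le> (b - a) * cmod (char M t)"
        using Gb[of t] by (rule order_trans)
    qed
    show "integrable lborel (\<lambda>t. (b - a) * cmod (char M t))" using int by simp
  qed measurable
  then have "(\<lambda>T. 1 / (2 * pi) * (CLBINT t. indicator {- real T..real T} t *\<^sub>R ?G t)) \<longlonglongrightarrow> 1 / (2 * pi) * (CLBINT t. ?G t)"
    by (intro tendsto_mult tendsto_const)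
  moreover have "(CLBINT t=-real T..real T. ?G t) = (CLBINT t. indicator {- real T..real T} t *\<^sub>R ?G t)" for T
  proof -
    have "(CLBINT t=ereal (- real T)..ereal (real T). ?G t) = (CLBINT t:{- real T..real T}. ?G t)" by (rule interval_integral_Icc) simp
    then show ?thesis by (simp add: set_lebesgue_integral_def)
  qed
  ultimately have "complex_of_real (measure M {a<..b}) = 1 / (2 * pi) * (CLBINT t. ?G t)"
    using LIMSEQ_unique[OF lim1] by simp
  also have "(CLBINT t. ?G t) = (CLBINT t. (CLBINT x. indicator {a..b} x *\<^sub>R (iexp (- (t * x)) * char M t)))"
  proof (rule integral_cong_AE)
    have "(\<lambda>z::real\<times>real. indicator {a..b} (snd z) *\<^sub>R (iexp (- (fst z * snd z)) * char M (fst z))) \<in> borel_measurable (lborel \<Otimes>\<^sub>M lborel)"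
      by measurable
    then show "(\<lambda>t. CLBINT x. indicator {a..b} x *\<^sub>R (iexp (- (t * x)) * char M t)) \<in> borel_measurable lborel"
      by (intro lborel.borel_measurable_lebesgue_integral) (simp add: case_prod_beta')
    \<comment> \<open>At \<open>t = 0\<close> the quotient has the value 0 of a division by 0
      instead of \<open>b - a\<close>, so the two sides agree only off that point.\<close>
    show "AE t in lborel. ?G t = (CLBINT x. indicator {a..b} x *\<^sub>R (iexp (- (t * x)) * char M t))"
      using AE_lborel_singleton[of 0]
    proof eventually_elim
      case (elim t)
      have "(CLBINT x. indicator {a..b} x *\<^sub>R (iexp (- (t * x)) * char M t)) = (CLBINT x. (indicator {a..b} x *\<^sub>R iexp (- (t * x))) * char M t)"
        by simp
      also have "\<dots> = ?G t" by (simp only: integral_mult_left_zero integral_iexp_interval[OF ab elim])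
      finally show ?case by simp
    qed
  qed simp
  also have "\<dots> = (CLBINT x. (CLBINT t. indicator {a..b} x *\<^sub>R (iexp (- (t * x)) * char M t)))"
  proof (rule lborel_pair.Fubini_integral[symmetric])
    note fin = integrable_indicator_Icc[of a b]
    show "integrable (lborel \<Otimes>\<^sub>M lborel) (\<lambda>(t, x). indicator {a..b} x *\<^sub>R (iexp (- (t * x)) * char M t))"
    proof (rule lborel_pair.Fubini_integrable)
      show "AE t in lborel. integrable lborel (\<lambda>x. case (t, x) of (t, x) \<Rightarrow> indicator {a..b} x *\<^sub>R (iexp (- (t * x)) * char M t))"
      proof (rule AE_I2)
        fix t
        show "integrable lborel (\<lambda>x. case (t, x) of (t, x) \<Rightarrow> indicator {a..b} x *\<^sub>R (iexp (- (t * x)) * char M t))"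
          by (rule Bochner_Integration.integrable_bound[of lborel "\<lambda>x. indicator {a..b} x * cmod (char M t)"])
            (rule fin, simp, auto simp: norm_mult indicator_def)
      qed
      have "integrable lborel (\<lambda>t. cmod (char M t) * (\<integral>x. indicator {a..b} x \<partial>lborel))"
        using int by (intro integrable_mult_left integrable_norm)
      then show "integrable lborel (\<lambda>t. \<integral>x. norm (case (t, x) of (t, x) \<Rightarrow> indicator {a..b} x *\<^sub>R (iexp (- (t * x)) * char M t)) \<partial>lborel)"
        by (simp add: norm_mult mult.commute)
    qed measurable
  qed
  also have "\<dots> = (CLBINT x. indicator {a..b} x *\<^sub>R (CLBINT t. iexp (- (t * x)) * char M t))"
    by (simp only: integral_scaleR_right)
  finally have eq: "complex_of_real (measure M {a<..b}) = 1 / (2 * pi) * (CLBINT x. indicator {a..b} x *\<^sub>R (CLBINT t. iexp (- (t * x)) * char M t))" .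
  have intx: "integrable lborel (\<lambda>x. indicator {a..b} x *\<^sub>R (CLBINT t. iexp (- (t * x)) * char M t))"
  proof (rule Bochner_Integration.integrable_bound[of lborel "\<lambda>x. indicator {a..b} x * (\<integral>\<xi>. cmod (char M \<xi>) \<partial>lborel)"])
    have "(\<lambda>z::real\<times>real. iexp (- (snd z * fst z)) * char M (snd z)) \<in> borel_measurable (lborel \<Otimes>\<^sub>M lborel)"
      by measurable
    then have [measurable]: "(\<lambda>x. CLBINT t. iexp (- (t * x)) * char M t) \<in> borel_measurable lborel"
      by (intro lborel.borel_measurable_lebesgue_integral) (simp add: case_prod_beta')
    show "(\<lambda>x. indicator {a..b} x *\<^sub>R (CLBINT t. iexp (- (t * x)) * char M t)) \<in> borel_measurable lborel" by measurable
    have "cmod (CLBINT t. iexp (- (t * x)) * char M t) \<le> (\<integral>\<xi>. cmod (char M \<xi>) \<partial>lborel)" for x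
      using integral_norm_bound[of lborel "\<lambda>t. iexp (- (t * x)) * char M t"] by (simp add: norm_mult)
    then show "AE x in lborel. norm (indicator {a..b} x *\<^sub>R (CLBINT t. iexp (- (t * x)) * char M t)) \<le> norm (indicator {a..b} x * (\<integral>\<xi>. cmod (char M \<xi>) \<partial>lborel))"
      by (auto simp: indicator_def intro!: AE_I2 order_trans[OF _ abs_ge_self])
  qed (rule integrable_indicator_Icc)
  have "measure M {a<..b} = Re (CLBINT x. indicator {a..b} x *\<^sub>R (CLBINT t. iexp (- (t * x)) * char M t)) / (2 * pi)"
    using arg_cong[OF eq, of Re] by (simp add: Re_divide_of_real flip: of_real_mult)
  also have "\<dots> = (\<integral>x. Re (indicator {a..b} x *\<^sub>R (CLBINT t. iexp (- (t * x)) * char M t)) / (2 * pi) \<partial>lborel)"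
    using intx by (simp only: integral_Re integral_divide_zero)
  also have "\<dots> = (\<integral>x. indicator {a..b} x * inverse_char x \<partial>lborel)"
    by (simp add: inverse_char_def)
  finally show ?thesis .
qed

text \<open>Atoms are countable in number, intervals are not.\<close>

lemma atomless_between:
  assumes "c < d"
  obtains a where "c < a" "a < d" "measure M {a} = 0"
proof -
  have "\<not> countable {c<..<d}" using assms by (simp add: uncountable_open_interval)
  then have "\<not> {c<..<d} \<subseteq> {x. measure M {x} \<noteq> 0}" using countable_support countable_subset by blast
  then show thesis using that by auto
qed

text \<open>Intervals with massless endpoints have measure at most \<open>C\<close> times their
  length; shrinking them rules out atoms, so the interval formula holds for all endpoints. By
  continuity it gives nonnegativity, and it determines the measure because half-open intervals
  generate the Borel sets.\<close>

lemma inverse_char_density: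
  assumes int: "integrable lborel (char M)"
  shows "0 \<le> inverse_char x" and "M = density lborel (\<lambda>x. ennreal (inverse_char x))"
proof -
  note cont = inverse_char_continuous[OF int]
  have [measurable]: "inverse_char \<in> borel_measurable borel" using cont by (rule borel_measurable_continuous_onI)
  define C where "C = (\<integral>\<xi>. cmod (char M \<xi>) \<partial>lborel)"
  have C: "\<bar>inverse_char x\<bar> \<le> C" for x unfolding C_def by (rule inverse_char_bound[OF int])
  have C0: "0 \<le> C" using C[of 0] by simp
  have ii: "integrable lborel (\<lambda>x. indicator {a..b} x * inverse_char x)" for a b
  proof (rule Bochner_Integration.integrable_bound[of lborel "\<lambda>x. indicator {a..b} x * C"])
    show "integrable lborel (\<lambda>x. indicator {a..b} x * C)" by (rule integrable_indicator_Icc)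
    show "AE x in lborel. norm (indicator {a..b} x * inverse_char x) \<le> norm (indicator {a..b} x * C)"
      using C C0 by (auto simp: indicator_def)
  qed simp_all
  have ub: "(\<integral>x. indicator {a..b} x * inverse_char x \<partial>lborel) \<le> C * (b - a)" if "a \<le> b" for a b
  proof -
    have "(\<integral>x. indicator {a..b} x * inverse_char x \<partial>lborel) \<le> (\<integral>x. indicator {a..b} x * C \<partial>lborel)"
      using C by (intro integral_mono ii integrable_indicator_Icc) (auto simp: indicator_def abs_le_iff)
    then show ?thesis using that by (simp add: mult.commute)
  qed
  have atomless: "measure M {x} = 0" for x
  proof (rule ccontr)
    assume "measure M {x} \<noteq> 0"
    then have pos: "0 < measure M {x}" using measure_nonneg[of M "{x}"] by linarith
    \<comment> \<open>Makes \<open>(C + 1) * (2 * e)\<close> half the mass of the supposed atom;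
      \<open>C + 1\<close> is positive even if \<open>C\<close> is 0.\<close>
    define e where "e = measure M {x} / (4 * (C + 1))"
    have e: "0 < e" using pos C0 by (simp add: e_def)
    obtain a where a: "x - e < a" "a < x" "measure M {a} = 0" using atomless_between[of "x - e" x] e by auto
    obtain b where b: "x < b" "b < x + e" "measure M {b} = 0" using atomless_between[of x "x + e"] e by auto
    have "measure M {x} \<le> measure M {a<..b}" using a b by (intro finite_measure_mono) auto
    also have "\<dots> \<le> C * (b - a)"
      using measure_Ioc_inverse_char[OF int _ a(3) b(3)] ub[of a b] a b by simp
    also have "\<dots> \<le> (C + 1) * (2 * e)" using a b C0 by (intro mult_mono) auto
    also have "\<dots> = measure M {x} / 2"
    proof -
      have "D * (2 * (m / (4 * D))) = m / 2" if "D \<noteq> 0" for D m :: real using that by simp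
      note half = this
      show ?thesis unfolding e_def by (rule half) (use C0 in simp)
    qed
    finally show False using pos by simp
  qed
  have Ioc: "measure M {a<..b} = (\<integral>x. indicator {a..b} x * inverse_char x \<partial>lborel)" if "a \<le> b" for a b
    by (rule measure_Ioc_inverse_char[OF int that atomless atomless])
  show nonneg: "0 \<le> inverse_char x" for x
  proof (rule ccontr)
    assume neg: "\<not> 0 \<le> inverse_char x"
    have "isCont inverse_char x" using cont by (simp add: continuous_on_eq_continuous_at)
    then have "\<forall>\<^sub>F y in at x. inverse_char y < inverse_char x / 2"
      using neg by (intro order_tendstoD(2)[of inverse_char "inverse_char x"]) (auto simp: isCont_def)
    then obtain d where d: "d > 0" "\<And>y. y \<noteq> x \<Longrightarrow> dist y x < d \<Longrightarrow> inverse_char y < inverse_char x / 2"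
      unfolding eventually_at by auto
    have le: "inverse_char y \<le> inverse_char x / 2" if "y \<in> {x - d / 2..x + d / 2}" for y
      using d(2)[of y] that d(1) neg by (cases "y = x") (auto simp: dist_real_def abs_less_iff)
    have "0 \<le> measure M {x - d / 2<..x + d / 2}" by simp
    also have "\<dots> = (\<integral>y. indicator {x - d / 2..x + d / 2} y * inverse_char y \<partial>lborel)" using d(1) by (intro Ioc) simp
    also have "\<dots> \<le> (\<integral>y. indicator {x - d / 2..x + d / 2} y * (inverse_char x / 2) \<partial>lborel)"
    proof (intro integral_mono ii integrable_indicator_Icc)
      fix y
      show "indicator {x - d / 2..x + d / 2} y * inverse_char y \<le> indicator {x - d / 2..x + d / 2} y * (inverse_char x / 2)"
        using le[of y] by (cases "y \<in> {x - d / 2..x + d / 2}") auto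
    qed
    also have "\<dots> = d * (inverse_char x / 2)" using d(1) by simp
    also have "\<dots> < 0" using d(1) neg by (simp add: mult_less_0_iff)
    finally show False by simp
  qed
  show "M = density lborel (\<lambda>x. ennreal (inverse_char x))"
  proof (rule measure_eqI_generator_eq[where \<Omega>=UNIV and E="range (\<lambda>(a, b). {a<..b::real})" and A="\<lambda>n. {- real n<..real n}"])
    show "Int_stable (range (\<lambda>(a, b). {a<..b::real}))"
      by (auto simp: Int_stable_def)
    have sig: "sets (borel :: real measure) = sigma_sets UNIV (range (\<lambda>(a, b). {a<..b::real}))"
      unfolding borel_sigma_sets_Ioc by (rule sets_measure_of) simp
    show "sets M = sigma_sets UNIV (range (\<lambda>(a, b). {a<..b}))" using sig by simp
    show "sets (density lborel (\<lambda>x. ennreal (inverse_char x))) = sigma_sets UNIV (range (\<lambda>(a, b). {a<..b}))" using sig by simp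
    show "(\<Union>n. {- real n<..real n}) = UNIV"
    proof -
      have "\<exists>n. x \<in> {- real n<..real n}" for x
      proof -
        obtain n where "\<bar>x\<bar> < real n" using reals_Archimedean2 by blast
        then show ?thesis by (intro exI[of _ n]) auto
      qed
      then show ?thesis by blast
    qed
    fix Y assume "Y \<in> range (\<lambda>(a, b). {a<..b::real})"
    then obtain a b where Y: "Y = {a<..b}" by auto
    show "emeasure M Y = emeasure (density lborel (\<lambda>x. ennreal (inverse_char x))) Y"
    proof (cases "a \<le> b")
      case True
      have "emeasure (density lborel (\<lambda>x. ennreal (inverse_char x))) Y = (\<integral>\<^sup>+x. ennreal (inverse_char x) * indicator {a<..b} x \<partial>lborel)"
        unfolding Y by (intro emeasure_density) simp_all
      also have "\<dots> = (\<integral>\<^sup>+x. ennreal (indicator {a..b} x * inverse_char x) \<partial>lborel)"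
      proof (rule nn_integral_cong_AE)
        show "AE x in lborel. ennreal (inverse_char x) * indicator {a<..b} x = ennreal (indicator {a..b} x * inverse_char x)"
          using AE_lborel_singleton[of a] by eventually_elim (auto simp: indicator_def)
      qed
      also have "\<dots> = ennreal (measure M {a<..b})"
        unfolding Ioc[OF True] by (intro nn_integral_eq_integral ii AE_I2 mult_nonneg_nonneg nonneg) simp
      finally show ?thesis by (simp add: Y emeasure_eq_measure)
    qed (simp add: Y)
  qed auto
qed

end

text \<open>Continuity is local, and the open slabs between two positive times cover the half
  plane.\<close>

lemma continuous_on_half_plane:
  fixes f :: "real \<times> real \<Rightarrow> real"
  assumes "\<And>\<epsilon> T. 0 < \<epsilon> \<Longrightarrow> 0 < T \<Longrightarrow> uniformly_continuous_on ({\<epsilon>..T} \<times> UNIV) f"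
  shows "continuous_on ({0<..} \<times> UNIV) f"
proof -
  let ?I = "{z :: real \<times> real. 0 < fst z \<and> 0 < snd z}"
  have "continuous_on (\<Union>z\<in>?I. {fst z<..<snd z} \<times> UNIV) f"
  proof (rule continuous_on_open_UN)
    fix z :: "real \<times> real" assume "z \<in> ?I"
    then have "continuous_on ({fst z..snd z} \<times> UNIV) f"
      by (intro uniformly_continuous_imp_continuous assms) simp_all
    then show "continuous_on ({fst z<..<snd z} \<times> UNIV) f" by (rule continuous_on_subset) auto
  qed (auto intro!: open_Times)
  moreover have "{0<..} \<times> UNIV \<subseteq> (\<Union>z\<in>?I. {fst z<..<snd z} \<times> (UNIV :: real set))"
  proof
    fix z :: "real \<times> real" assume "z \<in> {0<..} \<times> UNIV"
    then show "z \<in> (\<Union>z\<in>?I. {fst z<..<snd z} \<times> UNIV)"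
      by (intro UN_I[of "(fst z / 2, 2 * fst z)"]) (auto simp: mem_Times_iff)
  qed
  ultimately show ?thesis by (rule continuous_on_subset)
qed

context levy
begin

text \<open>The difference of two values of \<open>p\<close> is bounded by \<open>m\<close>, an
  integral that depends on the points only through their differences in time and space and is valid
  for all times from \<open>\<epsilon>\<close> on. Dominated convergence makes \<open>m\<close>
  small, so the continuity is uniform.\<close>

lemma transition_density_exists:
  assumes int: "\<And>t. 0 < t \<Longrightarrow> integrable lborel (\<lambda>\<xi>. exp (- t * rate \<xi>))"
  shows "\<exists>p. is_transition_density N X p"
proof -
  define p where "p t = real_distribution.inverse_char (distr N borel (X t))" for t
  have icomplex: "integrable lborel (chr t)" if t: "0 < t" for t
  proof (rule Bochner_Integration.integrable_bound[OF int[OF t]])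
    show "chr t \<in> borel_measurable lborel" using chr_measurable[of t] t by simp
    show "AE \<xi> in lborel. norm (chr t \<xi>) \<le> norm (exp (- t * rate \<xi>))"
      using t by (simp add: cmod_chr)
  qed
  have rd: "real_distribution (distr N borel (X t))" if "0 < t" for t
    using real_distribution_X[of t] that by simp
  have ic: "integrable lborel (char (distr N borel (X t)))" if t: "0 < t" for t
    using icomplex[OF t] t by (simp add: chr_eq_char)
  have nonneg: "0 \<le> p t x" if "0 < t" for t x
    unfolding p_def by (rule real_distribution.inverse_char_density(1)[OF rd ic]) fact+
  have dens: "distr N borel (X t) = density lborel (\<lambda>x. ennreal (p t x))" if "0 < t" for t
    unfolding p_def by (rule real_distribution.inverse_char_density(2)[OF rd ic]) fact+
  have formula: "p t x = Re (CLBINT \<xi>. iexp (- (\<xi> * x)) * chr t \<xi>) / (2 * pi)" if "0 < t" for t x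
    using that by (simp add: p_def real_distribution.inverse_char_def[OF rd] chr_eq_char)
  have integrand: "integrable lborel (\<lambda>\<xi>. iexp (- (\<xi> * x)) * chr t \<xi>)" if "0 < t" for t x
    using real_distribution.inverse_char_integrand[OF rd ic] that by (simp add: chr_eq_char)
  define m where "m \<epsilon> h d = (\<integral>\<xi>. exp (- \<epsilon> * rate \<xi>) * cmod (1 - iexp (\<xi> * d) * chr h \<xi>) \<partial>lborel)" for \<epsilon> h d
  have m_int: "integrable lborel (\<lambda>\<xi>. exp (- \<epsilon> * rate \<xi>) * cmod (1 - iexp (\<xi> * d) * chr h \<xi>))" if "0 < \<epsilon>" "0 \<le> h" for \<epsilon> h d
  proof (rule Bochner_Integration.integrable_bound[of lborel "\<lambda>\<xi>. 2 * exp (- \<epsilon> * rate \<xi>)"])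
    show "integrable lborel (\<lambda>\<xi>. 2 * exp (- \<epsilon> * rate \<xi>))" using int[OF that(1)] by simp
    have "cmod (1 - iexp (\<xi> * d) * chr h \<xi>) \<le> 2" for \<xi>
      using norm_triangle_ineq4[of 1 "iexp (\<xi> * d) * chr h \<xi>"] cmod_chr_le_1[OF that(2), of \<xi>] by (simp add: norm_mult)
    then show "AE \<xi> in lborel. norm (exp (- \<epsilon> * rate \<xi>) * cmod (1 - iexp (\<xi> * d) * chr h \<xi>)) \<le> norm (2 * exp (- \<epsilon> * rate \<xi>))"
      by (auto simp: mult.commute[of 2] abs_mult intro!: AE_I2 mult_left_mono)
  qed (use chr_measurable[OF that(2)] in measurable)
  have m_lim: "(\<lambda>n. m \<epsilon> (h n) (d n)) \<longlonglongrightarrow> 0" if \<epsilon>: "0 < \<epsilon>" and h: "\<And>n. 0 \<le> h n" "h \<longlonglongrightarrow> 0" and d: "d \<longlonglongrightarrow> 0" for \<epsilon> h d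
  proof -
    have "(\<lambda>n. m \<epsilon> (h n) (d n)) \<longlonglongrightarrow> (\<integral>\<xi>. 0 \<partial>(lborel :: real measure))"
      unfolding m_def
    proof (rule integral_dominated_convergence[where w="\<lambda>\<xi>. 2 * exp (- \<epsilon> * rate \<xi>)"])
      show "integrable lborel (\<lambda>\<xi>. 2 * exp (- \<epsilon> * rate \<xi>))" using int[OF \<epsilon>] by simp
      show "(\<lambda>\<xi>. exp (- \<epsilon> * rate \<xi>) * cmod (1 - iexp (\<xi> * d n) * chr (h n) \<xi>)) \<in> borel_measurable lborel" for n
        using m_int[OF \<epsilon> h(1)] by (rule borel_measurable_integrable)
      show "AE \<xi> in lborel. (\<lambda>n. exp (- \<epsilon> * rate \<xi>) * cmod (1 - iexp (\<xi> * d n) * chr (h n) \<xi>)) \<longlonglongrightarrow> 0"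
      proof (rule AE_I2)
        fix \<xi>
        have "(\<lambda>n. exp (- \<epsilon> * rate \<xi>) * cmod (1 - iexp (\<xi> * d n) * chr (h n) \<xi>)) \<longlonglongrightarrow> exp (- \<epsilon> * rate \<xi>) * cmod (1 - iexp (\<xi> * 0) * 1)"
          by (intro tendsto_intros chr_tendsto_1 h d)
        then show "(\<lambda>n. exp (- \<epsilon> * rate \<xi>) * cmod (1 - iexp (\<xi> * d n) * chr (h n) \<xi>)) \<longlonglongrightarrow> 0" by simp
      qed
      have "cmod (1 - iexp (\<xi> * d n) * chr (h n) \<xi>) \<le> 2" for \<xi> n
        using norm_triangle_ineq4[of 1 "iexp (\<xi> * d n) * chr (h n) \<xi>"] cmod_chr_le_1[OF h(1), of n \<xi>] by (simp add: norm_mult)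
      then show "AE \<xi> in lborel. norm (exp (- \<epsilon> * rate \<xi>) * cmod (1 - iexp (\<xi> * d n) * chr (h n) \<xi>)) \<le> 2 * exp (- \<epsilon> * rate \<xi>)" for n
        by (auto simp: mult.commute[of 2] abs_mult intro!: AE_I2 mult_left_mono)
    qed simp
    then show ?thesis by simp
  qed
  have modulus: "\<bar>p t x - p t' x'\<bar> \<le> m \<epsilon> (t' - t) (x - x')" if t: "0 < \<epsilon>" "\<epsilon> \<le> t" "t \<le> t'" for \<epsilon> t t' x x'
  proof -
    have t': "0 < t" "0 < t'" "0 \<le> t" "0 \<le> t' - t" using t by auto
    let ?I = "CLBINT \<xi>. iexp (- (\<xi> * x)) * chr t \<xi>" and ?I' = "CLBINT \<xi>. iexp (- (\<xi> * x')) * chr t' \<xi>"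
    have "\<bar>p t x - p t' x'\<bar> = \<bar>Re (?I - ?I')\<bar> / (2 * pi)"
      unfolding formula[OF t'(1)] formula[OF t'(2)] by (simp add: diff_divide_distrib[symmetric] abs_divide)
    also have "\<dots> \<le> \<bar>Re (?I - ?I')\<bar> / 1" using pi_ge_two by (intro divide_left_mono) auto
    also have "\<dots> \<le> cmod (?I - ?I')" using abs_Re_le_cmod[of "?I - ?I'"] by simp
    also have "?I - ?I' = (CLBINT \<xi>. iexp (- (\<xi> * x)) * chr t \<xi> - iexp (- (\<xi> * x')) * chr t' \<xi>)"
      by (rule Bochner_Integration.integral_diff[symmetric]) (rule integrand, fact)+
    also have "cmod \<dots> \<le> (\<integral>\<xi>. cmod (iexp (- (\<xi> * x)) * chr t \<xi> - iexp (- (\<xi> * x')) * chr t' \<xi>) \<partial>lborel)"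
      by (rule integral_norm_bound)
    also have "\<dots> \<le> m \<epsilon> (t' - t) (x - x')"
      unfolding m_def
    proof (rule integral_mono[OF _ m_int[OF t(1) t'(4)]])
      show "integrable lborel (\<lambda>\<xi>. cmod (iexp (- (\<xi> * x)) * chr t \<xi> - iexp (- (\<xi> * x')) * chr t' \<xi>))"
        by (intro integrable_norm Bochner_Integration.integrable_diff integrand t')
      fix \<xi>
      have c: "chr t' \<xi> = chr t \<xi> * chr (t' - t) \<xi>" using chr_add[OF t'(3,4), of \<xi>] by simp
      have e: "iexp (- (\<xi> * x')) = iexp (- (\<xi> * x)) * iexp (\<xi> * (x - x'))" by (simp add: algebra_simps flip: exp_add)
      have "u * v - (u * b) * (v * k) = (u * v) * (1 - b * k)" for u v b k :: complex by (simp add: algebra_simps)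
      then have "cmod (iexp (- (\<xi> * x)) * chr t \<xi> - iexp (- (\<xi> * x')) * chr t' \<xi>)
        = cmod (iexp (- (\<xi> * x)) * chr t \<xi> * (1 - iexp (\<xi> * (x - x')) * chr (t' - t) \<xi>))"
        unfolding c e by (simp only:)
      also have "\<dots> = exp (- t * rate \<xi>) * cmod (1 - iexp (\<xi> * (x - x')) * chr (t' - t) \<xi>)"
        unfolding norm_mult norm_exp_i_times cmod_chr[OF t'(3)] by simp
      also have "\<dots> \<le> exp (- \<epsilon> * rate \<xi>) * cmod (1 - iexp (\<xi> * (x - x')) * chr (t' - t) \<xi>)"
        using t rate_nonneg[of \<xi>] by (intro mult_right_mono) (auto intro: mult_right_mono)
      finally show "cmod (iexp (- (\<xi> * x)) * chr t \<xi> - iexp (- (\<xi> * x')) * chr t' \<xi>)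
        \<le> exp (- \<epsilon> * rate \<xi>) * cmod (1 - iexp (\<xi> * (x - x')) * chr (t' - t) \<xi>)" .
    qed
    finally show ?thesis .
  qed
  have uc: "uniformly_continuous_on ({\<epsilon>..T} \<times> UNIV) (\<lambda>(t, x). p t x)" if \<epsilon>: "0 < \<epsilon>" for \<epsilon> T
    unfolding uniformly_continuous_on_sequentially
  proof (intro allI impI, elim conjE)
    fix u v :: "nat \<Rightarrow> real \<times> real"
    assume u: "\<forall>n. u n \<in> {\<epsilon>..T} \<times> UNIV" and v: "\<forall>n. v n \<in> {\<epsilon>..T} \<times> UNIV" and uv: "(\<lambda>n. dist (u n) (v n)) \<longlonglongrightarrow> 0"
    define h where "h n = \<bar>fst (v n) - fst (u n)\<bar>" for n
    \<comment> \<open>\<open>modulus\<close> requires the earlier time first, so the sign of the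
      space difference follows the order of the times.\<close>
    define d where "d n = (if fst (u n) \<le> fst (v n) then snd (u n) - snd (v n) else snd (v n) - snd (u n))" for n
    have "\<bar>h n\<bar> \<le> dist (u n) (v n)" "\<bar>d n\<bar> \<le> dist (u n) (v n)" for n
      using dist_fst_le[of "u n" "v n"] dist_snd_le[of "u n" "v n"]
      by (auto simp: h_def d_def dist_real_def abs_minus_commute)
    then have h: "h \<longlonglongrightarrow> 0" and d: "d \<longlonglongrightarrow> 0"
      by (auto intro!: Lim_null_comparison[OF _ uv] always_eventually)
    have le: "\<bar>(\<lambda>(t, x). p t x) (u n) - (\<lambda>(t, x). p t x) (v n)\<bar> \<le> m \<epsilon> (h n) (d n)" for n
    proof (cases "fst (u n) \<le> fst (v n)")
      case True
      then show ?thesis using modulus[OF \<epsilon>, of "fst (u n)" "fst (v n)" "snd (u n)" "snd (v n)"] u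
        by (auto simp: h_def d_def case_prod_beta' mem_Times_iff)
    next
      case False
      then show ?thesis using modulus[OF \<epsilon>, of "fst (v n)" "fst (u n)" "snd (v n)" "snd (u n)"] v
        by (auto simp: h_def d_def case_prod_beta' mem_Times_iff abs_minus_commute)
    qed
    show "(\<lambda>n. dist ((\<lambda>(t, x). p t x) (u n)) ((\<lambda>(t, x). p t x) (v n))) \<longlonglongrightarrow> 0"
    proof (rule Lim_null_comparison)
      show "(\<lambda>n. m \<epsilon> (h n) (d n)) \<longlonglongrightarrow> 0" by (rule m_lim[OF \<epsilon> _ h d]) (simp add: h_def)
      show "\<forall>\<^sub>F n in sequentially. norm (dist ((\<lambda>(t, x). p t x) (u n)) ((\<lambda>(t, x). p t x) (v n))) \<le> m \<epsilon> (h n) (d n)"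
        using le by (intro always_eventually allI) (simp add: dist_real_def)
    qed
  qed
  have "continuous_on ({0<..} \<times> UNIV) (\<lambda>(t, x). p t x)"
    by (rule continuous_on_half_plane) (rule uc)
  then have "(\<lambda>(t, x). p t x) \<in> borel_measurable (restrict_space borel ({0<..} \<times> UNIV))"
    by (rule borel_measurable_continuous_on_restrict)
  moreover have "distributed N lborel (X t) (\<lambda>x. ennreal (p t x))" if t: "0 < t" for t
    unfolding distributed_def
  proof (intro conjI)
    show "distr N lborel (X t) = density lborel (\<lambda>x. ennreal (p t x))"
      using dens[OF t] by (simp cong: distr_cong)
    have "p t \<in> borel_measurable borel"
      unfolding p_def by (intro borel_measurable_continuous_onI real_distribution.inverse_char_continuous[OF rd ic]) fact+
    then show "(\<lambda>x. ennreal (p t x)) \<in> borel_measurable lborel" by simp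
    show "X t \<in> N \<rightarrow>\<^sub>M lborel" using X_measurable[of t] t by simp
  qed
  ultimately have "is_transition_density N X p"
    unfolding is_transition_density_def using nonneg uc by blast
  then show ?thesis by blast
qed

end

subsection \<open>The integral equation\<close>

text \<open>The properties of the transition density on which the integral equation rests; the
  process itself no longer appears.\<close>

locale density_kernel =
  fixes p :: "real \<Rightarrow> real \<Rightarrow> real"
  assumes p_cont: "continuous_on ({0<..} \<times> UNIV) (\<lambda>(t, x). p t x)"
    and p_nonneg: "0 < t \<Longrightarrow> 0 \<le> p t x"
    and p_total: "0 < t \<Longrightarrow> (\<integral>\<^sup>+x. ennreal (p t x) \<partial>lborel) = 1"
begin

text \<open>Extension by 0 settles the values at nonpositive times, which are arbitrary in
  \<open>p\<close>, and gives a Borel function on the whole plane.\<close>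

definition q :: "real \<times> real \<Rightarrow> real" where
  "q z = (if 0 < fst z then p (fst z) (snd z) else 0)"

lemma q_measurable [measurable]: "q \<in> borel_measurable borel"
proof -
  have "(\<lambda>(t, x). p t x) \<in> borel_measurable (restrict_space borel ({0<..} \<times> UNIV))"
    by (rule borel_measurable_continuous_on_restrict[OF p_cont])
  then have "(\<lambda>z. indicator ({0<..} \<times> UNIV) z *\<^sub>R (case z of (t, x) \<Rightarrow> p t x)) \<in> borel_measurable borel"
    by (subst (asm) borel_measurable_restrict_space_iff) (auto intro!: borel_open open_Times)
  also have "(\<lambda>z. indicator ({0<..} \<times> UNIV) z *\<^sub>R (case z of (t, x) \<Rightarrow> p t x)) = q"
    by (auto simp: fun_eq_iff q_def indicator_def)
  finally show ?thesis .
qed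

lemma q_measurable_pair [measurable]: "q \<in> borel_measurable (borel \<Otimes>\<^sub>M borel)"
  by (simp add: borel_prod)

lemma q_nonneg: "0 \<le> q z"
  by (simp add: q_def p_nonneg)

lemma q_total: "0 < t \<Longrightarrow> (\<integral>\<^sup>+x. ennreal (q (t, x)) \<partial>lborel) = 1"
  by (simp add: q_def p_total)

lemma q_tendsto:
  assumes "u \<longlonglongrightarrow> z" "0 < fst z"
  shows "(\<lambda>n. q (u n)) \<longlonglongrightarrow> q z"
proof -
  have "isCont (\<lambda>(t, x). p t x) z"
  proof -
    have op: "open ({0<..} \<times> (UNIV :: real set) :: (real \<times> real) set)" by (intro open_Times) auto
    show ?thesis
      by (rule bspec[OF iffD1[OF continuous_on_eq_continuous_at[OF op] p_cont]]) (simp add: mem_Times_iff assms)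
  qed
  then have "(\<lambda>n. (\<lambda>(t, x). p t x) (u n)) \<longlonglongrightarrow> (\<lambda>(t, x). p t x) z"
    using assms(1) by (rule isCont_tendsto_compose)
  moreover have "\<forall>\<^sub>F n in sequentially. 0 < fst (u n)"
    using tendsto_fst[OF assms(1)] assms(2) by (rule order_tendstoD)
  then have "\<forall>\<^sub>F n in sequentially. (\<lambda>(t, x). p t x) (u n) = q (u n)"
    by eventually_elim (simp add: q_def case_prod_beta')
  ultimately show ?thesis
    using assms(2) by (simp add: q_def case_prod_beta' filterlim_cong Lim_transform_eventually)
qed

text \<open>\<open>drift_term\<close> along a single path, with \<open>g\<close> in the place of
  \<open>b\<close> composed with the field.\<close>

definition potential :: "(real \<times> real \<Rightarrow> real) \<Rightarrow> real \<times> real \<Rightarrow> real" where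
  "potential g z = (LINT s:{0..<fst z}|lborel. (LINT y|lborel. g (s, snd z - y) * p (fst z - s) y))"

text \<open>The kernel of \<open>potential\<close> as a function of the source point, after a
  substitution that moves the space shift from the integrand to the density. For \<open>z\<close> at
  time \<open>t \<ge> 0\<close> it has total mass \<open>t\<close>.\<close>

definition past :: "real \<times> real \<Rightarrow> real \<times> real \<Rightarrow> real" where
  "past z = (\<lambda>(s, y). indicator {0..<fst z} s * q (fst z - s, snd z - y))"

lemma past_measurable [measurable]: "past z \<in> borel_measurable (borel \<Otimes>\<^sub>M borel)"
proof -
  have "(\<lambda>v. indicator {0..<fst z} (fst v) * q (fst z - fst v, snd z - snd v)) \<in> borel_measurable (borel \<Otimes>\<^sub>M borel)"
    by measurable
  then show ?thesis by (simp add: past_def case_prod_beta')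
qed

lemma past_nonneg: "0 \<le> past z v"
  by (simp add: past_def q_nonneg case_prod_beta')

lemma past_slice: "(\<integral>\<^sup>+y. ennreal (past z (s, y)) \<partial>lborel) = indicator {0..<fst z} s"
proof (cases "s \<in> {0..<fst z}")
  case True
  have "(\<integral>\<^sup>+y. ennreal (past z (s, y)) \<partial>lborel) = (\<integral>\<^sup>+y. ennreal (q (fst z - s, snd z - y)) \<partial>lborel)"
    using True by (simp add: past_def)
  also have "\<dots> = (\<integral>\<^sup>+y. ennreal (q (fst z - s, y)) \<partial>lborel)"
  proof -
    have [measurable]: "(\<lambda>y. q (fst z - s, y)) \<in> borel_measurable borel"
      by (rule measurable_compose[OF _ q_measurable]) (simp add: borel_prod[symmetric])
    show ?thesis by (subst (2) nn_integral_real_affine[where c="-1" and t="snd z"]) simp_all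
  qed
  also have "\<dots> = 1" using True by (intro q_total) simp
  finally show ?thesis using True by simp
qed (simp add: past_def)

text \<open>The density has mass 1 at each earlier time, so powers of time integrate as on the line.
  Iterated, the divisor \<open>Suc k\<close> produces the factorials of the Picard
  iteration.\<close>

lemma past_moment:
  assumes z: "0 \<le> fst z" and a: "0 \<le> a"
  shows "(\<integral>\<^sup>+v. ennreal (a * fst v ^ k * past z v) \<partial>(lborel \<Otimes>\<^sub>M lborel)) = ennreal (a * (fst z ^ Suc k / real (Suc k)))"
proof -
  have "(\<lambda>v. ennreal (a * fst v ^ k * past z v)) \<in> borel_measurable (lborel \<Otimes>\<^sub>M lborel)" by measurable
  from lborel.nn_integral_fst[OF this]
  have "(\<integral>\<^sup>+v. ennreal (a * fst v ^ k * past z v) \<partial>(lborel \<Otimes>\<^sub>M lborel)) = (\<integral>\<^sup>+s. (\<integral>\<^sup>+y. ennreal (a * s ^ k * past z (s, y)) \<partial>lborel) \<partial>lborel)"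
    by simp
  also have "\<dots> = (\<integral>\<^sup>+s. ennreal (a * s ^ k) * indicator {0..fst z} s \<partial>lborel)"
  proof (rule nn_integral_cong_AE)
    show "AE s in lborel. (\<integral>\<^sup>+y. ennreal (a * s ^ k * past z (s, y)) \<partial>lborel) = ennreal (a * s ^ k) * indicator {0..fst z} s"
      using AE_lborel_singleton[of "fst z"]
    proof eventually_elim
      case (elim s)
      show ?case
      proof (cases "0 \<le> s")
        case True
        have [measurable]: "(\<lambda>y. past z (s, y)) \<in> borel_measurable borel"
          by (rule measurable_compose[OF _ past_measurable]) simp
        have "(\<integral>\<^sup>+y. ennreal (a * s ^ k * past z (s, y)) \<partial>lborel) = (\<integral>\<^sup>+y. ennreal (a * s ^ k) * ennreal (past z (s, y)) \<partial>lborel)"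
          using True a by (intro nn_integral_cong) (simp add: ennreal_mult past_nonneg)
        also have "\<dots> = ennreal (a * s ^ k) * indicator {0..<fst z} s"
          by (subst nn_integral_cmult) (simp_all add: past_slice)
        finally show ?thesis using elim True by (auto simp: indicator_def)
      qed (simp add: past_def)
    qed
  qed
  also have "\<dots> = ennreal (a * (fst z ^ Suc k / real (Suc k)) - a * (0 ^ Suc k / real (Suc k)))"
  proof (rule nn_integral_FTC_Icc)
    show "((\<lambda>s. a * (s ^ Suc k / real (Suc k))) has_real_derivative a * s ^ k) (at s)" for s
      by (rule derivative_eq_intros refl | simp del: of_nat_Suc)+
  qed (use z a in auto)
  finally show ?thesis by simp
qed

lemma past_total: "0 \<le> fst z \<Longrightarrow> (\<integral>\<^sup>+v. ennreal (past z v) \<partial>(lborel \<Otimes>\<^sub>M lborel)) = ennreal (fst z)"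
  using past_moment[of z 1 0] by simp

lemma past_integrable: "0 \<le> fst z \<Longrightarrow> integrable (lborel \<Otimes>\<^sub>M lborel) (past z)"
  using past_total[of z] by (simp add: integrable_iff_bounded past_nonneg)

lemma mult_past_integrable:
  assumes [measurable]: "g \<in> borel_measurable (borel \<Otimes>\<^sub>M borel)" and C: "\<And>v. \<bar>g v\<bar> \<le> C" and z: "0 \<le> fst z"
  shows "integrable (lborel \<Otimes>\<^sub>M lborel) (\<lambda>v. g v * past z v)"
proof (rule Bochner_Integration.integrable_bound)
  show "integrable (lborel \<Otimes>\<^sub>M lborel) (\<lambda>v. C * past z v)" using past_integrable[OF z] by simp
  have "\<bar>g v\<bar> * past z v \<le> \<bar>C\<bar> * past z v" for v using C[of v] past_nonneg by (intro mult_right_mono) auto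
  then show "AE v in lborel \<Otimes>\<^sub>M lborel. norm (g v * past z v) \<le> norm (C * past z v)"
    by (intro AE_I2) (simp add: abs_mult past_nonneg)
qed measurable

text \<open>Turns the iterated integral into one integral against a fixed integrable kernel, to
  which dominated convergence and Scheffe's lemma apply.\<close>

lemma potential_eq:
  assumes g[measurable]: "g \<in> borel_measurable (borel \<Otimes>\<^sub>M borel)" and C: "\<And>v. \<bar>g v\<bar> \<le> C" and z: "0 \<le> fst z"
  shows "potential g z = (\<integral>v. g v * past z v \<partial>(lborel \<Otimes>\<^sub>M lborel))"
proof -
  have "potential g z = (\<integral>s. (\<integral>y. g (s, y) * past z (s, y) \<partial>lborel) \<partial>lborel)"
    unfolding potential_def set_lebesgue_integral_def
  proof (intro Bochner_Integration.integral_cong refl)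
    fix s
    show "indicator {0..<fst z} s *\<^sub>R (\<integral>y. g (s, snd z - y) * p (fst z - s) y \<partial>lborel) = (\<integral>y. g (s, y) * past z (s, y) \<partial>lborel)"
    proof (cases "s \<in> {0..<fst z}")
      case True
      have "(\<integral>y. g (s, y) * past z (s, y) \<partial>lborel) = \<bar>-1\<bar> *\<^sub>R (\<integral>y. g (s, snd z + -1 * y) * past z (s, snd z + -1 * y) \<partial>lborel)"
        by (rule lborel_integral_real_affine) simp
      then show ?thesis using True by (simp add: past_def q_def)
    qed (simp add: past_def)
  qed
  also have "\<dots> = (\<integral>v. g v * past z v \<partial>(lborel \<Otimes>\<^sub>M lborel))"
    by (rule lborel_pair.integral_fst'[OF mult_past_integrable[OF g C z]])
  finally show ?thesis .
qed

lemma potential_bound: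
  assumes g: "g \<in> borel_measurable (borel \<Otimes>\<^sub>M borel)" and C: "\<And>v. \<bar>g v\<bar> \<le> C" and z: "0 \<le> fst z"
  shows "\<bar>potential g z\<bar> \<le> C * fst z"
proof -
  have "\<bar>potential g z\<bar> \<le> (\<integral>v. C * past z v \<partial>(lborel \<Otimes>\<^sub>M lborel))"
    unfolding potential_eq[OF assms]
  proof (rule abs_integral_le)
    show "\<bar>g v * past z v\<bar> \<le> C * past z v" for v
      unfolding abs_mult using C[of v] past_nonneg[of z v] by (simp add: mult_right_mono)
  qed (use past_integrable[OF z] in simp)
  also have "\<dots> = C * fst z"
  proof -
    have "(\<integral>v. past z v \<partial>(lborel \<Otimes>\<^sub>M lborel)) = fst z"
      using past_total[OF z] z by (subst integral_eq_nn_integral) (auto simp: past_nonneg)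
    then show ?thesis by simp
  qed
  finally show ?thesis .
qed

text \<open>By Scheffe's lemma the kernels \<open>past z\<close> depend continuously on \<open>z\<close> in the space of
  integrable functions.\<close>

lemma potential_continuous:
  assumes g: "g \<in> borel_measurable (borel \<Otimes>\<^sub>M borel)" and C: "\<And>v. \<bar>g v\<bar> \<le> C"
  shows "continuous_on ({0..} \<times> UNIV) (potential g)"
  unfolding continuous_on_sequentially
proof (intro ballI allI impI, elim conjE)
  fix z and u :: "nat \<Rightarrow> real \<times> real"
  assume z: "z \<in> {0..} \<times> UNIV" and u: "\<forall>n. u n \<in> {0..} \<times> UNIV" and lim: "u \<longlonglongrightarrow> z"
  have z0: "0 \<le> fst z" and u0: "0 \<le> fst (u n)" for n using z u by (auto simp: mem_Times_iff)
  note flim = tendsto_fst[OF lim] and slim = tendsto_snd[OF lim]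
  let ?L = "lborel \<Otimes>\<^sub>M lborel :: (real \<times> real) measure"
  have pw: "(\<lambda>n. past (u n) v) \<longlonglongrightarrow> past z v" if "fst v \<noteq> fst z" for v
  proof (cases "fst v < fst z")
    case True
    have "(\<lambda>n. q (fst (u n) - fst v, snd (u n) - snd v)) \<longlonglongrightarrow> q (fst z - fst v, snd z - snd v)"
      using True by (intro q_tendsto tendsto_intros flim slim) simp
    then have l: "(\<lambda>n. indicator {0..} (fst v) * q (fst (u n) - fst v, snd (u n) - snd v)) \<longlonglongrightarrow> indicator {0..} (fst v) * q (fst z - fst v, snd z - snd v)"
      by (intro tendsto_intros)
    have "\<forall>\<^sub>F n in sequentially. fst v < fst (u n)" using flim True by (rule order_tendstoD)
    then have "\<forall>\<^sub>F n in sequentially. indicator {0..} (fst v) * q (fst (u n) - fst v, snd (u n) - snd v) = past (u n) v"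
      by eventually_elim (auto simp: past_def case_prod_beta' indicator_def)
    from Lim_transform_eventually[OF l this] show ?thesis
      using True by (auto simp: past_def case_prod_beta' indicator_def split: if_splits)
  next
    case False
    then have "fst z < fst v" using that by simp
    have "\<forall>\<^sub>F n in sequentially. fst (u n) < fst v" using flim \<open>fst z < fst v\<close> by (rule order_tendstoD)
    then have "\<forall>\<^sub>F n in sequentially. 0 = past (u n) v"
      by eventually_elim (auto simp: past_def case_prod_beta' indicator_def)
    from Lim_transform_eventually[OF tendsto_const this] show ?thesis
      using \<open>fst z < fst v\<close> by (auto simp: past_def case_prod_beta' indicator_def)
  qed
  have "(\<lambda>n. \<integral>\<^sup>+v. norm (past (u n) v - past z v) \<partial>?L) \<longlonglongrightarrow> 0"
  proof (rule Scheffe_lemma1)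
    show "integrable ?L (past (u n))" for n by (rule past_integrable[OF u0])
    show "integrable ?L (past z)" by (rule past_integrable[OF z0])
    show "AE v in ?L. (\<lambda>n. past (u n) v) \<longlonglongrightarrow> past z v"
    proof (rule AE_I'[where N="{fst z} \<times> UNIV"])
      have "emeasure ?L ({fst z} \<times> UNIV) = emeasure lborel {fst z} * emeasure (lborel :: real measure) UNIV"
        by (intro lborel.emeasure_pair_measure_Times) auto
      then show "{fst z} \<times> UNIV \<in> null_sets ?L" by (intro null_setsI) auto
      show "{v \<in> space ?L. \<not> (\<lambda>n. past (u n) v) \<longlonglongrightarrow> past z v} \<subseteq> {fst z} \<times> UNIV"
      proof
        fix v assume "v \<in> {v \<in> space ?L. \<not> (\<lambda>n. past (u n) v) \<longlonglongrightarrow> past z v}"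
        then have "fst v = fst z" using pw[of v] by blast
        then show "v \<in> {fst z} \<times> UNIV" by (simp add: mem_Times_iff)
      qed
    qed
    \<comment> \<open>Scheffe's lemma asks for convergence of the total masses. These are the times,
      so it is convergence of the first coordinates.\<close>
    have "(\<lambda>n. ennreal (fst (u n))) \<longlonglongrightarrow> ennreal (fst z)" by (intro tendsto_ennrealI flim)
    then have "limsup (\<lambda>n. ennreal (fst (u n))) = ennreal (fst z)" by (intro lim_imp_Limsup) simp_all
    then show "limsup (\<lambda>n. \<integral>\<^sup>+v. norm (past (u n) v) \<partial>?L) \<le> (\<integral>\<^sup>+v. norm (past z v) \<partial>?L)"
      by (simp add: past_nonneg past_total u0 z0)
  qed
  moreover have "(\<integral>\<^sup>+v. norm (past (u n) v - past z v) \<partial>?L) = ennreal (\<integral>v. norm (past (u n) v - past z v) \<partial>?L)" for n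
    by (intro nn_integral_eq_integral integrable_norm Bochner_Integration.integrable_diff past_integrable u0 z0) simp
  ultimately have "(\<lambda>n. ennreal (\<integral>v. norm (past (u n) v - past z v) \<partial>?L)) \<longlonglongrightarrow> ennreal 0" by simp
  then have "(\<lambda>n. \<integral>v. norm (past (u n) v - past z v) \<partial>?L) \<longlonglongrightarrow> 0"
    by (subst (asm) tendsto_ennreal_iff) auto
  then have lim0: "(\<lambda>n. C * (\<integral>v. norm (past (u n) v - past z v) \<partial>?L)) \<longlonglongrightarrow> 0"
    by (rule tendsto_mult_right_zero)
  have "(\<lambda>n. potential g (u n) - potential g z) \<longlonglongrightarrow> 0"
  proof (rule Lim_null_comparison[OF _ lim0], intro always_eventually allI)
    fix n
    have "potential g (u n) - potential g z = (\<integral>v. g v * past (u n) v - g v * past z v \<partial>?L)"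
      unfolding potential_eq[OF g C u0] potential_eq[OF g C z0]
      by (rule Bochner_Integration.integral_diff[symmetric]) (intro mult_past_integrable[OF g C] u0 z0)+
    also have "norm \<dots> \<le> (\<integral>v. C * norm (past (u n) v - past z v) \<partial>?L)"
      unfolding real_norm_def[of "integral\<^sup>L _ _"]
    proof (rule abs_integral_le)
      show "integrable ?L (\<lambda>v. C * norm (past (u n) v - past z v))"
        by (intro integrable_mult_right integrable_norm Bochner_Integration.integrable_diff past_integrable u0 z0)
      show "\<bar>g v * past (u n) v - g v * past z v\<bar> \<le> C * norm (past (u n) v - past z v)" for v
        using C[of v] by (simp add: mult_right_mono abs_mult flip: right_diff_distrib)
    qed
    finally show "norm (potential g (u n) - potential g z) \<le> C * (\<integral>v. norm (past (u n) v - past z v) \<partial>?L)" by simp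
  qed
  then show "(potential g \<circ> u) \<longlonglongrightarrow> potential g z" unfolding o_def by (rule LIM_zero_cancel)
qed

text \<open>With \<open>q\<close> in place of \<open>p\<close> and the time restriction as a
  conditional, the integrand is jointly measurable in all variables, and measurability passes
  through both integrals.\<close>

lemma potential_measurable:
  assumes g: "g \<in> borel_measurable ((borel \<Otimes>\<^sub>M borel) \<Otimes>\<^sub>M M)"
  shows "(\<lambda>v. potential (\<lambda>z. g (z, snd v)) (fst v)) \<in> borel_measurable ((borel \<Otimes>\<^sub>M borel) \<Otimes>\<^sub>M M)"
proof -
  let ?P = "(borel \<Otimes>\<^sub>M borel) \<Otimes>\<^sub>M M :: ((real \<times> real) \<times> _) measure"
  have eq: "potential (\<lambda>z. g (z, snd v)) (fst v) =
      (\<integral>s. (\<integral>y. (if 0 \<le> s \<and> s < fst (fst v) then g ((s, snd (fst v) - y), snd v) * q (fst (fst v) - s, y) else 0) \<partial>lborel) \<partial>lborel)" for v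
    unfolding potential_def set_lebesgue_integral_def
    by (intro Bochner_Integration.integral_cong refl) (auto simp: indicator_def q_def)
  note [measurable] = g
  have "(\<lambda>v. \<integral>s. (\<integral>y. (if 0 \<le> s \<and> s < fst (fst v) then g ((s, snd (fst v) - y), snd v) * q (fst (fst v) - s, y) else 0) \<partial>lborel) \<partial>lborel)
     \<in> borel_measurable ?P"
    by measurable
  then show ?thesis by (simp add: eq)
qed

text \<open>The gain of a Volterra operator: a bound by \<open>s ^ k\<close> is raised to the next
  power of time and divided by \<open>Suc k\<close>.\<close>

lemma potential_diff_le:
  assumes g: "g \<in> borel_measurable (borel \<Otimes>\<^sub>M borel)" "\<And>v. \<bar>g v\<bar> \<le> C"
    and g': "g' \<in> borel_measurable (borel \<Otimes>\<^sub>M borel)" "\<And>v. \<bar>g' v\<bar> \<le> C"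
    and le: "\<And>s y. 0 \<le> s \<Longrightarrow> \<bar>g (s, y) - g' (s, y)\<bar> \<le> a * s ^ k" and z: "0 \<le> fst z"
  shows "\<bar>potential g z - potential g' z\<bar> \<le> a * fst z ^ Suc k / real (Suc k)"
proof -
  note [measurable] = g(1) g'(1)
  let ?L = "lborel \<Otimes>\<^sub>M lborel :: (real \<times> real) measure"
  have a0: "0 \<le> a" using le[of 1 0] by simp
  have pw: "\<bar>g v * past z v - g' v * past z v\<bar> \<le> \<bar>a * fst v ^ k * past z v\<bar>" for v
  proof (cases "0 \<le> fst v")
    case True
    have "\<bar>g v - g' v\<bar> * past z v \<le> a * fst v ^ k * past z v"
      using le[OF True, of "snd v"] past_nonneg by (intro mult_right_mono) auto
    moreover have "\<bar>a * fst v ^ k * past z v\<bar> = a * fst v ^ k * past z v"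
      using a0 True past_nonneg[of z v] by (intro abs_of_nonneg mult_nonneg_nonneg) auto
    moreover have "\<bar>g v * past z v - g' v * past z v\<bar> = \<bar>g v - g' v\<bar> * past z v"
      using past_nonneg[of z v] by (simp add: abs_mult flip: left_diff_distrib)
    ultimately show ?thesis by simp
  qed (simp add: past_def case_prod_beta')
  have nn: "(\<integral>\<^sup>+v. ennreal \<bar>a * fst v ^ k * past z v\<bar> \<partial>?L) = ennreal (a * (fst z ^ Suc k / real (Suc k)))"
  proof -
    have "\<bar>a * fst v ^ k * past z v\<bar> = a * fst v ^ k * past z v" for v
    proof (cases "0 \<le> fst v")
      case True
      then show ?thesis using a0 past_nonneg[of z v] by (intro abs_of_nonneg mult_nonneg_nonneg) auto
    qed (simp add: past_def case_prod_beta')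
    then show ?thesis using past_moment[OF z a0, of k] by simp
  qed
  have int: "integrable ?L (\<lambda>v. \<bar>a * fst v ^ k * past z v\<bar>)"
    unfolding integrable_iff_bounded using nn by simp
  have "\<bar>potential g z - potential g' z\<bar> = \<bar>\<integral>v. g v * past z v - g' v * past z v \<partial>?L\<bar>"
    unfolding potential_eq[OF g z] potential_eq[OF g' z]
    by (subst Bochner_Integration.integral_diff[OF mult_past_integrable[OF g z] mult_past_integrable[OF g' z]]) (rule refl)
  also have "\<dots> \<le> (\<integral>v. \<bar>a * fst v ^ k * past z v\<bar> \<partial>?L)"
    by (rule abs_integral_le[OF int pw])
  also have "\<dots> = a * (fst z ^ Suc k / real (Suc k))"
    by (subst integral_eq_nn_integral) (use nn a0 z in auto)
  finally show ?thesis by simp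
qed

end

section \<open>Picard iteration along a fixed path\<close>

locale lipschitz_drift = density_kernel +
  fixes b :: "real \<Rightarrow> real" and B L :: real
  assumes b_bound: "\<And>r. \<bar>b r\<bar> \<le> B" and b_lipschitz: "L-lipschitz_on UNIV b"
begin

lemma b_measurable [measurable]: "b \<in> borel_measurable borel"
  using b_lipschitz by (intro borel_measurable_continuous_onI lipschitz_on_continuous_on)

text \<open>Iterates the drift part alone, with the path \<open>h\<close> as data: \<open>h\<close>
  is only measurable, whereas potentials of bounded functions are bounded on bounded times. The
  probability parameter is an argument, so that every iterate is jointly measurable.\<close>

primrec picard :: "((real \<times> real) \<times> 'a \<Rightarrow> real) \<Rightarrow> nat \<Rightarrow> (real \<times> real) \<times> 'a \<Rightarrow> real" where
  "picard h 0 = (\<lambda>_. 0)"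
| "picard h (Suc n) = (\<lambda>u. potential (\<lambda>z. b (h (z, snd u) + picard h n (z, snd u))) (fst u))"

lemma picard_measurable:
  assumes h[measurable]: "h \<in> borel_measurable ((borel \<Otimes>\<^sub>M borel) \<Otimes>\<^sub>M M)"
  shows "picard h n \<in> borel_measurable ((borel \<Otimes>\<^sub>M borel) \<Otimes>\<^sub>M M)"
proof (induction n)
  case (Suc n)
  note [measurable] = Suc.IH
  have "(\<lambda>u. b (h u + picard h n u)) \<in> borel_measurable ((borel \<Otimes>\<^sub>M borel) \<Otimes>\<^sub>M M)" by measurable
  from potential_measurable[OF this] show ?case by simp
qed simp

lemma slice_measurable:
  assumes "f \<in> borel_measurable ((borel \<Otimes>\<^sub>M borel) \<Otimes>\<^sub>M M)" "\<omega> \<in> space M"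
  shows "(\<lambda>z. f (z, \<omega>)) \<in> borel_measurable (borel \<Otimes>\<^sub>M borel)"
  by (rule measurable_compose[OF _ assms(1)]) (use assms(2) in simp)

text \<open>The first iterate is bounded by \<open>B\<close> times the time. Each further one
  contributes a factor \<open>L\<close> from the drift and, by \<open>potential_diff_le\<close>, one
  power of time over the next integer.\<close>

lemma picard_increment_le:
  assumes h: "h \<in> borel_measurable ((borel \<Otimes>\<^sub>M borel) \<Otimes>\<^sub>M M)" and \<omega>: "\<omega> \<in> space M" and z: "0 \<le> fst z"
  shows "\<bar>picard h (Suc n) (z, \<omega>) - picard h n (z, \<omega>)\<bar> \<le> B * L ^ n * fst z ^ Suc n / fact (Suc n)"
  using z
proof (induction n arbitrary: z)
  case 0
  have [measurable]: "(\<lambda>z. h (z, \<omega>)) \<in> borel_measurable (borel \<Otimes>\<^sub>M borel)" by (rule slice_measurable[OF h \<omega>])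
  have "\<bar>potential (\<lambda>z. b (h (z, \<omega>) + 0)) z\<bar> \<le> B * fst z"
    by (rule potential_bound[OF _ _ 0]) (simp_all add: b_bound)
  then show ?case by simp
next
  case (Suc n)
  note [measurable] = slice_measurable[OF h \<omega>] slice_measurable[OF picard_measurable[OF h] \<omega>]
  have "\<bar>picard h (Suc (Suc n)) (z, \<omega>) - picard h (Suc n) (z, \<omega>)\<bar>
      = \<bar>potential (\<lambda>z. b (h (z, \<omega>) + picard h (Suc n) (z, \<omega>))) z - potential (\<lambda>z. b (h (z, \<omega>) + picard h n (z, \<omega>))) z\<bar>"
    by simp
  also have "\<dots> \<le> (L * (B * L ^ n / fact (Suc n))) * fst z ^ Suc (Suc n) / real (Suc (Suc n))"
  proof (rule potential_diff_le[where C=B])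
    fix s y :: real assume s: "0 \<le> s"
    have "\<bar>b (h ((s, y), \<omega>) + picard h (Suc n) ((s, y), \<omega>)) - b (h ((s, y), \<omega>) + picard h n ((s, y), \<omega>))\<bar>
        \<le> L * \<bar>picard h (Suc n) ((s, y), \<omega>) - picard h n ((s, y), \<omega>)\<bar>"
      using lipschitz_onD[OF b_lipschitz, of "h ((s, y), \<omega>) + picard h (Suc n) ((s, y), \<omega>)" "h ((s, y), \<omega>) + picard h n ((s, y), \<omega>)"]
      by (simp add: dist_real_def del: picard.simps)
    also have "\<dots> \<le> L * (B * L ^ n * s ^ Suc n / fact (Suc n))"
      using Suc.IH[of "(s, y)"] s lipschitz_on_nonneg[OF b_lipschitz] by (intro mult_left_mono) auto
    finally show "\<bar>b (h ((s, y), \<omega>) + picard h (Suc n) ((s, y), \<omega>)) - b (h ((s, y), \<omega>) + picard h n ((s, y), \<omega>))\<bar>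
        \<le> (L * (B * L ^ n / fact (Suc n))) * s ^ Suc n" by simp
  next
    show "(\<lambda>z. b (h (z, \<omega>) + picard h (Suc n) (z, \<omega>))) \<in> borel_measurable (borel \<Otimes>\<^sub>M borel)"
      by (intro measurable_compose[OF _ b_measurable] borel_measurable_add slice_measurable[OF h \<omega>] slice_measurable[OF picard_measurable[OF h] \<omega>])
    show "(\<lambda>z. b (h (z, \<omega>) + picard h n (z, \<omega>))) \<in> borel_measurable (borel \<Otimes>\<^sub>M borel)"
      by (intro measurable_compose[OF _ b_measurable] borel_measurable_add slice_measurable[OF h \<omega>] slice_measurable[OF picard_measurable[OF h] \<omega>])
  qed (use b_bound Suc.prems in auto)
  also have "\<dots> = B * L ^ Suc n * fst z ^ Suc (Suc n) / fact (Suc (Suc n))"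
    by (simp add: field_simps)
  finally show ?case .
qed

lemma picard_convergent:
  assumes h: "h \<in> borel_measurable ((borel \<Otimes>\<^sub>M borel) \<Otimes>\<^sub>M M)" and \<omega>: "\<omega> \<in> space M"
  shows "convergent (\<lambda>n. picard h n (z, \<omega>))"
proof (cases "0 \<le> fst z")
  case True
  let ?d = "\<lambda>n. picard h (Suc n) (z, \<omega>) - picard h n (z, \<omega>)"
  have L0: "0 \<le> L" by (rule lipschitz_on_nonneg[OF b_lipschitz])
  have B0: "0 \<le> B" using b_bound[of 0] by linarith
  have "norm (?d n) \<le> B * fst z * ((L * fst z) ^ n /\<^sub>R fact n)" for n
  proof -
    have "norm (?d n) \<le> B * L ^ n * fst z ^ Suc n / fact (Suc n)"
      unfolding real_norm_def by (rule picard_increment_le[OF h \<omega> True])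
    also have "\<dots> \<le> B * L ^ n * fst z ^ Suc n / fact n"
      using B0 L0 True by (intro divide_left_mono fact_mono) auto
    also have "\<dots> = B * fst z * ((L * fst z) ^ n /\<^sub>R fact n)"
      by (simp add: power_mult_distrib field_simps)
    finally show ?thesis .
  qed
  then have "summable ?d"
    by (intro summable_comparison_test[of ?d "\<lambda>n. B * fst z * ((L * fst z) ^ n /\<^sub>R fact n)"] summable_mult summable_exp_generic) auto
  then have "convergent (\<lambda>n. \<Sum>k<n. ?d k)" by (simp add: summable_iff_convergent)
  moreover have "(\<Sum>k<n. ?d k) = picard h n (z, \<omega>)" for n by (induction n) auto
  ultimately show ?thesis by (simp del: picard.simps)
next
  case False
  \<comment> \<open>At negative times the interval of integration is empty, so all iterates
    vanish.\<close>
  have "picard h n (z, \<omega>) = 0" for n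
    using False by (cases n) (simp_all add: potential_def set_lebesgue_integral_def)
  then show ?thesis by (simp add: convergent_const)
qed

text \<open>The increments are dominated by an exponential series, so the iterates converge at every
  point of every path. Continuity of \<open>b\<close> and dominated convergence, with
  \<open>B\<close> times the kernel, carry the recursion to the limit.\<close>

lemma picard_solution:
  assumes h: "h \<in> borel_measurable ((borel \<Otimes>\<^sub>M borel) \<Otimes>\<^sub>M M)"
  shows "\<exists>u. u \<in> borel_measurable ((borel \<Otimes>\<^sub>M borel) \<Otimes>\<^sub>M M) \<and>
    (\<forall>\<omega>\<in>space M. \<forall>z. 0 \<le> fst z \<longrightarrow> u (z, \<omega>) = potential (\<lambda>v. b (h (v, \<omega>) + u (v, \<omega>))) z)"
proof (intro exI conjI ballI allI impI)
  let ?u = "\<lambda>v. lim (\<lambda>n. picard h n v)"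
  show um: "?u \<in> borel_measurable ((borel \<Otimes>\<^sub>M borel) \<Otimes>\<^sub>M M)"
    by (rule borel_measurable_lim_metric) (rule picard_measurable[OF h])
  fix \<omega> and z :: "real \<times> real" assume \<omega>: "\<omega> \<in> space M" and z: "0 \<le> fst z"
  let ?L = "lborel \<Otimes>\<^sub>M lborel :: (real \<times> real) measure"
  note ms = measurable_compose[OF _ b_measurable] borel_measurable_add slice_measurable[OF h \<omega>]
    slice_measurable[OF picard_measurable[OF h] \<omega>] slice_measurable[OF um \<omega>]
  have lim: "(\<lambda>n. picard h n (v, \<omega>)) \<longlonglongrightarrow> ?u (v, \<omega>)" for v
    using picard_convergent[OF h \<omega>] by (simp add: convergent_LIMSEQ_iff)
  have gm: "(\<lambda>v. b (h (v, \<omega>) + picard h n (v, \<omega>))) \<in> borel_measurable (borel \<Otimes>\<^sub>M borel)" for n by (intro ms)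
  have gm': "(\<lambda>v. b (h (v, \<omega>) + ?u (v, \<omega>))) \<in> borel_measurable (borel \<Otimes>\<^sub>M borel)" by (intro ms)
  have "(\<lambda>n. potential (\<lambda>v. b (h (v, \<omega>) + picard h n (v, \<omega>))) z) \<longlonglongrightarrow> potential (\<lambda>v. b (h (v, \<omega>) + ?u (v, \<omega>))) z"
    unfolding potential_eq[OF gm b_bound z] potential_eq[OF gm' b_bound z]
  proof (rule integral_dominated_convergence[where w="\<lambda>v. B * past z v"])
    show "integrable ?L (\<lambda>v. B * past z v)" using past_integrable[OF z] by simp
    show "AE v in ?L. (\<lambda>n. b (h (v, \<omega>) + picard h n (v, \<omega>)) * past z v) \<longlonglongrightarrow> b (h (v, \<omega>) + ?u (v, \<omega>)) * past z v"
    proof (intro AE_I2 tendsto_intros)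
      fix v
      have "isCont b r" for r
        using lipschitz_on_continuous_on[OF b_lipschitz] by (simp add: continuous_on_eq_continuous_at)
      then show "(\<lambda>n. b (h (v, \<omega>) + picard h n (v, \<omega>))) \<longlonglongrightarrow> b (h (v, \<omega>) + ?u (v, \<omega>))"
        by (rule isCont_tendsto_compose) (intro tendsto_intros lim)
    qed
    show "AE v in ?L. norm (b (h (v, \<omega>) + picard h n (v, \<omega>)) * past z v) \<le> B * past z v" for n
      using b_bound past_nonneg by (intro AE_I2) (simp add: abs_mult mult_right_mono)
    show "(\<lambda>v. b (h (v, \<omega>) + picard h n (v, \<omega>)) * past z v) \<in> borel_measurable ?L" for n
      using mult_past_integrable[OF gm b_bound z] by (rule borel_measurable_integrable)
    show "(\<lambda>v. b (h (v, \<omega>) + ?u (v, \<omega>)) * past z v) \<in> borel_measurable ?L"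
      using mult_past_integrable[OF gm' b_bound z] by (rule borel_measurable_integrable)
  qed
  then have "(\<lambda>n. picard h (Suc n) (z, \<omega>)) \<longlonglongrightarrow> potential (\<lambda>v. b (h (v, \<omega>) + ?u (v, \<omega>))) z" by simp
  moreover have "(\<lambda>n. picard h (Suc n) (z, \<omega>)) \<longlonglongrightarrow> ?u (z, \<omega>)" by (rule LIMSEQ_Suc[OF lim])
  ultimately show "?u (z, \<omega>) = potential (\<lambda>v. b (h (v, \<omega>) + ?u (v, \<omega>))) z"
    by (rule LIMSEQ_unique[symmetric])
qed

end

section \<open>Moduli, integrability and path moments for the random field\<close>

context heat
begin

text \<open>Turns the sequential limit into the modulus of continuity that
  \<open>jointly_measurable_modification\<close> asks for: a failure at every scale 1 / n would give
  sequences contradicting it.\<close>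

lemma increment_energy_small:
  assumes fin: "total_weight T < \<infinity>" and T: "0 < T" and e: "0 < e"
  shows "\<exists>\<delta>>0. \<forall>h d. 0 \<le> h \<longrightarrow> h < \<delta> \<longrightarrow> \<bar>d\<bar> < \<delta> \<longrightarrow> increment_energy T h d < e"
proof (rule ccontr)
  assume "\<not> ?thesis"
  then have "\<exists>h d. 0 \<le> h \<and> h < inverse (real (Suc n)) \<and> \<bar>d\<bar> < inverse (real (Suc n)) \<and> \<not> increment_energy T h d < e" for n
    using inverse_positive_iff_positive[of "real (Suc n)"] by (meson of_nat_0_less_iff zero_less_Suc)
  then obtain h d where h: "\<And>n. 0 \<le> h n" "\<And>n. h n < inverse (real (Suc n))"
    and d: "\<And>n. \<bar>d n\<bar> < inverse (real (Suc n))" and big: "\<And>n. \<not> increment_energy T (h n) (d n) < e" by metis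
  have "h \<longlonglongrightarrow> 0"
    by (rule Lim_null_comparison[OF _ LIMSEQ_inverse_real_of_nat])
      (intro always_eventually allI, simp add: h(1) less_imp_le[OF h(2)] del: of_nat_Suc)
  moreover have "d \<longlonglongrightarrow> 0"
    by (rule Lim_null_comparison[OF _ LIMSEQ_inverse_real_of_nat])
      (intro always_eventually allI, simp add: less_imp_le[OF d] del: of_nat_Suc)
  ultimately have "(\<lambda>n. increment_energy T (h n) (d n)) \<longlonglongrightarrow> 0"
    by (intro increment_energy_tendsto_0[OF fin T h(1)])
  then have "\<forall>\<^sub>F n in sequentially. increment_energy T (h n) (d n) < e" using e by (rule order_tendstoD)
  then show False using big by (simp add: eventually_sequentially)
qed

text \<open>The weight at time \<open>t / 2\<close> dominates a multiple of
  \<open>exp (- t * rate)\<close>, because its exponent carries a factor 2.\<close>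

lemma exp_rate_integrable:
  assumes fin: "total_weight (t / 2) < \<infinity>" and t: "0 < t"
  shows "integrable lborel (\<lambda>\<xi>. exp (- t * L.rate \<xi>))"
proof -
  have "ennreal (t / 2) * (\<integral>\<^sup>+\<xi>. ennreal (exp (- t * L.rate \<xi>)) \<partial>lborel) = (\<integral>\<^sup>+\<xi>. ennreal (t / 2) * ennreal (exp (- t * L.rate \<xi>)) \<partial>lborel)"
    by (rule nn_integral_cmult[symmetric]) measurable
  also have "\<dots> \<le> total_weight (t / 2)"
    unfolding total_weight_def
  proof (intro nn_integral_mono)
    fix \<xi>
    show "ennreal (t / 2) * ennreal (exp (- t * L.rate \<xi>)) \<le> L.weight (t / 2) \<xi>"
      using L.weight_ge[of "t / 2" \<xi>] t by simp
  qed
  also have "\<dots> < \<infinity>" by (rule fin)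
  finally have "(\<integral>\<^sup>+\<xi>. ennreal (exp (- t * L.rate \<xi>)) \<partial>lborel) < \<infinity>"
    using t by (auto simp: ennreal_mult_less_top)
  then show ?thesis unfolding integrable_iff_bounded by simp
qed

text \<open>The moments are bounded uniformly over a box, so their integral over the box is finite.
  Fubini's theorem needs the joint measurability of the modification; countably many boxes and
  powers share one null set.\<close>

lemma modification_even_moments_finite:
  assumes Z[measurable]: "Z \<in> borel_measurable ((borel \<Otimes>\<^sub>M borel) \<Otimes>\<^sub>M M)"
    and ext: "\<And>t x. 0 \<le> t \<Longrightarrow> weak_solution_extension N X M w t (dirac x) (H t x)"
    and eq: "\<And>t x. 0 \<le> t \<Longrightarrow> AE \<omega> in M. Z ((t, x), \<omega>) = H t x \<omega>"
  shows "AE \<omega> in M. \<forall>n k. (\<integral>\<^sup>+z. indicator (time_box n) z * ennreal (Z (z, \<omega>) ^ (2 * k)) \<partial>lborel) < \<infinity>"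
  unfolding AE_all_countable
proof (intro allI)
  fix n k
  have [measurable]: "Z \<in> borel_measurable (borel \<Otimes>\<^sub>M M)" using Z by (simp add: borel_prod)
  interpret Q: pair_sigma_finite "lborel :: (real \<times> real) measure" M ..
  define C where "C = ennreal (gaussian_moment k) * (2 * (2 + 64 * total_weight (real n)) + 2) ^ k"
  have "total_weight (real n) < \<infinity>" by (rule total_weight_finite[OF _ ext[of "real n" 0]]) simp_all
  then have "C < \<infinity>" unfolding C_def by (simp add: ennreal_mult_less_top power_less_top_ennreal)
  have slice: "(\<integral>\<^sup>+\<omega>. ennreal (Z (z, \<omega>) ^ (2 * k)) \<partial>M) \<le> C" if z: "z \<in> time_box n" for z
  proof -
    obtain t x where tx: "z = (t, x)" by (cases z)
    have t: "0 \<le> t" "t \<le> real n" using z tx by (auto simp: time_box_def)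
    have "(\<integral>\<^sup>+\<omega>. ennreal (Z (z, \<omega>) ^ (2 * k)) \<partial>M) = (\<integral>\<^sup>+\<omega>. ennreal (H t x \<omega> ^ (2 * k)) \<partial>M)"
    proof (rule nn_integral_cong_AE)
      show "AE \<omega> in M. ennreal (Z (z, \<omega>) ^ (2 * k)) = ennreal (H t x \<omega> ^ (2 * k))"
        using eq[OF t(1), of x] by eventually_elim (simp add: tx)
    qed
    also have "\<dots> \<le> ennreal (gaussian_moment k) * (2 * (2 + 64 * total_weight t) + 2) ^ k"
      by (rule extension_moment_le[OF t(1) ext[OF t(1)]])
    also have "\<dots> \<le> C"
      unfolding C_def by (intro mult_left_mono power_mono add_right_mono add_left_mono total_weight_mono t) auto
    finally show ?thesis .
  qed
  have "(\<integral>\<^sup>+\<omega>. (\<integral>\<^sup>+z. indicator (time_box n) z * ennreal (Z (z, \<omega>) ^ (2 * k)) \<partial>lborel) \<partial>M)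
      = (\<integral>\<^sup>+z. (\<integral>\<^sup>+\<omega>. indicator (time_box n) z * ennreal (Z (z, \<omega>) ^ (2 * k)) \<partial>M) \<partial>lborel)"
    by (rule Q.Fubini') measurable
  also have "\<dots> \<le> (\<integral>\<^sup>+z. C * indicator (time_box n) z \<partial>lborel)"
  proof (intro nn_integral_mono)
    fix z
    have "(\<lambda>\<omega>. Z (z, \<omega>)) \<in> borel_measurable M" by measurable
    then have "(\<integral>\<^sup>+\<omega>. indicator (time_box n) z * ennreal (Z (z, \<omega>) ^ (2 * k)) \<partial>M) = indicator (time_box n) z * (\<integral>\<^sup>+\<omega>. ennreal (Z (z, \<omega>) ^ (2 * k)) \<partial>M)"
      by (intro nn_integral_cmult) measurable
    then show "(\<integral>\<^sup>+\<omega>. indicator (time_box n) z * ennreal (Z (z, \<omega>) ^ (2 * k)) \<partial>M) \<le> C * indicator (time_box n) z"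
      using slice[of z] by (cases "z \<in> time_box n") auto
  qed
  also have "\<dots> = C * emeasure lborel (time_box n)" by (rule nn_integral_cmult_indicator) simp
  also have "\<dots> < \<infinity>" using \<open>C < \<infinity>\<close> emeasure_time_box[of n] by (simp add: ennreal_mult_less_top)
  finally have lt: "(\<integral>\<^sup>+\<omega>. (\<integral>\<^sup>+z. indicator (time_box n) z * ennreal (Z (z, \<omega>) ^ (2 * k)) \<partial>lborel) \<partial>M) < \<infinity>" .
  have "AE \<omega> in M. (\<integral>\<^sup>+z. indicator (time_box n) z * ennreal (Z (z, \<omega>) ^ (2 * k)) \<partial>lborel) \<noteq> \<infinity>"
  proof (rule nn_integral_PInf_AE)
    show "(\<lambda>\<omega>. \<integral>\<^sup>+z. indicator (time_box n) z * ennreal (Z (z, \<omega>) ^ (2 * k)) \<partial>lborel) \<in> borel_measurable M" by measurable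
  qed (use lt in simp)
  then show "AE \<omega> in M. (\<integral>\<^sup>+z. indicator (time_box n) z * ennreal (Z (z, \<omega>) ^ (2 * k)) \<partial>lborel) < \<infinity>"
    by eventually_elim (simp add: less_top)
qed

end

theorem theorem8p2:
  fixes N :: "'o measure" and X :: "real \<Rightarrow> 'o \<Rightarrow> real"
    and M :: "'a measure" and w :: "(real \<times> real) set \<Rightarrow> 'a \<Rightarrow> real"
    and H :: "real \<Rightarrow> real \<Rightarrow> 'a \<Rightarrow> real" and b :: "real \<Rightarrow> real"
  assumes "levy_process N X"
    and "prob_space M" and "complete_measure M"
    and "white_noise M w"
    and "bounded (range b)" and "\<exists>L. L-lipschitz_on UNIV b"
    and "random_field_solution N X M w H"
  shows "\<exists>H' Hb.
    modification_of M H' H \<and> random_field M Hb \<and>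
    (AE \<omega> in M. \<forall>q\<ge>1. Lp_loc ({0..} \<times> UNIV) q (\<lambda>(t, x). Hb t x \<omega>)) \<and>
    (AE \<omega> in M. \<forall>t\<ge>0. \<forall>x.
       Hb t x \<omega> = H' t x \<omega> + drift_term (transition_density N X) b Hb t x \<omega>) \<and>
    (\<forall>T>0. AE \<omega> in M.
       bounded ((\<lambda>(t, x). drift_term (transition_density N X) b Hb t x \<omega>) ` ({0..T} \<times> UNIV)) \<and>
       continuous_on ({0..T} \<times> UNIV)
         (\<lambda>(t, x). drift_term (transition_density N X) b Hb t x \<omega>))"
proof -
  interpret heat N X M w
    using assms(1,2,4) by (simp add: heat_def levy_def noise_def noise_axioms_def)
  have ext: "weak_solution_extension N X M w t (dirac x) (H t x)" if "0 \<le> t" for t x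
    using assms(7) that by (simp add: random_field_solution_def)
  have H_measurable: "H t x \<in> borel_measurable M" if "0 \<le> t" for t x
    using ext[OF that, of x] by (auto simp: weak_solution_extension_def L2_limit_def)
  have fin: "total_weight t < \<infinity>" if "0 \<le> t" for t by (rule total_weight_finite[OF that ext[OF that]])
  define p where "p = transition_density N X"
  have "\<exists>p. is_transition_density N X p"
    by (rule L.transition_density_exists, rule exp_rate_integrable, rule fin) auto
  then have p: "is_transition_density N X p" unfolding p_def transition_density_def by (rule someI_ex)
  have p_total: "(\<integral>\<^sup>+x. ennreal (p t x) \<partial>lborel) = 1" if t: "0 < t" for t
  proof -
    have D: "distributed N lborel (X t) (\<lambda>x. ennreal (p t x))" using p t by (simp add: is_transition_density_def)
    then have Xm: "X t \<in> N \<rightarrow>\<^sub>M lborel" and [measurable]: "(\<lambda>x. ennreal (p t x)) \<in> borel_measurable lborel"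
      and dens: "distr N lborel (X t) = density lborel (\<lambda>x. ennreal (p t x))" by (simp_all add: distributed_def)
    have "(\<integral>\<^sup>+x. ennreal (p t x) \<partial>lborel) = emeasure (density lborel (\<lambda>x. ennreal (p t x))) UNIV"
      by (subst emeasure_density) simp_all
    also have "\<dots> = emeasure (distr N lborel (X t)) (space (distr N lborel (X t)))" by (simp add: dens)
    also have "\<dots> = 1" by (rule prob_space.emeasure_space_1[OF L.prob_space_distr[OF Xm]])
    finally show ?thesis .
  qed
  obtain B where B: "\<And>r. \<bar>b r\<bar> \<le> B" using assms(5) by (auto simp: bounded_iff)
  obtain Lb where Lb: "Lb-lipschitz_on UNIV b" using assms(6) by blast
  interpret D: lipschitz_drift p b B Lb
  proof
    show "continuous_on ({0<..} \<times> UNIV) (\<lambda>(t, x). p t x)"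
      by (rule continuous_on_half_plane) (use p in \<open>simp add: is_transition_density_def\<close>)
  qed (use p B Lb p_total in \<open>auto simp: is_transition_density_def\<close>)
  have "\<exists>Z :: real \<Rightarrow> real \<Rightarrow> 'a \<Rightarrow> real. (\<lambda>z. Z (fst (fst z)) (snd (fst z)) (snd z)) \<in> borel_measurable ((borel \<Otimes>\<^sub>M borel) \<Otimes>\<^sub>M M) \<and>
    (\<forall>t\<ge>0. \<forall>x. AE \<omega> in M. Z t x \<omega> = H t x \<omega>)"
  proof (rule jointly_measurable_modification[OF H_measurable])
    fix n :: nat
    \<comment> \<open>The added 1 keeps the horizon positive for \<open>n = 0\<close>. The divisor
      64 below cancels the constant of \<open>extension_increment_le\<close>.\<close>
    let ?T = "real n + 1"
    have "0 < ennreal ((1/2) ^ n / 64)" by simp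
    then obtain \<delta> where \<delta>: "\<delta> > 0" "\<And>h d. 0 \<le> h \<Longrightarrow> h < \<delta> \<Longrightarrow> \<bar>d\<bar> < \<delta> \<Longrightarrow> increment_energy ?T h d < ennreal ((1/2) ^ n / 64)"
      using increment_energy_small[OF fin, of ?T "ennreal ((1/2) ^ n / 64)"] by auto
    have "sq_norm M (\<lambda>\<omega>. H t x \<omega> - H t' x' \<omega>) \<le> ennreal ((1/2) ^ n)"
      if "0 \<le> t" "t \<le> t'" "t' \<le> real n" "t' - t < \<delta>" "\<bar>x' - x\<bar> < \<delta>" for t t' x x'
    proof -
      have "sq_norm M (\<lambda>\<omega>. H t x \<omega> - H t' x' \<omega>) \<le> 64 * increment_energy ?T (t' - t) (x' - x)"
        using that(3) by (intro extension_increment_le[OF that(1,2) _ ext[OF that(1)] ext[OF order_trans[OF that(1,2)]]]) simp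
      also have "\<dots> \<le> 64 * ennreal ((1/2) ^ n / 64)"
        using \<delta>(2)[of "t' - t" "x' - x"] that by (intro mult_left_mono) auto
      also have "\<dots> = ennreal (64 * ((1/2) ^ n / 64))" by (subst ennreal_mult') simp_all
      finally show ?thesis by simp
    qed
    then show "\<exists>\<delta>>0. \<forall>t t' x x'. 0 \<le> t \<longrightarrow> t \<le> t' \<longrightarrow> t' \<le> real n \<longrightarrow> t' - t < \<delta> \<longrightarrow> \<bar>x' - x\<bar> < \<delta> \<longrightarrow>
      sq_norm M (\<lambda>\<omega>. H t x \<omega> - H t' x' \<omega>) \<le> ennreal ((1/2) ^ n)" using \<delta>(1) by blast
  qed
  then obtain Z :: "real \<Rightarrow> real \<Rightarrow> 'a \<Rightarrow> real"
    where Z: "(\<lambda>z. Z (fst (fst z)) (snd (fst z)) (snd z)) \<in> borel_measurable ((borel \<Otimes>\<^sub>M borel) \<Otimes>\<^sub>M M)"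
      and Z_eq: "\<And>t x. 0 \<le> t \<Longrightarrow> AE \<omega> in M. Z t x \<omega> = H t x \<omega>" by blast
  define h where "h z = Z (fst (fst z)) (snd (fst z)) (snd z)" for z
  have h: "h \<in> borel_measurable ((borel \<Otimes>\<^sub>M borel) \<Otimes>\<^sub>M M)" unfolding h_def[abs_def] by (rule Z)
  obtain u where u: "u \<in> borel_measurable ((borel \<Otimes>\<^sub>M borel) \<Otimes>\<^sub>M M)"
    and u_eq: "\<And>\<omega> z. \<omega> \<in> space M \<Longrightarrow> 0 \<le> fst z \<Longrightarrow> u (z, \<omega>) = D.potential (\<lambda>v. b (h (v, \<omega>) + u (v, \<omega>))) z"
    using D.picard_solution[OF h] by blast
  define Hb where "Hb t x \<omega> = Z t x \<omega> + u ((t, x), \<omega>)" for t x \<omega>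
  let ?g = "\<lambda>\<omega> v. b (h (v, \<omega>) + u (v, \<omega>))"
  have g: "?g \<omega> \<in> borel_measurable (borel \<Otimes>\<^sub>M borel)" if "\<omega> \<in> space M" for \<omega>
    by (intro measurable_compose[OF _ D.b_measurable] borel_measurable_add D.slice_measurable[OF h that] D.slice_measurable[OF u that])
  \<comment> \<open>Along each path the drift of \<open>Hb\<close> is the very potential that
    determines \<open>u\<close>, so the equation, the bound and the continuity all hold path by
    path.\<close>
  have drift: "drift_term p b Hb t x \<omega> = D.potential (?g \<omega>) (t, x)" for t x \<omega>
    by (simp add: drift_term_def D.potential_def Hb_def h_def)
  have slice_omega: "(\<lambda>\<omega>. f ((t, x), \<omega>)) \<in> borel_measurable M" if "f \<in> borel_measurable ((borel \<Otimes>\<^sub>M borel) \<Otimes>\<^sub>M M)" for f :: "(real \<times> real) \<times> 'a \<Rightarrow> real" and t x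
    by (rule measurable_compose[OF _ that]) simp
  have Z_measurable: "Z t x \<in> borel_measurable M" for t x
    using slice_omega[OF h, of t x] by (simp add: h_def)
  have 1: "modification_of M Z H"
    unfolding modification_of_def random_field_def using Z_measurable Z_eq by blast
  have 2: "random_field M Hb"
    unfolding random_field_def Hb_def by (intro allI impI borel_measurable_add Z_measurable slice_omega[OF u])
  have u_bound: "\<bar>u (z, \<omega>)\<bar> \<le> B * fst z" if "\<omega> \<in> space M" "0 \<le> fst z" for \<omega> z
    unfolding u_eq[OF that] by (rule D.potential_bound[OF g[OF that(1)] B that(2)])
  have B0: "0 \<le> B" using B[of 0] by linarith
  \<comment> \<open>The quantifiers over \<open>n\<close> and \<open>k\<close> stand inside, so that
    the same null set works for every \<open>q\<close> below.\<close>
  have "AE \<omega> in M. \<forall>n k. (\<integral>\<^sup>+z. indicator (time_box n) z * ennreal (h (z, \<omega>) ^ (2 * k)) \<partial>lborel) < \<infinity>"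
    by (rule modification_even_moments_finite[OF h ext]) (use Z_eq in \<open>simp_all add: h_def\<close>)
  moreover have "AE \<omega> in M. \<omega> \<in> space M" by (rule AE_space)
  ultimately have 3: "AE \<omega> in M. \<forall>q\<ge>1. Lp_loc ({0..} \<times> UNIV) q (\<lambda>(t, x). Hb t x \<omega>)"
  proof eventually_elim
    case (elim \<omega>)
    show ?case
    proof (intro allI impI)
      fix q :: real assume q: "1 \<le> q"
      have "Lp_loc ({0..} \<times> UNIV) q (\<lambda>z. h (z, \<omega>) + u (z, \<omega>))"
      proof (rule Lp_loc_of_moments_plus_bounded[where C="\<lambda>n. B * real n"])
        show "(\<lambda>z. h (z, \<omega>)) \<in> borel_measurable borel" "(\<lambda>z. u (z, \<omega>)) \<in> borel_measurable borel"
          using D.slice_measurable[OF h elim(2)] D.slice_measurable[OF u elim(2)] by (simp_all add: borel_prod)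
        show "\<bar>u (z, \<omega>)\<bar> \<le> B * real n" if "z \<in> time_box n" for n z
        proof -
          have z: "0 \<le> fst z" "fst z \<le> real n" using that by (auto simp: time_box_def)
          show ?thesis using u_bound[OF elim(2) z(1)] mult_left_mono[OF z(2) B0] by linarith
        qed
      qed (use elim q in auto)
      also have "(\<lambda>z. h (z, \<omega>) + u (z, \<omega>)) = (\<lambda>(t, x). Hb t x \<omega>)"
        by (auto simp: fun_eq_iff Hb_def h_def)
      finally show "Lp_loc ({0..} \<times> UNIV) q (\<lambda>(t, x). Hb t x \<omega>)" .
    qed
  qed
  have 4: "AE \<omega> in M. \<forall>t\<ge>0. \<forall>x. Hb t x \<omega> = Z t x \<omega> + drift_term p b Hb t x \<omega>"
  proof (rule AE_I2, intro allI impI)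
    fix \<omega> and t x :: real assume "\<omega> \<in> space M" "0 \<le> t"
    then show "Hb t x \<omega> = Z t x \<omega> + drift_term p b Hb t x \<omega>"
      unfolding drift using u_eq[of \<omega> "(t, x)"] by (simp add: Hb_def)
  qed
  have 5: "AE \<omega> in M. bounded ((\<lambda>(t, x). drift_term p b Hb t x \<omega>) ` ({0..T} \<times> UNIV)) \<and>
       continuous_on ({0..T} \<times> UNIV) (\<lambda>(t, x). drift_term p b Hb t x \<omega>)" for T
  proof (rule AE_I2)
    fix \<omega> assume \<omega>: "\<omega> \<in> space M"
    have "(\<lambda>(t, x). drift_term p b Hb t x \<omega>) = D.potential (?g \<omega>)" by (auto simp: fun_eq_iff drift)
    moreover have "bounded (D.potential (?g \<omega>) ` ({0..T} \<times> UNIV))"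
      unfolding bounded_iff
    proof (intro exI[of _ "B * T"] ballI, elim imageE)
      fix y and z :: "real \<times> real" assume z: "z \<in> {0..T} \<times> UNIV" and y: "y = D.potential (?g \<omega>) z"
      have z: "0 \<le> fst z" "fst z \<le> T" using z by (auto simp: mem_Times_iff)
      show "norm y \<le> B * T"
        using D.potential_bound[OF g[OF \<omega>] B z(1)] mult_left_mono[OF z(2) B0] by (simp add: y)
    qed
    moreover have "continuous_on ({0..T} \<times> UNIV) (D.potential (?g \<omega>))"
      by (rule continuous_on_subset[OF D.potential_continuous[OF g[OF \<omega>] B]]) auto
    ultimately show "bounded ((\<lambda>(t, x). drift_term p b Hb t x \<omega>) ` ({0..T} \<times> UNIV)) \<and>
       continuous_on ({0..T} \<times> UNIV) (\<lambda>(t, x). drift_term p b Hb t x \<omega>)" by simp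
  qed
  from 1 2 3 4 5 show ?thesis unfolding p_def by blast
qed

end
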